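(* Let $k$ be any field. Then $HS(k)\supseteq PS(k)$ as subgroups of the Brauer group $Br(k)$, where $HS(k)$ is the Hopf-Schur group of $k$ and $PS(k)$ is the projective Schur group of $k$.
   Context: A $k$-central simple algebra is called Hopf-Schur over $k$ if it is a homomorphic image (as a $k$-algebra) of a finite dimensional Hopf algebra over $k$. The Hopf-Schur group $HS(k)$ is the subgroup of $Br(k)$ generated by (and in fact consisting of) the Brauer classes that may be represented by Hopf-Schur algebras over $k$. For a finite group $G$ and a 2-cocycle $\alpha\in Z^2(G,k^* )$ (trivial action), the twisted group algebra $k^\alpha G$ is the $k$-algebra with basis $\{U_\sigma\}_{\sigma\in G}$ and multiplication $U_\sigma U_\tau=\alpha(\sigma,\tau)U_{\sigma\tau}$. The projective Schur group $PS(k)$ is the subgroup of $Br(k)$ consisting of the Brauer classes that may be represented by $k$-central simple algebras which are homomorphic images of twisted group algebras $k^\alpha G$ for some finite group $G$ and some $\alpha\in Z^2(G,k^* )$. *)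

theory Defs
  imports "HOL-Algebra.Algebra"
begin

section \<open>Algebras over a field\<close>

text \<open>
  The locale \<^locale>\<open>algebra\<close> of HOL-Algebra is restricted to commutative algebras. Here an
  algebra is associative and unital, but not necessarily commutative. The ground ring is a field
  in all uses.
\<close>

locale assoc_algebra = module R M + ring M for R (structure) and M (structure) +
  assumes smult_mult_left:
      "\<lbrakk>a \<in> carrier R; x \<in> carrier M; y \<in> carrier M\<rbrakk> \<Longrightarrow>
        (a \<odot>\<^bsub>M\<^esub> x) \<otimes>\<^bsub>M\<^esub> y = a \<odot>\<^bsub>M\<^esub> (x \<otimes>\<^bsub>M\<^esub> y)"
    and smult_mult_right:
      "\<lbrakk>a \<in> carrier R; x \<in> carrier M; y \<in> carrier M\<rbrakk> \<Longrightarrow>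
        x \<otimes>\<^bsub>M\<^esub> (a \<odot>\<^bsub>M\<^esub> y) = a \<odot>\<^bsub>M\<^esub> (x \<otimes>\<^bsub>M\<^esub> y)"

definition linear_maps ::
  "('k, 'm) ring_scheme \<Rightarrow> ('k, 'a, 'n) module_scheme \<Rightarrow> ('k, 'b, 'p) module_scheme \<Rightarrow> ('a \<Rightarrow> 'b) set"
  where "linear_maps K V W =
    {f \<in> carrier V \<rightarrow> carrier W.
      (\<forall>x \<in> carrier V. \<forall>y \<in> carrier V. f (x \<oplus>\<^bsub>V\<^esub> y) = f x \<oplus>\<^bsub>W\<^esub> f y) \<and>
      (\<forall>c \<in> carrier K. \<forall>x \<in> carrier V. f (c \<odot>\<^bsub>V\<^esub> x) = c \<odot>\<^bsub>W\<^esub> f x)}"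

definition algebra_homs ::
  "('k, 'm) ring_scheme \<Rightarrow> ('k, 'a, 'n) module_scheme \<Rightarrow> ('k, 'b, 'p) module_scheme \<Rightarrow> ('a \<Rightarrow> 'b) set"
  where "algebra_homs K A B = ring_hom A B \<inter> linear_maps K A B"

definition algebra_iso ::
  "('k, 'm) ring_scheme \<Rightarrow> ('k, 'a, 'n) module_scheme \<Rightarrow> ('k, 'b, 'p) module_scheme \<Rightarrow> bool"
  where "algebra_iso K A B \<longleftrightarrow> (\<exists>f \<in> algebra_homs K A B. bij_betw f (carrier A) (carrier B))"

definition homomorphic_image ::
  "('k, 'm) ring_scheme \<Rightarrow> ('k, 'a, 'n) module_scheme \<Rightarrow> ('k, 'b, 'p) module_scheme \<Rightarrow> bool"
  where "homomorphic_image K B A \<longleftrightarrow> (\<exists>f \<in> algebra_homs K A B. f ` carrier A = carrier B)"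

definition finite_dimensional ::
  "('k, 'm) ring_scheme \<Rightarrow> ('k, 'a, 'n) module_scheme \<Rightarrow> bool"
  where "finite_dimensional K V \<longleftrightarrow>
    (\<exists>B. finite B \<and> B \<subseteq> carrier V \<and>
      (\<forall>v \<in> carrier V. \<exists>c \<in> B \<rightarrow> carrier K. v = (\<Oplus>\<^bsub>V\<^esub>b\<in>B. c b \<odot>\<^bsub>V\<^esub> b)))"

definition center :: "('a, 'm) ring_scheme \<Rightarrow> 'a set"
  where "center A = {z \<in> carrier A. \<forall>x \<in> carrier A. z \<otimes>\<^bsub>A\<^esub> x = x \<otimes>\<^bsub>A\<^esub> z}"

definition central_simple ::
  "('k, 'm) ring_scheme \<Rightarrow> ('k, 'a, 'n) module_scheme \<Rightarrow> bool"
  where "central_simple K A \<longleftrightarrow>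
    assoc_algebra K A \<and> finite_dimensional K A \<and>
    center A = (\<lambda>c. c \<odot>\<^bsub>A\<^esub> \<one>\<^bsub>A\<^esub>) ` carrier K \<and>
    carrier A \<noteq> {\<zero>\<^bsub>A\<^esub>} \<and>
    (\<forall>I. ideal I A \<longrightarrow> I = {\<zero>\<^bsub>A\<^esub>} \<or> I = carrier A)"

definition ground_algebra :: "('k, 'm) ring_scheme \<Rightarrow> ('k, 'k) module"
  where "ground_algebra K =
    \<lparr>carrier = carrier K, monoid.mult = monoid.mult K, one = \<one>\<^bsub>K\<^esub>,
     ring.zero = \<zero>\<^bsub>K\<^esub>, add = add K, smult = monoid.mult K\<rparr>"

definition matrix_algebra ::
  "nat \<Rightarrow> ('k, 'a, 'n) module_scheme \<Rightarrow> ('k, nat \<times> nat \<Rightarrow> 'a) module"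
  where "matrix_algebra n A = (let I = {..<n} \<times> {..<n} in
    \<lparr>carrier = I \<rightarrow>\<^sub>E carrier A,
     monoid.mult = (\<lambda>x y. \<lambda>(i, j) \<in> I. \<Oplus>\<^bsub>A\<^esub>l\<in>{..<n}. x (i, l) \<otimes>\<^bsub>A\<^esub> y (l, j)),
     one = (\<lambda>(i, j) \<in> I. if i = j then \<one>\<^bsub>A\<^esub> else \<zero>\<^bsub>A\<^esub>),
     ring.zero = (\<lambda>_ \<in> I. \<zero>\<^bsub>A\<^esub>),
     add = (\<lambda>x y. \<lambda>p \<in> I. x p \<oplus>\<^bsub>A\<^esub> y p),
     smult = (\<lambda>c x. \<lambda>p \<in> I. c \<odot>\<^bsub>A\<^esub> x p)\<rparr>)"


section \<open>Tensor products\<close>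

text \<open>
  Over a field, bilinear forms separate the elements of \<open>V \<otimes> W\<close>. Hence the tensor product may be
  realised inside the dual of the space of bilinear forms, with \<open>v \<otimes> w\<close> the evaluation
  \<open>\<phi> \<mapsto> \<phi>(v, w)\<close>, and its elements are the finite sums of such evaluations.
\<close>

definition bilinear_forms ::
  "('k, 'm) ring_scheme \<Rightarrow> ('k, 'a, 'n) module_scheme \<Rightarrow> ('k, 'b, 'p) module_scheme
    \<Rightarrow> ('a \<Rightarrow> 'b \<Rightarrow> 'k) set"
  where "bilinear_forms K V W =
    {\<phi>. (\<forall>v \<in> carrier V. (\<lambda>w. \<phi> v w) \<in> linear_maps K W (ground_algebra K)) \<and>
        (\<forall>w \<in> carrier W. (\<lambda>v. \<phi> v w) \<in> linear_maps K V (ground_algebra K))}"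

type_synonym ('k, 'a, 'b) tensor = "('a \<Rightarrow> 'b \<Rightarrow> 'k) \<Rightarrow> 'k"

definition pure_tensor ::
  "('k, 'm) ring_scheme \<Rightarrow> ('k, 'a, 'n) module_scheme \<Rightarrow> ('k, 'b, 'p) module_scheme
    \<Rightarrow> 'a \<Rightarrow> 'b \<Rightarrow> ('k, 'a, 'b) tensor"
  where "pure_tensor K V W v w = (\<lambda>\<phi> \<in> bilinear_forms K V W. \<phi> v w)"

text \<open>
  The product below is the one with \<open>(a \<otimes> b)(c \<otimes> d) = ac \<otimes> bd\<close>: on sums of pure tensors \<open>s\<close> and
  \<open>t\<close>, the functional \<open>s t\<close> sends \<open>\<phi>\<close> to the sum of the values \<open>\<phi>(ac, bd)\<close>
  (see \<open>tensor_mult_pure\<close>).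
\<close>

definition tensor_algebra ::
  "('k, 'm) ring_scheme \<Rightarrow> ('k, 'a, 'n) module_scheme \<Rightarrow> ('k, 'b, 'p) module_scheme
    \<Rightarrow> ('k, ('k, 'a, 'b) tensor) module"
  where "tensor_algebra K A B = (let F = bilinear_forms K A B in
    \<lparr>carrier = {\<lambda>\<phi> \<in> F. \<Oplus>\<^bsub>K\<^esub>i\<in>{..<n}. \<phi> (a i) (b i) | (n::nat) a b.
                a \<in> {..<n} \<rightarrow> carrier A \<and> b \<in> {..<n} \<rightarrow> carrier B},
     monoid.mult = (\<lambda>s t. \<lambda>\<phi> \<in> F. s (\<lambda>a b. t (\<lambda>c d. \<phi> (a \<otimes>\<^bsub>A\<^esub> c) (b \<otimes>\<^bsub>B\<^esub> d)))),
     one = pure_tensor K A B \<one>\<^bsub>A\<^esub> \<one>\<^bsub>B\<^esub>,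
     ring.zero = (\<lambda>\<phi> \<in> F. \<zero>\<^bsub>K\<^esub>),
     add = (\<lambda>s t. \<lambda>\<phi> \<in> F. s \<phi> \<oplus>\<^bsub>K\<^esub> t \<phi>),
     smult = (\<lambda>c t. \<lambda>\<phi> \<in> F. c \<otimes>\<^bsub>K\<^esub> t \<phi>)\<rparr>)"

text \<open>
  \<open>tensor_lift K V W Z \<beta>\<close> is the linear map \<open>V \<otimes> W \<rightarrow> Z\<close> induced by a bilinear map
  \<open>\<beta> : V \<times> W \<rightarrow> Z\<close>.
\<close>

definition tensor_lift ::
  "('k, 'm) ring_scheme \<Rightarrow> ('k, 'a, 'n) module_scheme \<Rightarrow> ('k, 'b, 'p) module_scheme
    \<Rightarrow> ('k, 'c, 'q) module_scheme \<Rightarrow> ('a \<Rightarrow> 'b \<Rightarrow> 'c) \<Rightarrow> ('k, 'a, 'b) tensor \<Rightarrow> 'c"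
  where "tensor_lift K V W Z \<beta> =
    (THE f. f \<in> linear_maps K (tensor_algebra K V W) Z \<and>
            f \<in> extensional (carrier (tensor_algebra K V W)) \<and>
            (\<forall>v \<in> carrier V. \<forall>w \<in> carrier W. f (pure_tensor K V W v w) = \<beta> v w))"

lemma tensor_mult_pure:
  assumes "assoc_algebra K A" "assoc_algebra K B"
    and "a \<in> carrier A" "b \<in> carrier B" "c \<in> carrier A" "d \<in> carrier B"
  shows "pure_tensor K A B a b \<otimes>\<^bsub>tensor_algebra K A B\<^esub> pure_tensor K A B c d =
    pure_tensor K A B (a \<otimes>\<^bsub>A\<^esub> c) (b \<otimes>\<^bsub>B\<^esub> d)"
proof -
  interpret A: assoc_algebra K A by fact
  interpret B: assoc_algebra K B by fact
  have form: "(\<lambda>c d. \<phi> (a' \<otimes>\<^bsub>A\<^esub> c) (b' \<otimes>\<^bsub>B\<^esub> d)) \<in> bilinear_forms K A B"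
    if "\<phi> \<in> bilinear_forms K A B" "a' \<in> carrier A" "b' \<in> carrier B" for \<phi> a' b'
    using that
    by (auto simp: bilinear_forms_def linear_maps_def Pi_def A.r_distr B.r_distr
        A.smult_mult_right B.smult_mult_right)
  have outer: "(\<lambda>a b. pure_tensor K A B c d (\<lambda>c d. \<phi> (a \<otimes>\<^bsub>A\<^esub> c) (b \<otimes>\<^bsub>B\<^esub> d)))
      \<in> bilinear_forms K A B" if "\<phi> \<in> bilinear_forms K A B" for \<phi>
  proof -
    have "(\<lambda>a b. \<phi> (a \<otimes>\<^bsub>A\<^esub> c) (b \<otimes>\<^bsub>B\<^esub> d)) \<in> bilinear_forms K A B"
      using that assms(5,6)
      by (auto simp: bilinear_forms_def linear_maps_def Pi_def A.l_distr B.l_distr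
          A.smult_mult_left B.smult_mult_left)
    moreover have "pure_tensor K A B c d (\<lambda>c d. \<phi> (a' \<otimes>\<^bsub>A\<^esub> c) (b' \<otimes>\<^bsub>B\<^esub> d))
        = \<phi> (a' \<otimes>\<^bsub>A\<^esub> c) (b' \<otimes>\<^bsub>B\<^esub> d)" if "a' \<in> carrier A" "b' \<in> carrier B" for a' b'
      using form[OF \<open>\<phi> \<in> _\<close> that] by (simp add: pure_tensor_def)
    ultimately show ?thesis
      by (simp add: bilinear_forms_def linear_maps_def Pi_def)
  qed
  show ?thesis
    using form outer assms(3-6)
    by (auto simp: tensor_algebra_def pure_tensor_def Let_def fun_eq_iff restrict_def)
qed


section \<open>Hopf algebras and twisted group algebras\<close>

text \<open>
  The tensor product \<open>H \<otimes> (H \<otimes> H)\<close> is used for the coassociativity law; on its left-hand side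
  \<open>(x \<otimes> y) \<otimes> b\<close> is identified with \<open>x \<otimes> (y \<otimes> b)\<close>.
\<close>

locale hopf_algebra = assoc_algebra K H
  for K :: "('k, 'm) ring_scheme" (structure) and H :: "('k, 'a, 'n) module_scheme" (structure) +
  fixes \<Delta> :: "'a \<Rightarrow> ('k, 'a, 'a) tensor" and \<epsilon> :: "'a \<Rightarrow> 'k" and S :: "'a \<Rightarrow> 'a"
  assumes comult: "\<Delta> \<in> algebra_homs K H (tensor_algebra K H H)"
    and counit: "\<epsilon> \<in> algebra_homs K H (ground_algebra K)"
    and antipode: "S \<in> linear_maps K H H"
    and coassoc: "h \<in> carrier H \<Longrightarrow>
      tensor_lift K H H (tensor_algebra K H (tensor_algebra K H H))
        (\<lambda>a b. tensor_lift K H H (tensor_algebra K H (tensor_algebra K H H))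
          (\<lambda>x y. pure_tensor K H (tensor_algebra K H H) x (pure_tensor K H H y b)) (\<Delta> a)) (\<Delta> h)
      = tensor_lift K H H (tensor_algebra K H (tensor_algebra K H H))
        (\<lambda>a b. pure_tensor K H (tensor_algebra K H H) a (\<Delta> b)) (\<Delta> h)"
    and counit_left: "h \<in> carrier H \<Longrightarrow> tensor_lift K H H H (\<lambda>a b. \<epsilon> a \<odot>\<^bsub>H\<^esub> b) (\<Delta> h) = h"
    and counit_right: "h \<in> carrier H \<Longrightarrow> tensor_lift K H H H (\<lambda>a b. \<epsilon> b \<odot>\<^bsub>H\<^esub> a) (\<Delta> h) = h"
    and antipode_left: "h \<in> carrier H \<Longrightarrow>
      tensor_lift K H H H (\<lambda>a b. S a \<otimes>\<^bsub>H\<^esub> b) (\<Delta> h) = \<epsilon> h \<odot>\<^bsub>H\<^esub> \<one>\<^bsub>H\<^esub>"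
    and antipode_right: "h \<in> carrier H \<Longrightarrow>
      tensor_lift K H H H (\<lambda>a b. a \<otimes>\<^bsub>H\<^esub> S b) (\<Delta> h) = \<epsilon> h \<odot>\<^bsub>H\<^esub> \<one>\<^bsub>H\<^esub>"

definition two_cocycles ::
  "('k, 'm) ring_scheme \<Rightarrow> ('g, 'n) monoid_scheme \<Rightarrow> ('g \<Rightarrow> 'g \<Rightarrow> 'k) set"
  where "two_cocycles K G =
    {\<alpha> \<in> carrier G \<rightarrow> carrier G \<rightarrow> Units K.
      \<forall>\<sigma> \<in> carrier G. \<forall>\<tau> \<in> carrier G. \<forall>\<rho> \<in> carrier G.
        \<alpha> \<sigma> \<tau> \<otimes>\<^bsub>K\<^esub> \<alpha> (\<sigma> \<otimes>\<^bsub>G\<^esub> \<tau>) \<rho> = \<alpha> \<tau> \<rho> \<otimes>\<^bsub>K\<^esub> \<alpha> \<sigma> (\<tau> \<otimes>\<^bsub>G\<^esub> \<rho>)}"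

text \<open>
  An element \<open>x\<close> stands for the sum of the \<open>x(\<sigma>) U\<^sub>\<sigma>\<close>. Cocycles are not assumed to be normalised,
  so the unit element is \<open>\<alpha>(1,1)\<inverse> U\<^sub>1\<close>. In the product, the coefficient of \<open>U\<^sub>\<rho>\<close> collects the
  terms \<open>U\<^sub>\<sigma> U\<^sub>\<tau>\<close> with \<open>\<sigma>\<tau> = \<rho>\<close>, that is, \<open>\<tau> = \<sigma>\<inverse>\<rho>\<close>. Only finite groups are used.
\<close>

definition twisted_group_algebra ::
  "('k, 'm) ring_scheme \<Rightarrow> ('g, 'n) monoid_scheme \<Rightarrow> ('g \<Rightarrow> 'g \<Rightarrow> 'k) \<Rightarrow> ('k, 'g \<Rightarrow> 'k) module"
  where "twisted_group_algebra K G \<alpha> =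
    \<lparr>carrier = carrier G \<rightarrow>\<^sub>E carrier K,
     monoid.mult = (\<lambda>x y. \<lambda>\<rho> \<in> carrier G.
       \<Oplus>\<^bsub>K\<^esub>\<sigma>\<in>carrier G. x \<sigma> \<otimes>\<^bsub>K\<^esub> y (inv\<^bsub>G\<^esub> \<sigma> \<otimes>\<^bsub>G\<^esub> \<rho>) \<otimes>\<^bsub>K\<^esub> \<alpha> \<sigma> (inv\<^bsub>G\<^esub> \<sigma> \<otimes>\<^bsub>G\<^esub> \<rho>)),
     one = (\<lambda>\<rho> \<in> carrier G. if \<rho> = \<one>\<^bsub>G\<^esub> then inv\<^bsub>K\<^esub> \<alpha> \<one>\<^bsub>G\<^esub> \<one>\<^bsub>G\<^esub> else \<zero>\<^bsub>K\<^esub>),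
     ring.zero = (\<lambda>_ \<in> carrier G. \<zero>\<^bsub>K\<^esub>),
     add = (\<lambda>x y. \<lambda>\<rho> \<in> carrier G. x \<rho> \<oplus>\<^bsub>K\<^esub> y \<rho>),
     smult = (\<lambda>c x. \<lambda>\<rho> \<in> carrier G. c \<otimes>\<^bsub>K\<^esub> x \<rho>)\<rparr>"

text \<open>
  The existential quantifiers over Hopf algebras and groups below have to range over a fixed type.
  This is no restriction: a finite-dimensional algebra has an isomorphic copy whose elements
  are coordinate vectors, and these embed into \<^typ>\<open>nat \<Rightarrow> 'k\<close>; a finite group has an isomorphic
  copy on natural numbers.
\<close>

definition hopf_schur_algebra ::
  "('k, 'm) ring_scheme \<Rightarrow> ('k, 'a, 'n) module_scheme \<Rightarrow> bool"
  where "hopf_schur_algebra K A \<longleftrightarrow>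
    central_simple K A \<and>
    (\<exists>(H :: ('k, nat \<Rightarrow> 'k) module) \<Delta> \<epsilon> S.
      hopf_algebra K H \<Delta> \<epsilon> S \<and> finite_dimensional K H \<and> homomorphic_image K A H)"

definition projective_schur_algebra ::
  "('k, 'm) ring_scheme \<Rightarrow> ('k, 'a, 'n) module_scheme \<Rightarrow> bool"
  where "projective_schur_algebra K A \<longleftrightarrow>
    central_simple K A \<and>
    (\<exists>(G :: nat monoid) \<alpha>. group G \<and> finite (carrier G) \<and> \<alpha> \<in> two_cocycles K G \<and>
      homomorphic_image K A (twisted_group_algebra K G \<alpha>))"


section \<open>The Brauer group and the two subgroups\<close>

definition brauer_equivalent ::
  "('k, 'm) ring_scheme \<Rightarrow> ('k, 'a, 'n) module_scheme \<Rightarrow> ('k, 'b, 'p) module_scheme \<Rightarrow> bool"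
  where "brauer_equivalent K A B \<longleftrightarrow>
    (\<exists>m n. m > 0 \<and> n > 0 \<and> algebra_iso K (matrix_algebra m A) (matrix_algebra n B))"

text \<open>
  Brauer classes consist of the central simple algebras on the type \<^typ>\<open>nat \<Rightarrow> 'k\<close>, which contains
  a copy of every finite-dimensional algebra. The algebra \<open>A\<close> itself may live on any type.
\<close>

definition brauer_class ::
  "('k, 'm) ring_scheme \<Rightarrow> ('k, 'a, 'n) module_scheme \<Rightarrow> ('k, nat \<Rightarrow> 'k) module set"
  where "brauer_class K A = {B. central_simple K B \<and> brauer_equivalent K B A}"

definition brauer_group ::
  "('k, 'm) ring_scheme \<Rightarrow> ('k, nat \<Rightarrow> 'k) module set monoid"
  where "brauer_group K =
    \<lparr>carrier = {brauer_class K A | A :: ('k, nat \<Rightarrow> 'k) module. central_simple K A},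
     monoid.mult = (\<lambda>C D. \<Union>A\<in>C. \<Union>B\<in>D. brauer_class K (tensor_algebra K A B)),
     one = brauer_class K (ground_algebra K)\<rparr>"

definition hopf_schur_group ::
  "('k, 'm) ring_scheme \<Rightarrow> ('k, nat \<Rightarrow> 'k) module set set"
  where "hopf_schur_group K =
    generate (brauer_group K) {C \<in> carrier (brauer_group K). \<exists>A \<in> C. hopf_schur_algebra K A}"

definition projective_schur_group ::
  "('k, 'm) ring_scheme \<Rightarrow> ('k, nat \<Rightarrow> 'k) module set set"
  where "projective_schur_group K =
    {C \<in> carrier (brauer_group K). \<exists>A \<in> C. projective_schur_algebra K A}"

end

theory Submission
  imports Defs
begin

text \<open>
  Every central simple image of a twisted group algebra \<open>K\<^sup>\<alpha>G\<close> of a finite group is already an image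
  of a finite-dimensional Hopf algebra, so each class in the projective Schur group is one of the
  generators of the Hopf-Schur group. It suffices to find a finite-dimensional Hopf algebra that
  maps onto \<open>K\<^sup>\<alpha>G\<close>.

  A single \<open>K\<^sup>\<alpha>G\<close> need not carry a Hopf structure, but the powers of \<open>\<alpha>\<close> belong together:
  sending each basis element \<open>U\<close> to \<open>U \<otimes> U\<close> defines an algebra map from the twisted group algebra
  of \<open>\<alpha>\<^bsup>i+j\<^esup>\<close> to the tensor product of those of \<open>\<alpha>\<^sup>i\<close> and \<open>\<alpha>\<^sup>j\<close>. Adding up these maps over all
  \<open>i + j = m\<close> suggests a comultiplication on the sum of all the algebras, but over the integers this is
  an infinite sum. To make it finite, choose \<open>n > 1\<close> such that \<open>\<alpha>\<^sup>n\<close> is a coboundary,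
  say \<open>\<alpha>\<^sup>n(s, t) = \<mu>(s) \<mu>(t) / \<mu>(st)\<close>; this is possible because the class of \<open>\<alpha>\<close> is killed by the order
  of \<open>G\<close> (\<open>two_cocycle_pow_card\<close>). Rescaling basis elements by \<open>\<mu>\<close> identifies the
  algebra of \<open>\<alpha>\<^bsup>i+n\<^esup>\<close> with that of \<open>\<alpha>\<^sup>i\<close>, so that \<open>i\<close> may be taken modulo \<open>n\<close>. The result is an
  algebra \<open>H\<close> with basis \<open>e\<^sub>i(s)\<close>, where \<open>i\<close> is an integer modulo \<open>n\<close> and \<open>s \<in> G\<close>. Its comultiplication
  sends \<open>e\<^sub>m(s)\<close> to the sum over \<open>i + j = m\<close> modulo \<open>n\<close> of the \<open>e\<^sub>i(s) \<otimes> e\<^sub>j(s)\<close>, with a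
  factor \<open>1 / \<mu>(s)\<close> whenever the addition of \<open>i\<close> and \<open>j\<close> produces a carry. The component of index \<open>1\<close>
  is \<open>K\<^sup>\<alpha>G\<close>, onto which \<open>H\<close> projects.

  The Hopf axioms only use a symmetric set of conditions on the two families of structure constants,
  one consisting of two-cocycles on \<open>G\<close> and one of two-cocycles on the group of indices. They are
  therefore proved for the bicrossed product of an arbitrary pair of finite groups
  (\<open>hopf_algebra_H\<close>). All axioms are identities between linear maps, checked on basis elements; this
  rests on a description of the maps induced on \<open>M \<otimes> M\<close> for a space \<open>M\<close> with a finite basis
  (\<open>tensor_lift_linear\<close> and \<open>tensor_lift_pure\<close>).
\<close>


section \<open>Linear and bilinear maps\<close>

lemma linear_mapsI:
  assumes "\<And>x. x \<in> carrier V \<Longrightarrow> f x \<in> carrier W"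
    and "\<And>x y. \<lbrakk>x \<in> carrier V; y \<in> carrier V\<rbrakk> \<Longrightarrow> f (x \<oplus>\<^bsub>V\<^esub> y) = f x \<oplus>\<^bsub>W\<^esub> f y"
    and "\<And>c x. \<lbrakk>c \<in> carrier K; x \<in> carrier V\<rbrakk> \<Longrightarrow> f (c \<odot>\<^bsub>V\<^esub> x) = c \<odot>\<^bsub>W\<^esub> f x"
  shows "f \<in> linear_maps K V W"
  using assms by (auto simp: linear_maps_def)

lemma linear_maps_closed: "\<lbrakk>f \<in> linear_maps K V W; x \<in> carrier V\<rbrakk> \<Longrightarrow> f x \<in> carrier W"
  by (auto simp: linear_maps_def)

lemma linear_maps_add:
  "\<lbrakk>f \<in> linear_maps K V W; x \<in> carrier V; y \<in> carrier V\<rbrakk> \<Longrightarrow> f (x \<oplus>\<^bsub>V\<^esub> y) = f x \<oplus>\<^bsub>W\<^esub> f y"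
  by (auto simp: linear_maps_def)

lemma linear_maps_smult:
  "\<lbrakk>f \<in> linear_maps K V W; c \<in> carrier K; x \<in> carrier V\<rbrakk> \<Longrightarrow> f (c \<odot>\<^bsub>V\<^esub> x) = c \<odot>\<^bsub>W\<^esub> f x"
  by (auto simp: linear_maps_def)

lemma linear_maps_id: "(\<lambda>x. x) \<in> linear_maps K V V"
  by (simp add: linear_maps_def)

lemma linear_maps_comp:
  assumes "f \<in> linear_maps K U V" "g \<in> linear_maps K V W"
  shows "(\<lambda>x. g (f x)) \<in> linear_maps K U W"
  using assms by (auto simp: linear_maps_def Pi_def)

lemma linear_maps_zero:
  assumes "module K V" "module K W" "f \<in> linear_maps K V W"
  shows "f \<zero>\<^bsub>V\<^esub> = \<zero>\<^bsub>W\<^esub>"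
proof -
  interpret V: module K V by fact
  interpret W: module K W by fact
  have "f (\<zero>\<^bsub>K\<^esub> \<odot>\<^bsub>V\<^esub> \<zero>\<^bsub>V\<^esub>) = \<zero>\<^bsub>K\<^esub> \<odot>\<^bsub>W\<^esub> f \<zero>\<^bsub>V\<^esub>"
    using assms(3) by (rule linear_maps_smult) auto
  then show ?thesis
    using linear_maps_closed[OF assms(3)] by simp
qed

lemma linear_maps_finsum:
  assumes "module K V" "module K W" and f: "f \<in> linear_maps K V W"
    and "finite S" "g \<in> S \<rightarrow> carrier V"
  shows "f (\<Oplus>\<^bsub>V\<^esub>s\<in>S. g s) = (\<Oplus>\<^bsub>W\<^esub>s\<in>S. f (g s))"
proof -
  interpret V: module K V by fact
  interpret W: module K W by fact
  show ?thesis
    using assms(4,5)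
  proof (induction S rule: finite_induct)
    case empty
    then show ?case by (simp add: linear_maps_zero[OF assms(1,2) f])
  next
    case (insert s S)
    then have "(\<lambda>s. f (g s)) \<in> insert s S \<rightarrow> carrier W"
      using linear_maps_closed[OF f] by auto
    with insert show ?case
      by (auto simp: linear_maps_add[OF f] V.finsum_closed Pi_def)
  qed
qed

lemma linear_maps_cong:
  assumes "module K V" "f \<in> linear_maps K V W" "\<And>x. x \<in> carrier V \<Longrightarrow> g x = f x"
  shows "g \<in> linear_maps K V W"
proof -
  interpret V: module K V by fact
  show ?thesis
    using assms(2) by (auto simp: linear_maps_def Pi_def assms(3))
qed

lemma linear_maps_plus:
  assumes "module K Z" "f \<in> linear_maps K V Z" "g \<in> linear_maps K V Z"
  shows "(\<lambda>x. f x \<oplus>\<^bsub>Z\<^esub> g x) \<in> linear_maps K V Z"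
proof -
  interpret Z: module K Z by fact
  show ?thesis
    using assms(2,3) by (intro linear_mapsI)
      (auto simp: linear_maps_closed linear_maps_add linear_maps_smult Z.a_ac Z.smult_r_distr)
qed

lemma linear_maps_const_zero:
  assumes "module K Z"
  shows "(\<lambda>x. \<zero>\<^bsub>Z\<^esub>) \<in> linear_maps K V Z"
proof -
  interpret Z: module K Z by fact
  show ?thesis by (intro linear_mapsI) auto
qed

lemma linear_maps_finsum_fun:
  assumes "module K V" "module K Z" "finite S" "\<And>s. s \<in> S \<Longrightarrow> f s \<in> linear_maps K V Z"
  shows "(\<lambda>x. \<Oplus>\<^bsub>Z\<^esub>s\<in>S. f s x) \<in> linear_maps K V Z"
proof -
  interpret V: module K V by fact
  interpret Z: module K Z by fact
  have closed: "f s x \<in> carrier Z" if "s \<in> S" "x \<in> carrier V" for s x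
    using assms(4)[OF that(1)] that(2) by (rule linear_maps_closed)
  show ?thesis
  proof (rule linear_mapsI)
    fix x y c assume x: "x \<in> carrier V"
    show "(\<Oplus>\<^bsub>Z\<^esub>s\<in>S. f s x) \<in> carrier Z"
      using x closed by auto
    show "(\<Oplus>\<^bsub>Z\<^esub>s\<in>S. f s (x \<oplus>\<^bsub>V\<^esub> y)) = (\<Oplus>\<^bsub>Z\<^esub>s\<in>S. f s x) \<oplus>\<^bsub>Z\<^esub> (\<Oplus>\<^bsub>Z\<^esub>s\<in>S. f s y)"
      if "y \<in> carrier V"
    proof -
      have "(\<Oplus>\<^bsub>Z\<^esub>s\<in>S. f s (x \<oplus>\<^bsub>V\<^esub> y)) = (\<Oplus>\<^bsub>Z\<^esub>s\<in>S. f s x \<oplus>\<^bsub>Z\<^esub> f s y)"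
        using x that closed by (intro Z.finsum_cong') (auto simp: linear_maps_add[OF assms(4)])
      then show ?thesis
        using x that closed by (simp add: Pi_def)
    qed
    show "(\<Oplus>\<^bsub>Z\<^esub>s\<in>S. f s (c \<odot>\<^bsub>V\<^esub> x)) = c \<odot>\<^bsub>Z\<^esub> (\<Oplus>\<^bsub>Z\<^esub>s\<in>S. f s x)" if "c \<in> carrier K"
      using x that closed assms(3)
      by (subst Z.finsum_smult_ldistr)
        (auto simp: linear_maps_smult[OF assms(4)] intro!: Z.finsum_cong')
  qed
qed

lemma (in abelian_monoid) finsum_swap:
  assumes "finite A" "finite B" "\<And>a b. \<lbrakk>a \<in> A; b \<in> B\<rbrakk> \<Longrightarrow> f a b \<in> carrier G"
  shows "(\<Oplus>a\<in>A. \<Oplus>b\<in>B. f a b) = (\<Oplus>b\<in>B. \<Oplus>a\<in>A. f a b)"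
  using assms(1,3)
proof (induction A rule: finite_induct)
  case empty
  then show ?case by (simp add: add.finprod_one_eqI)
next
  case (insert a A)
  then have "(\<Oplus>a'\<in>insert a A. \<Oplus>b\<in>B. f a' b) = (\<Oplus>b\<in>B. f a b) \<oplus> (\<Oplus>b\<in>B. \<Oplus>a'\<in>A. f a' b)"
    by (auto simp: Pi_def)
  also have "\<dots> = (\<Oplus>b\<in>B. f a b \<oplus> (\<Oplus>a'\<in>A. f a' b))"
    using insert by (auto simp: Pi_def intro!: finsum_addf[symmetric])
  also have "\<dots> = (\<Oplus>b\<in>B. \<Oplus>a'\<in>insert a A. f a' b)"
    using insert by (intro finsum_cong') (auto simp: Pi_def)
  finally show ?case .
qed

lemma (in group) finsum_translate:
  assumes "abelian_monoid Z" "j \<in> carrier G" "f \<in> carrier G \<rightarrow> carrier Z"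
  shows "(\<Oplus>\<^bsub>Z\<^esub>i\<in>carrier G. f i) = (\<Oplus>\<^bsub>Z\<^esub>k\<in>carrier G. f (j \<otimes> k))"
proof -
  interpret Z: abelian_monoid Z by fact
  have "(\<lambda>k. j \<otimes> k) ` carrier G = carrier G"
    using assms(2) by (rule surj_const_mult)
  then show ?thesis
    using Z.finsum_reindex[of f "\<lambda>k. j \<otimes> k" "carrier G"] assms(3) assms(2)
      inj_on_cmult[of j] by simp
qed

lemma (in group) finsum_inverse:
  assumes "abelian_monoid Z" "f \<in> carrier G \<rightarrow> carrier Z"
  shows "(\<Oplus>\<^bsub>Z\<^esub>i\<in>carrier G. f i) = (\<Oplus>\<^bsub>Z\<^esub>k\<in>carrier G. f (inv k))"
proof -
  interpret Z: abelian_monoid Z by fact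
  have "(\<lambda>k. inv k) ` carrier G = carrier G"
    using inv_inv inv_closed by (metis image_eqI subsetI subset_antisym image_subsetI)
  moreover have "inj_on (\<lambda>k. inv k) (carrier G)"
    by (rule inj_onI) (metis inv_inv)
  ultimately show ?thesis
    using Z.finsum_reindex[of f "\<lambda>k. inv k" "carrier G"] assms(2) by simp
qed

definition bilinear_maps ::
  "('k, 'm) ring_scheme \<Rightarrow> ('k, 'a, 'n) module_scheme \<Rightarrow> ('k, 'b, 'p) module_scheme
    \<Rightarrow> ('k, 'c, 'q) module_scheme \<Rightarrow> ('a \<Rightarrow> 'b \<Rightarrow> 'c) set"
  where "bilinear_maps K V W Z =
    {\<beta>. (\<forall>v \<in> carrier V. (\<lambda>w. \<beta> v w) \<in> linear_maps K W Z) \<and>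
        (\<forall>w \<in> carrier W. (\<lambda>v. \<beta> v w) \<in> linear_maps K V Z)}"

lemma bilinear_maps_left:
  "\<lbrakk>\<beta> \<in> bilinear_maps K V W Z; w \<in> carrier W\<rbrakk> \<Longrightarrow> (\<lambda>v. \<beta> v w) \<in> linear_maps K V Z"
  by (simp add: bilinear_maps_def)

lemma bilinear_maps_right:
  "\<lbrakk>\<beta> \<in> bilinear_maps K V W Z; v \<in> carrier V\<rbrakk> \<Longrightarrow> (\<lambda>w. \<beta> v w) \<in> linear_maps K W Z"
  by (simp add: bilinear_maps_def)

lemma bilinear_maps_closed:
  "\<lbrakk>\<beta> \<in> bilinear_maps K V W Z; v \<in> carrier V; w \<in> carrier W\<rbrakk> \<Longrightarrow> \<beta> v w \<in> carrier Z"
  by (auto simp: bilinear_maps_def linear_maps_def)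

lemma bilinear_maps_comp:
  assumes "\<beta> \<in> bilinear_maps K V W Z" "f \<in> linear_maps K V' V" "g \<in> linear_maps K W' W"
    "h \<in> linear_maps K Z Z'"
  shows "(\<lambda>v w. h (\<beta> (f v) (g w))) \<in> bilinear_maps K V' W' Z'"
  using assms by (auto simp: bilinear_maps_def linear_maps_def Pi_def)

lemma linear_maps_finsum_bilinear:
  assumes "module K V" "module K W" "module K Z" "\<beta> \<in> bilinear_maps K V W Z"
    and "finite S" "finite S'" "g \<in> S \<rightarrow> carrier V" "h \<in> S' \<rightarrow> carrier W"
  shows "\<beta> (\<Oplus>\<^bsub>V\<^esub>s\<in>S. g s) (\<Oplus>\<^bsub>W\<^esub>t\<in>S'. h t) = (\<Oplus>\<^bsub>Z\<^esub>s\<in>S. \<Oplus>\<^bsub>Z\<^esub>t\<in>S'. \<beta> (g s) (h t))"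
proof -
  interpret V: module K V by fact
  interpret W: module K W by fact
  interpret Z: module K Z by fact
  have gs: "g s \<in> carrier V" if "s \<in> S" for s using assms(7) that by auto
  have ht: "h t \<in> carrier W" if "t \<in> S'" for t using assms(8) that by auto
  have "(\<Oplus>\<^bsub>W\<^esub>t\<in>S'. h t) \<in> carrier W"
    using assms(8) by auto
  from linear_maps_finsum[OF assms(1,3) bilinear_maps_left[OF assms(4) this] assms(5,7)]
  have "\<beta> (\<Oplus>\<^bsub>V\<^esub>s\<in>S. g s) (\<Oplus>\<^bsub>W\<^esub>t\<in>S'. h t) = (\<Oplus>\<^bsub>Z\<^esub>s\<in>S. \<beta> (g s) (\<Oplus>\<^bsub>W\<^esub>t\<in>S'. h t))" .
  also have "\<dots> = (\<Oplus>\<^bsub>Z\<^esub>s\<in>S. \<Oplus>\<^bsub>Z\<^esub>t\<in>S'. \<beta> (g s) (h t))"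
    using linear_maps_finsum[OF assms(2,3) bilinear_maps_right[OF assms(4)] assms(6,8)]
      bilinear_maps_closed[OF assms(4)] gs ht
    by (intro Z.finsum_cong') (auto intro!: Z.finsum_closed)
  finally show ?thesis .
qed

lemma ground_algebra_simps:
  "carrier (ground_algebra K) = carrier K" "monoid.mult (ground_algebra K) = monoid.mult K"
  "\<one>\<^bsub>ground_algebra K\<^esub> = \<one>\<^bsub>K\<^esub>" "\<zero>\<^bsub>ground_algebra K\<^esub> = \<zero>\<^bsub>K\<^esub>"
  "add (ground_algebra K) = add K" "smult (ground_algebra K) = monoid.mult K"
  by (simp_all add: ground_algebra_def)

lemma finsum_ground_algebra: "finsum (ground_algebra K) = finsum K"
  by (intro ext) (simp add: finsum_def finprod_def ground_algebra_simps)

lemma module_ground_algebra: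
  assumes "cring K"
  shows "module K (ground_algebra K)"
proof -
  interpret cring K by fact
  show ?thesis
    by (intro moduleI abelian_groupI assms)
      (auto simp: ground_algebra_simps a_ac m_ac l_distr r_distr intro!: l_neg bexI[of _ "\<ominus>\<^bsub>K\<^esub> _"])
qed

lemma linear_maps_smult_const:
  assumes "module K Z" "f \<in> linear_maps K V (ground_algebra K)" "z \<in> carrier Z"
  shows "(\<lambda>x. f x \<odot>\<^bsub>Z\<^esub> z) \<in> linear_maps K V Z"
proof -
  interpret Z: module K Z by fact
  show ?thesis
    using assms(2,3) linear_maps_closed[OF assms(2)]
    by (intro linear_mapsI)
      (auto simp: linear_maps_add linear_maps_smult ground_algebra_simps Z.smult_l_distr
        Z.smult_assoc1)
qed

lemma bilinear_forms_eq: "bilinear_forms K V W = bilinear_maps K V W (ground_algebra K)"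
  by (simp add: bilinear_forms_def bilinear_maps_def)


section \<open>Tensor products of modules\<close>

lemma tensor_algebra_simps:
  "\<one>\<^bsub>tensor_algebra K V W\<^esub> = pure_tensor K V W \<one>\<^bsub>V\<^esub> \<one>\<^bsub>W\<^esub>"
  "\<zero>\<^bsub>tensor_algebra K V W\<^esub> = (\<lambda>\<phi> \<in> bilinear_forms K V W. \<zero>\<^bsub>K\<^esub>)"
  "s \<oplus>\<^bsub>tensor_algebra K V W\<^esub> t = (\<lambda>\<phi> \<in> bilinear_forms K V W. s \<phi> \<oplus>\<^bsub>K\<^esub> t \<phi>)"
  "c \<odot>\<^bsub>tensor_algebra K V W\<^esub> t = (\<lambda>\<phi> \<in> bilinear_forms K V W. c \<otimes>\<^bsub>K\<^esub> t \<phi>)"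
  by (simp_all add: tensor_algebra_def Let_def)

locale module_pair = V: module K V + W: module K W
  for K :: "('k, 'm) ring_scheme" (structure)
    and V :: "('k, 'a, 'n) module_scheme"
    and W :: "('k, 'b, 'p) module_scheme"
begin

abbreviation "T \<equiv> tensor_algebra K V W"
abbreviation "F \<equiv> bilinear_forms K V W"

lemma form_closed: "\<lbrakk>\<phi> \<in> F; v \<in> carrier V; w \<in> carrier W\<rbrakk> \<Longrightarrow> \<phi> v w \<in> carrier K"
  using bilinear_maps_closed[of \<phi> K V W "ground_algebra K" v w]
  by (simp add: bilinear_forms_eq ground_algebra_simps)

lemma pure_tensor_closed [simp, intro]:
  assumes "v \<in> carrier V" "w \<in> carrier W"
  shows "pure_tensor K V W v w \<in> carrier T"
proof -
  have "pure_tensor K V W v w = (\<lambda>\<phi>\<in>F. \<Oplus>i\<in>{..<Suc 0}. \<phi> v w)"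
    using assms by (auto simp: pure_tensor_def form_closed lessThan_Suc intro!: restrict_ext)
  then show ?thesis
    using assms unfolding tensor_algebra_def Let_def
    by (fastforce intro!: exI[of _ "Suc 0"] exI[of _ "\<lambda>_. v"] exI[of _ "\<lambda>_. w"])
qed

lemma tensor_zero_closed: "\<zero>\<^bsub>T\<^esub> \<in> carrier T"
  unfolding tensor_algebra_def Let_def by (fastforce intro!: exI[of _ "0 :: nat"])

text \<open>
  Elements of the tensor product are given by families of pure tensors of arbitrary length. This
  rule hides the families: a property of tensors has to be checked when one pure tensor is added.
\<close>

lemma tensor_induct [consumes 1, case_names zero add]:
  assumes t: "t \<in> carrier T" and zero: "P (\<zero>\<^bsub>T\<^esub>)"
    and add: "\<And>t v w. \<lbrakk>t \<in> carrier T; P t; v \<in> carrier V; w \<in> carrier W\<rbrakk>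
      \<Longrightarrow> P (t \<oplus>\<^bsub>T\<^esub> pure_tensor K V W v w)"
  shows "P t"
proof -
  have *: "(\<lambda>\<phi>\<in>F. \<Oplus>i\<in>{..<n}. \<phi> (a i) (b i)) \<in> carrier T \<and> P (\<lambda>\<phi>\<in>F. \<Oplus>i\<in>{..<n}. \<phi> (a i) (b i))"
    if "a \<in> {..<n} \<rightarrow> carrier V" "b \<in> {..<n} \<rightarrow> carrier W" for n :: nat and a b
    using that
  proof (induction n)
    case 0
    have "(\<lambda>\<phi>\<in>F. \<Oplus>i\<in>{..<0}. \<phi> (a i) (b i)) = \<zero>\<^bsub>T\<^esub>"
      unfolding tensor_algebra_simps by (rule restrict_ext) simp
    then show ?case
      using zero tensor_zero_closed by metis
  next
    case (Suc n)
    let ?t = "\<lambda>\<phi>\<in>F. \<Oplus>i\<in>{..<n}. \<phi> (a i) (b i)"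
    have "?t \<in> carrier T \<and> P ?t"
      using Suc by (intro Suc.IH) auto
    then have "P (?t \<oplus>\<^bsub>T\<^esub> pure_tensor K V W (a n) (b n))"
      using Suc.prems by (intro add) auto
    moreover have "?t \<oplus>\<^bsub>T\<^esub> pure_tensor K V W (a n) (b n) = (\<lambda>\<phi>\<in>F. \<Oplus>i\<in>{..<Suc n}. \<phi> (a i) (b i))"
      using Suc.prems
      by (auto simp: tensor_algebra_simps pure_tensor_def lessThan_Suc form_closed Pi_def
          V.R.add.m_comm V.R.finsum_closed intro!: restrict_ext)
    moreover have "(\<lambda>\<phi>\<in>F. \<Oplus>i\<in>{..<Suc n}. \<phi> (a i) (b i)) \<in> carrier T"
      using Suc.prems unfolding tensor_algebra_def Let_def by auto
    ultimately show ?case by metis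
  qed
  from t show ?thesis
    using * by (auto simp: tensor_algebra_def Let_def)
qed

lemma tensorI:
  assumes "a \<in> {..<n::nat} \<rightarrow> carrier V" "b \<in> {..<n} \<rightarrow> carrier W"
  shows "(\<lambda>\<phi>\<in>F. \<Oplus>i\<in>{..<n}. \<phi> (a i) (b i)) \<in> carrier T"
  using assms unfolding tensor_algebra_def Let_def by auto

lemma tensorE:
  assumes "t \<in> carrier T"
  obtains a b and n :: nat where "t = (\<lambda>\<phi>\<in>F. \<Oplus>i\<in>{..<n}. \<phi> (a i) (b i))"
    "a \<in> {..<n} \<rightarrow> carrier V" "b \<in> {..<n} \<rightarrow> carrier W"
  using assms by (auto simp: tensor_algebra_def Let_def)

lemma tensor_extensional: "t \<in> carrier T \<Longrightarrow> t \<in> extensional F"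
  by (erule tensorE) auto

lemma tensor_ext: "\<lbrakk>s \<in> carrier T; t \<in> carrier T; \<And>\<phi>. \<phi> \<in> F \<Longrightarrow> s \<phi> = t \<phi>\<rbrakk> \<Longrightarrow> s = t"
  by (rule extensionalityI[OF tensor_extensional tensor_extensional])

lemma tensor_eval_closed:
  assumes "t \<in> carrier T" "\<phi> \<in> F"
  shows "t \<phi> \<in> carrier K"
proof -
  obtain a b and n :: nat where "t = (\<lambda>\<phi>\<in>F. \<Oplus>i\<in>{..<n}. \<phi> (a i) (b i))"
    "a \<in> {..<n} \<rightarrow> carrier V" "b \<in> {..<n} \<rightarrow> carrier W"
    using assms(1) by (rule tensorE)
  then show ?thesis
    using assms(2) by (auto simp: Pi_def form_closed)
qed

lemma pure_tensor_bilinear: "pure_tensor K V W \<in> bilinear_maps K V W T"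
  unfolding bilinear_maps_def mem_Collect_eq
proof (intro conjI ballI linear_mapsI)
  fix w x y c
  assume "w \<in> carrier W" "x \<in> carrier V"
  then show "pure_tensor K V W x w \<in> carrier T" "pure_tensor K V W x w \<in> carrier T" by simp_all
qed (auto simp: tensor_algebra_simps pure_tensor_def bilinear_forms_eq
      ground_algebra_simps linear_maps_add[OF bilinear_maps_left]
      linear_maps_add[OF bilinear_maps_right] linear_maps_smult[OF bilinear_maps_left]
      linear_maps_smult[OF bilinear_maps_right] intro!: restrict_ext)

text \<open>
  Adding one pure tensor lengthens the family by one; adding a general tensor is then an induction,
  which avoids concatenating two families.
\<close>

lemma tensor_add_closed:
  assumes "s \<in> carrier T" "t \<in> carrier T"
  shows "s \<oplus>\<^bsub>T\<^esub> t \<in> carrier T"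
  using assms(2)
proof (induction t rule: tensor_induct)
  case zero
  have "s \<oplus>\<^bsub>T\<^esub> \<zero>\<^bsub>T\<^esub> = s"
    using assms(1) tensor_extensional[OF assms(1)]
    by (auto simp: tensor_algebra_simps tensor_eval_closed extensional_def fun_eq_iff)
  with assms show ?case by simp
next
  case (add t v w)
  have "s \<oplus>\<^bsub>T\<^esub> (t \<oplus>\<^bsub>T\<^esub> pure_tensor K V W v w) = (s \<oplus>\<^bsub>T\<^esub> t) \<oplus>\<^bsub>T\<^esub> pure_tensor K V W v w"
    using assms(1) add
    by (auto simp: tensor_algebra_simps pure_tensor_def tensor_eval_closed form_closed
        V.R.add.m_assoc intro!: restrict_ext)
  moreover have "r \<oplus>\<^bsub>T\<^esub> pure_tensor K V W v w \<in> carrier T" if "r \<in> carrier T" for r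
  proof -
    obtain n :: nat and a b where r: "r = (\<lambda>\<phi>\<in>F. \<Oplus>i\<in>{..<n}. \<phi> (a i) (b i))"
      and ab: "a \<in> {..<n} \<rightarrow> carrier V" "b \<in> {..<n} \<rightarrow> carrier W"
      using \<open>r \<in> carrier T\<close> by (rule tensorE)
    let ?a = "a(n := v)" and ?b = "b(n := w)"
    have "(\<Oplus>i\<in>{..<Suc n}. \<phi> (?a i) (?b i)) = (\<Oplus>i\<in>{..<n}. \<phi> (a i) (b i)) \<oplus> \<phi> v w"
      if "\<phi> \<in> F" for \<phi>
    proof -
      have "(\<Oplus>i\<in>{..<n}. \<phi> (?a i) (?b i)) = (\<Oplus>i\<in>{..<n}. \<phi> (a i) (b i))"
        using ab that by (intro V.R.finsum_cong') (auto simp: form_closed Pi_def)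
      moreover have "(\<Oplus>i\<in>insert n {..<n}. \<phi> (?a i) (?b i)) =
          \<phi> (?a n) (?b n) \<oplus> (\<Oplus>i\<in>{..<n}. \<phi> (?a i) (?b i))"
        using ab add that by (intro V.R.finsum_insert) (auto simp: form_closed Pi_def)
      moreover have "(\<Oplus>i\<in>{..<n}. \<phi> (a i) (b i)) \<in> carrier K"
        using ab that by (auto simp: form_closed Pi_def)
      ultimately show ?thesis
        using add that by (simp add: lessThan_Suc V.R.add.m_comm form_closed)
    qed
    then have "r \<oplus>\<^bsub>T\<^esub> pure_tensor K V W v w = (\<lambda>\<phi>\<in>F. \<Oplus>i\<in>{..<Suc n}. \<phi> (?a i) (?b i))"
      unfolding r tensor_algebra_simps pure_tensor_def by (intro restrict_ext) simp
    moreover have "?a \<in> {..<Suc n} \<rightarrow> carrier V" "?b \<in> {..<Suc n} \<rightarrow> carrier W"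
      using ab add by (auto simp: less_Suc_eq Pi_def)
    ultimately show ?thesis
      using tensorI[of ?a "Suc n" ?b] by metis
  qed
  ultimately show ?case
    using add by simp
qed

lemma tensor_smult_closed:
  assumes c: "c \<in> carrier K" and "t \<in> carrier T"
  shows "c \<odot>\<^bsub>T\<^esub> t \<in> carrier T"
  using assms(2)
proof (induction t rule: tensor_induct)
  case zero
  have "c \<odot>\<^bsub>T\<^esub> \<zero>\<^bsub>T\<^esub> = \<zero>\<^bsub>T\<^esub>"
    using c by (auto simp: tensor_algebra_simps intro!: restrict_ext)
  then show ?case by (simp add: tensor_zero_closed)
next
  case (add t v w)
  have "c \<odot>\<^bsub>T\<^esub> (t \<oplus>\<^bsub>T\<^esub> pure_tensor K V W v w) = c \<odot>\<^bsub>T\<^esub> t \<oplus>\<^bsub>T\<^esub> c \<odot>\<^bsub>T\<^esub> pure_tensor K V W v w"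
    using add c
    by (auto simp: tensor_algebra_simps pure_tensor_def tensor_eval_closed form_closed
        V.R.r_distr intro!: restrict_ext)
  also have "c \<odot>\<^bsub>T\<^esub> pure_tensor K V W v w = pure_tensor K V W (c \<odot>\<^bsub>V\<^esub> v) w"
    using linear_maps_smult[OF bilinear_maps_left[OF pure_tensor_bilinear]] add c by simp
  finally show ?case
    using add c by (simp add: tensor_add_closed)
qed

lemma module_tensor: "module K T"
proof (intro moduleI abelian_groupI)
  have "\<exists>y\<in>carrier T. y \<oplus>\<^bsub>T\<^esub> x = \<zero>\<^bsub>T\<^esub>" if "x \<in> carrier T" for x
  proof
    show "(\<ominus> \<one>) \<odot>\<^bsub>T\<^esub> x \<in> carrier T"
      using that by (simp add: tensor_smult_closed)
    show "((\<ominus> \<one>) \<odot>\<^bsub>T\<^esub> x) \<oplus>\<^bsub>T\<^esub> x = \<zero>\<^bsub>T\<^esub>"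
      using that by (auto simp: tensor_algebra_simps tensor_eval_closed V.R.l_minus V.R.l_neg
          intro!: restrict_ext)
  qed
  then show "\<And>x. x \<in> carrier T \<Longrightarrow> \<exists>y\<in>carrier T. y \<oplus>\<^bsub>T\<^esub> x = \<zero>\<^bsub>T\<^esub>" .
  show "\<zero>\<^bsub>T\<^esub> \<oplus>\<^bsub>T\<^esub> x = x" if "x \<in> carrier T" for x
    using that by (intro tensor_ext tensor_add_closed tensor_zero_closed)
      (auto simp: tensor_algebra_simps tensor_eval_closed)
  show "\<one> \<odot>\<^bsub>T\<^esub> x = x" if "x \<in> carrier T" for x
    using that by (intro tensor_ext tensor_smult_closed)
      (auto simp: tensor_algebra_simps tensor_eval_closed)
qed (auto simp: tensor_add_closed tensor_smult_closed tensor_zero_closed V.R.is_cring,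
     auto simp: tensor_algebra_simps tensor_eval_closed V.R.a_ac V.R.m_ac V.R.l_distr V.R.r_distr
       intro!: restrict_ext)

lemma linear_maps_tensor_eqI:
  assumes "module K Z" "f \<in> linear_maps K T Z" "g \<in> linear_maps K T Z"
    and "\<And>v w. \<lbrakk>v \<in> carrier V; w \<in> carrier W\<rbrakk> \<Longrightarrow>
      f (pure_tensor K V W v w) = g (pure_tensor K V W v w)"
    and "t \<in> carrier T"
  shows "f t = g t"
  using assms(5)
  by (induction rule: tensor_induct)
    (simp_all add: linear_maps_zero[OF module_tensor assms(1)] linear_maps_add[of _ K T Z] assms)

text \<open>
  A tensor is a functional on forms, and it is linear in the form. Forms are compared on the carriers
  only, because two forms may differ outside; the product of tensors evaluates its factors at forms
  that are sums only on the carriers.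
\<close>

lemma tensor_eval_add:
  assumes "t \<in> carrier T" "\<phi> \<in> F" "\<psi> \<in> F" "\<chi> \<in> F"
    and "\<And>v w. \<lbrakk>v \<in> carrier V; w \<in> carrier W\<rbrakk> \<Longrightarrow> \<chi> v w = \<phi> v w \<oplus> \<psi> v w"
  shows "t \<chi> = t \<phi> \<oplus> t \<psi>"
  using assms(1)
proof (induction rule: tensor_induct)
  case zero
  then show ?case using assms by (simp add: tensor_algebra_simps)
next
  case (add t v w)
  then show ?case
    using assms(2-)
    by (simp add: tensor_algebra_simps pure_tensor_def form_closed tensor_eval_closed V.R.a_ac)
qed

lemma tensor_eval_smult:
  assumes "t \<in> carrier T" "c \<in> carrier K" "\<phi> \<in> F" "\<chi> \<in> F"
    and "\<And>v w. \<lbrakk>v \<in> carrier V; w \<in> carrier W\<rbrakk> \<Longrightarrow> \<chi> v w = c \<otimes> \<phi> v w"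
  shows "t \<chi> = c \<otimes> t \<phi>"
  using assms(1)
proof (induction rule: tensor_induct)
  case zero
  then show ?case using assms by (simp add: tensor_algebra_simps)
next
  case (add t v w)
  then show ?case
    using assms(2-)
    by (simp add: tensor_algebra_simps pure_tensor_def form_closed tensor_eval_closed V.R.r_distr)
qed

end


section \<open>Multiplication in tensor products of algebras\<close>

locale algebra_pair = A: assoc_algebra K A + B: assoc_algebra K B
  for K :: "('k, 'm) ring_scheme" (structure)
    and A :: "('k, 'a, 'n) module_scheme"
    and B :: "('k, 'b, 'p) module_scheme"

sublocale algebra_pair \<subseteq> module_pair K A B ..

context algebra_pair
begin

lemma translated_form:
  assumes "\<phi> \<in> F" "a \<in> carrier A" "b \<in> carrier B"
  shows "(\<lambda>c d. \<phi> (a \<otimes>\<^bsub>A\<^esub> c) (b \<otimes>\<^bsub>B\<^esub> d)) \<in> F"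
  using assms
  by (auto simp: bilinear_forms_def linear_maps_def Pi_def A.r_distr B.r_distr
      A.smult_mult_right B.smult_mult_right)

text \<open>
  In a product of two tensors, the left one is evaluated at forms of this kind, obtained by contracting
  with the right one.
\<close>

lemma contracted_form:
  assumes t: "t \<in> carrier T" and \<phi>: "\<phi> \<in> F"
  shows "(\<lambda>a b. t (\<lambda>c d. \<phi> (a \<otimes>\<^bsub>A\<^esub> c) (b \<otimes>\<^bsub>B\<^esub> d))) \<in> F"
proof -
  let ?\<psi> = "\<lambda>a b. t (\<lambda>c d. \<phi> (a \<otimes>\<^bsub>A\<^esub> c) (b \<otimes>\<^bsub>B\<^esub> d))"
  have \<phi>': "\<phi> \<in> bilinear_maps K A B (ground_algebra K)"
    using \<phi> by (simp add: bilinear_forms_eq)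
  note lin = linear_maps_add[OF bilinear_maps_left[OF \<phi>'], unfolded ground_algebra_simps]
    linear_maps_add[OF bilinear_maps_right[OF \<phi>'], unfolded ground_algebra_simps]
    linear_maps_smult[OF bilinear_maps_left[OF \<phi>'], unfolded ground_algebra_simps]
    linear_maps_smult[OF bilinear_maps_right[OF \<phi>'], unfolded ground_algebra_simps]
  have closed: "?\<psi> a b \<in> carrier K" if "a \<in> carrier A" "b \<in> carrier B" for a b
    using tensor_eval_closed[OF t translated_form[OF \<phi> that]] .
  have "?\<psi> a (b \<oplus>\<^bsub>B\<^esub> b') = ?\<psi> a b \<oplus> ?\<psi> a b'"
    if "a \<in> carrier A" "b \<in> carrier B" "b' \<in> carrier B" for a b b'
    using that by (intro tensor_eval_add[OF t] translated_form[OF \<phi>])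
      (auto simp: B.l_distr lin)
  moreover have "?\<psi> (a \<oplus>\<^bsub>A\<^esub> a') b = ?\<psi> a b \<oplus> ?\<psi> a' b"
    if "a \<in> carrier A" "a' \<in> carrier A" "b \<in> carrier B" for a a' b
    using that by (intro tensor_eval_add[OF t] translated_form[OF \<phi>])
      (auto simp: A.l_distr lin)
  moreover have "?\<psi> a (r \<odot>\<^bsub>B\<^esub> b) = r \<otimes> ?\<psi> a b" "?\<psi> (r \<odot>\<^bsub>A\<^esub> a) b = r \<otimes> ?\<psi> a b"
    if "a \<in> carrier A" "b \<in> carrier B" "r \<in> carrier K" for a b r
    using that by (auto intro!: tensor_eval_smult[OF t] translated_form[OF \<phi>]
        simp: A.smult_mult_left B.smult_mult_left lin)
  ultimately show ?thesis
    using closed unfolding bilinear_forms_eq bilinear_maps_def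
    by (auto intro!: linear_mapsI simp: ground_algebra_simps)
qed

lemma tensor_mult_eval:
  "s \<otimes>\<^bsub>T\<^esub> t = (\<lambda>\<phi>\<in>F. s (\<lambda>a b. t (\<lambda>c d. \<phi> (a \<otimes>\<^bsub>A\<^esub> c) (b \<otimes>\<^bsub>B\<^esub> d))))"
  by (simp add: tensor_algebra_def Let_def)

lemma tensor_mult_distrib_left:
  assumes "s \<in> carrier T" "s' \<in> carrier T" "t \<in> carrier T"
  shows "(s \<oplus>\<^bsub>T\<^esub> s') \<otimes>\<^bsub>T\<^esub> t = s \<otimes>\<^bsub>T\<^esub> t \<oplus>\<^bsub>T\<^esub> s' \<otimes>\<^bsub>T\<^esub> t"
  unfolding tensor_mult_eval tensor_algebra_simps(3) using contracted_form[OF assms(3)]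
  by (intro restrict_ext) simp

lemma tensor_mult_smult_left:
  assumes "s \<in> carrier T" "t \<in> carrier T" "r \<in> carrier K"
  shows "(r \<odot>\<^bsub>T\<^esub> s) \<otimes>\<^bsub>T\<^esub> t = r \<odot>\<^bsub>T\<^esub> (s \<otimes>\<^bsub>T\<^esub> t)"
  unfolding tensor_mult_eval tensor_algebra_simps(4) using contracted_form[OF assms(2)]
  by (intro restrict_ext) simp

lemma tensor_mult_distrib_right:
  assumes "s \<in> carrier T" "t \<in> carrier T" "t' \<in> carrier T"
  shows "s \<otimes>\<^bsub>T\<^esub> (t \<oplus>\<^bsub>T\<^esub> t') = s \<otimes>\<^bsub>T\<^esub> t \<oplus>\<^bsub>T\<^esub> s \<otimes>\<^bsub>T\<^esub> t'"
proof -
  have "s (\<lambda>a b. (t \<oplus>\<^bsub>T\<^esub> t') (\<lambda>c d. \<phi> (a \<otimes>\<^bsub>A\<^esub> c) (b \<otimes>\<^bsub>B\<^esub> d))) =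
      s (\<lambda>a b. t (\<lambda>c d. \<phi> (a \<otimes>\<^bsub>A\<^esub> c) (b \<otimes>\<^bsub>B\<^esub> d))) \<oplus>
      s (\<lambda>a b. t' (\<lambda>c d. \<phi> (a \<otimes>\<^bsub>A\<^esub> c) (b \<otimes>\<^bsub>B\<^esub> d)))" if "\<phi> \<in> F" for \<phi>
    using that assms
    by (intro tensor_eval_add[OF assms(1)] contracted_form tensor_add_closed)
      (simp_all add: tensor_algebra_simps(3) translated_form)
  then show ?thesis
    unfolding tensor_mult_eval by (subst (2) tensor_algebra_simps(3)) (auto intro!: restrict_ext)
qed

lemma tensor_mult_smult_right:
  assumes "s \<in> carrier T" "t \<in> carrier T" "r \<in> carrier K"
  shows "s \<otimes>\<^bsub>T\<^esub> (r \<odot>\<^bsub>T\<^esub> t) = r \<odot>\<^bsub>T\<^esub> (s \<otimes>\<^bsub>T\<^esub> t)"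
proof -
  have "s (\<lambda>a b. (r \<odot>\<^bsub>T\<^esub> t) (\<lambda>c d. \<phi> (a \<otimes>\<^bsub>A\<^esub> c) (b \<otimes>\<^bsub>B\<^esub> d))) =
      r \<otimes> s (\<lambda>a b. t (\<lambda>c d. \<phi> (a \<otimes>\<^bsub>A\<^esub> c) (b \<otimes>\<^bsub>B\<^esub> d)))" if "\<phi> \<in> F" for \<phi>
    using that assms
    by (intro tensor_eval_smult[OF assms(1,3)] contracted_form tensor_smult_closed)
      (simp_all add: tensor_algebra_simps(4) translated_form)
  then show ?thesis
    unfolding tensor_mult_eval by (subst (2) tensor_algebra_simps(4)) (auto intro!: restrict_ext)
qed

text \<open>
  The product is defined by evaluation at forms, so that it is a sum of pure tensors again has to be
  shown. By distributivity it is enough to consider products of pure tensors.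
\<close>

lemma tensor_mult_closed:
  assumes "s \<in> carrier T" "t \<in> carrier T"
  shows "s \<otimes>\<^bsub>T\<^esub> t \<in> carrier T"
proof -
  interpret T: module K T by (rule module_tensor)
  have null: "\<zero>\<^bsub>T\<^esub> \<otimes>\<^bsub>T\<^esub> r = \<zero>\<^bsub>T\<^esub>" "r \<otimes>\<^bsub>T\<^esub> \<zero>\<^bsub>T\<^esub> = \<zero>\<^bsub>T\<^esub>" if r: "r \<in> carrier T" for r
  proof -
    show "\<zero>\<^bsub>T\<^esub> \<otimes>\<^bsub>T\<^esub> r = \<zero>\<^bsub>T\<^esub>"
      unfolding tensor_mult_eval tensor_algebra_simps(2)
      using contracted_form[OF r] by (intro restrict_ext) simp
    have "r (\<lambda>a b. \<zero>\<^bsub>T\<^esub> (\<lambda>c d. \<phi> (a \<otimes>\<^bsub>A\<^esub> c) (b \<otimes>\<^bsub>B\<^esub> d))) = \<zero>" if "\<phi> \<in> F" for \<phi>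
    proof -
      let ?\<chi> = "\<lambda>a b. \<zero>\<^bsub>T\<^esub> (\<lambda>c d. \<phi> (a \<otimes>\<^bsub>A\<^esub> c) (b \<otimes>\<^bsub>B\<^esub> d))"
      have F: "?\<chi> \<in> F"
        using that by (rule contracted_form[OF tensor_zero_closed])
      have "?\<chi> a b = \<zero>" if "a \<in> carrier A" "b \<in> carrier B" for a b
        using translated_form[OF \<open>\<phi> \<in> F\<close> that] by (simp add: tensor_algebra_simps(2))
      then have "r ?\<chi> = \<zero> \<otimes> r ?\<chi>"
        using tensor_eval_smult[OF r A.R.zero_closed F F] form_closed[OF F] by simp
      then show ?thesis
        using tensor_eval_closed[OF r F] by simp
    qed
    then show "r \<otimes>\<^bsub>T\<^esub> \<zero>\<^bsub>T\<^esub> = \<zero>\<^bsub>T\<^esub>"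
      unfolding tensor_mult_eval
      by (subst (2) tensor_algebra_simps(2)) (auto intro!: restrict_ext)
  qed
  have pure: "pure_tensor K A B a b \<otimes>\<^bsub>T\<^esub> t \<in> carrier T" if "a \<in> carrier A" "b \<in> carrier B" for a b
    using assms(2)
  proof (induction rule: tensor_induct)
    case zero
    then show ?case using that by (simp add: null tensor_zero_closed)
  next
    case (add t c d)
    then show ?case
      using that tensor_mult_pure[OF A.assoc_algebra_axioms B.assoc_algebra_axioms that add.hyps(2,3)]
      by (simp add: tensor_mult_distrib_right tensor_add_closed)
  qed
  show ?thesis
    using assms(1)
  proof (induction rule: tensor_induct)
    case zero
    then show ?case using assms(2) by (simp add: null tensor_zero_closed)
  next
    case (add s a b)
    then show ?case
      using assms(2) by (simp add: tensor_mult_distrib_left tensor_add_closed pure)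
  qed
qed

lemma tensor_mult_bilinear: "(\<otimes>\<^bsub>T\<^esub>) \<in> bilinear_maps K T T T"
  unfolding bilinear_maps_def
  by (auto intro!: linear_mapsI tensor_mult_closed simp: tensor_mult_distrib_left tensor_mult_smult_left
      tensor_mult_distrib_right tensor_mult_smult_right)

end


section \<open>Coordinate spaces\<close>

text \<open>
  Only the linear structure is prescribed, so the locale applies to any algebra whose elements
  are coordinate vectors, whatever its multiplication.
\<close>

locale coordinate_space = cring K
  for K :: "('k, 'm) ring_scheme" (structure) +
  fixes B :: "'b set" and M :: "('k, 'b \<Rightarrow> 'k, 'n) module_scheme"
  assumes finite_index: "finite B"
    and carrier_eq: "carrier M = B \<rightarrow>\<^sub>E carrier K"
    and zero_eq: "\<zero>\<^bsub>M\<^esub> = (\<lambda>_\<in>B. \<zero>)"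
    and add_eq: "x \<oplus>\<^bsub>M\<^esub> y = (\<lambda>b\<in>B. x b \<oplus> y b)"
    and smult_eq: "c \<odot>\<^bsub>M\<^esub> x = (\<lambda>b\<in>B. c \<otimes> x b)"
begin

definition unit_vector :: "'b \<Rightarrow> 'b \<Rightarrow> 'k"
  where "unit_vector b = (\<lambda>c\<in>B. if c = b then \<one> else \<zero>)"

lemma coordinate_closed: "\<lbrakk>x \<in> carrier M; b \<in> B\<rbrakk> \<Longrightarrow> x b \<in> carrier K"
  by (auto simp: carrier_eq)

lemma vector_ext: "\<lbrakk>x \<in> carrier M; y \<in> carrier M; \<And>b. b \<in> B \<Longrightarrow> x b = y b\<rbrakk> \<Longrightarrow> x = y"
  unfolding carrier_eq by (rule PiE_ext)

lemma module_coordinate_space: "module K M"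
proof (intro moduleI abelian_groupI)
  show "\<exists>y\<in>carrier M. y \<oplus>\<^bsub>M\<^esub> x = \<zero>\<^bsub>M\<^esub>" if "x \<in> carrier M" for x
  proof
    show "(\<lambda>b\<in>B. \<ominus> x b) \<in> carrier M"
      using that by (auto simp: carrier_eq)
    show "(\<lambda>b\<in>B. \<ominus> x b) \<oplus>\<^bsub>M\<^esub> x = \<zero>\<^bsub>M\<^esub>"
      using that by (auto simp: add_eq zero_eq coordinate_closed l_neg intro!: restrict_ext)
  qed
  show "\<zero>\<^bsub>M\<^esub> \<oplus>\<^bsub>M\<^esub> x = x" if "x \<in> carrier M" for x
    using that by (intro vector_ext) (auto simp: add_eq zero_eq carrier_eq Pi_def PiE_def)
  show "\<one> \<odot>\<^bsub>M\<^esub> x = x" if "x \<in> carrier M" for x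
    using that by (intro vector_ext) (auto simp: smult_eq carrier_eq Pi_def PiE_def)
qed (auto simp: is_cring, auto simp: add_eq zero_eq smult_eq carrier_eq PiE_mem[of _ B "\<lambda>_. carrier K"]
       a_ac m_ac l_distr r_distr intro!: restrict_ext)

sublocale M: module K M
  by (rule module_coordinate_space)

lemma unit_vector_closed [simp, intro]: "unit_vector b \<in> carrier M"
  by (auto simp: unit_vector_def carrier_eq)

lemma coordinate_linear: "b \<in> B \<Longrightarrow> (\<lambda>x. x b) \<in> linear_maps K M (ground_algebra K)"
  by (intro linear_mapsI) (auto simp: coordinate_closed ground_algebra_simps add_eq smult_eq)

lemma finsum_coordinate:
  assumes "finite S" "g \<in> S \<rightarrow> carrier M" "b \<in> B"
  shows "(\<Oplus>\<^bsub>M\<^esub>s\<in>S. g s) b = (\<Oplus>s\<in>S. g s b)"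
  using linear_maps_finsum[OF M.module_axioms module_ground_algebra[OF is_cring]
      coordinate_linear[OF assms(3)] assms(1,2)]
  by (simp add: finsum_ground_algebra)

lemma unit_vector_expansion:
  assumes "x \<in> carrier M"
  shows "x = (\<Oplus>\<^bsub>M\<^esub>b\<in>B. x b \<odot>\<^bsub>M\<^esub> unit_vector b)"
proof (rule vector_ext[OF assms])
  show "(\<Oplus>\<^bsub>M\<^esub>b\<in>B. x b \<odot>\<^bsub>M\<^esub> unit_vector b) \<in> carrier M"
    using assms by (auto simp: coordinate_closed)
  fix c assume c: "c \<in> B"
  have "(\<Oplus>\<^bsub>M\<^esub>b\<in>B. x b \<odot>\<^bsub>M\<^esub> unit_vector b) c = (\<Oplus>b\<in>B. (x b \<odot>\<^bsub>M\<^esub> unit_vector b) c)"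
    using assms c by (intro finsum_coordinate finite_index) (auto simp: coordinate_closed)
  also have "\<dots> = (\<Oplus>b\<in>B. if c = b then x b else \<zero>)"
    using assms c by (intro finsum_cong') (auto simp: coordinate_closed smult_eq unit_vector_def)
  also have "\<dots> = x c"
    using assms c by (intro finsum_singleton finite_index) (auto simp: coordinate_closed)
  finally show "x c = (\<Oplus>\<^bsub>M\<^esub>b\<in>B. x b \<odot>\<^bsub>M\<^esub> unit_vector b) c" ..
qed

text \<open>
  The spanning set is indexed by the unit vectors themselves. They are distinct
  because \<open>1 \<noteq> 0\<close>, so a coordinate can be recovered from its unit vector.
\<close>

lemma finite_dimensional_coordinate_space:
  assumes "\<one> \<noteq> \<zero>"
  shows "finite_dimensional K M"
  unfolding finite_dimensional_def
proof (intro exI conjI ballI)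
  show "finite (unit_vector ` B)" "unit_vector ` B \<subseteq> carrier M"
    using finite_index by auto
  have eq_iff: "unit_vector b = unit_vector c \<longleftrightarrow> b = c" if "b \<in> B" "c \<in> B" for b c
  proof
    assume "unit_vector b = unit_vector c"
    then have "unit_vector b b = unit_vector c b" by simp
    then show "b = c"
      using that assms by (auto simp: unit_vector_def split: if_splits)
  qed simp
  then have inj: "inj_on unit_vector B"
    by (auto simp: inj_on_def)
  fix v assume v: "v \<in> carrier M"
  let ?c = "\<lambda>u. v (the_inv_into B unit_vector u)"
  have c: "?c (unit_vector b) = v b" if "b \<in> B" for b
    using that inj by (simp add: the_inv_into_f_f)
  have "(\<Oplus>\<^bsub>M\<^esub>u\<in>unit_vector ` B. ?c u \<odot>\<^bsub>M\<^esub> u) =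
      (\<Oplus>\<^bsub>M\<^esub>b\<in>B. ?c (unit_vector b) \<odot>\<^bsub>M\<^esub> unit_vector b)"
    using v inj by (intro M.finsum_reindex) (auto simp: c coordinate_closed)
  also have "\<dots> = (\<Oplus>\<^bsub>M\<^esub>b\<in>B. v b \<odot>\<^bsub>M\<^esub> unit_vector b)"
    using v by (intro M.finsum_cong') (auto simp: c coordinate_closed)
  finally show "\<exists>c\<in>unit_vector ` B \<rightarrow> carrier K. v = (\<Oplus>\<^bsub>M\<^esub>u\<in>unit_vector ` B. c u \<odot>\<^bsub>M\<^esub> u)"
    using v unit_vector_expansion[OF v] by (intro bexI[of _ ?c]) (auto simp: c coordinate_closed)
qed

lemma linear_maps_expansion:
  assumes "module K Z" "f \<in> linear_maps K M Z" "x \<in> carrier M"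
  shows "f x = (\<Oplus>\<^bsub>Z\<^esub>b\<in>B. x b \<odot>\<^bsub>Z\<^esub> f (unit_vector b))"
proof -
  interpret Z: module K Z by fact
  have "f (\<Oplus>\<^bsub>M\<^esub>b\<in>B. x b \<odot>\<^bsub>M\<^esub> unit_vector b) = (\<Oplus>\<^bsub>Z\<^esub>b\<in>B. f (x b \<odot>\<^bsub>M\<^esub> unit_vector b))"
    using assms by (intro linear_maps_finsum[OF M.module_axioms] finite_index)
      (auto simp: coordinate_closed)
  also have "\<dots> = (\<Oplus>\<^bsub>Z\<^esub>b\<in>B. x b \<odot>\<^bsub>Z\<^esub> f (unit_vector b))"
    using assms by (intro Z.finsum_cong')
      (auto simp: linear_maps_smult coordinate_closed linear_maps_closed)
  finally show ?thesis
    using unit_vector_expansion[OF assms(3)] by simp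
qed

lemma linear_maps_eqI:
  assumes "module K Z" "f \<in> linear_maps K M Z" "g \<in> linear_maps K M Z"
    and "\<And>b. b \<in> B \<Longrightarrow> f (unit_vector b) = g (unit_vector b)" and "x \<in> carrier M"
  shows "f x = g x"
proof -
  interpret Z: module K Z by fact
  have "(\<Oplus>\<^bsub>Z\<^esub>b\<in>B. x b \<odot>\<^bsub>Z\<^esub> f (unit_vector b)) = (\<Oplus>\<^bsub>Z\<^esub>b\<in>B. x b \<odot>\<^bsub>Z\<^esub> g (unit_vector b))"
    using assms by (intro Z.finsum_cong')
      (auto simp: coordinate_closed linear_maps_closed[OF assms(3)])
  then show ?thesis
    using linear_maps_expansion[OF assms(1,2,5)] linear_maps_expansion[OF assms(1,3,5)] by simp
qed

lemma bilinear_maps_eqI: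
  assumes "module K Z" "\<beta> \<in> bilinear_maps K M M Z" "\<gamma> \<in> bilinear_maps K M M Z"
    and "\<And>b c. \<lbrakk>b \<in> B; c \<in> B\<rbrakk> \<Longrightarrow>
      \<beta> (unit_vector b) (unit_vector c) = \<gamma> (unit_vector b) (unit_vector c)"
    and "x \<in> carrier M" "y \<in> carrier M"
  shows "\<beta> x y = \<gamma> x y"
proof (rule linear_maps_eqI[OF assms(1) _ _ _ assms(5)])
  show "(\<lambda>x. \<beta> x y) \<in> linear_maps K M Z"
    using assms(2,6) by (rule bilinear_maps_left)
  show "(\<lambda>x. \<gamma> x y) \<in> linear_maps K M Z"
    using assms(3,6) by (rule bilinear_maps_left)
  fix b assume b: "b \<in> B"
  show "\<beta> (unit_vector b) y = \<gamma> (unit_vector b) y"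
    by (rule linear_maps_eqI[OF assms(1) bilinear_maps_right[OF assms(2)]
          bilinear_maps_right[OF assms(3)] assms(4)[OF b] assms(6)]) auto
qed

lemma algebra_homs_unit_vectorI:
  assumes Z: "module K Z" and f: "f \<in> linear_maps K M Z"
    and M: "(\<otimes>\<^bsub>M\<^esub>) \<in> bilinear_maps K M M M" and Z': "(\<otimes>\<^bsub>Z\<^esub>) \<in> bilinear_maps K Z Z Z"
    and mult: "\<And>b c. \<lbrakk>b \<in> B; c \<in> B\<rbrakk> \<Longrightarrow>
      f (unit_vector b \<otimes>\<^bsub>M\<^esub> unit_vector c) = f (unit_vector b) \<otimes>\<^bsub>Z\<^esub> f (unit_vector c)"
    and one: "f \<one>\<^bsub>M\<^esub> = \<one>\<^bsub>Z\<^esub>"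
  shows "f \<in> algebra_homs K M Z"
proof -
  have "f (x \<otimes>\<^bsub>M\<^esub> y) = f x \<otimes>\<^bsub>Z\<^esub> f y" if "x \<in> carrier M" "y \<in> carrier M" for x y
    using bilinear_maps_eqI[OF Z bilinear_maps_comp[OF M linear_maps_id linear_maps_id f]
        bilinear_maps_comp[OF Z' f f linear_maps_id] mult that] .
  then show ?thesis
    using f one by (auto simp: algebra_homs_def ring_hom_def linear_maps_def)
qed

definition linear_extension ::
  "('k, 'c, 'q) module_scheme \<Rightarrow> ('b \<Rightarrow> 'c) \<Rightarrow> ('b \<Rightarrow> 'k) \<Rightarrow> 'c"
  where "linear_extension Z g x = (\<Oplus>\<^bsub>Z\<^esub>b\<in>B. x b \<odot>\<^bsub>Z\<^esub> g b)"

lemma linear_extension_linear: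
  assumes "module K Z" "g \<in> B \<rightarrow> carrier Z"
  shows "linear_extension Z g \<in> linear_maps K M Z"
  unfolding linear_extension_def using assms
  by (intro linear_maps_finsum_fun linear_maps_smult_const coordinate_linear finite_index
      M.module_axioms) auto

lemma linear_extension_unit_vector:
  assumes "module K Z" "g \<in> B \<rightarrow> carrier Z" "b \<in> B"
  shows "linear_extension Z g (unit_vector b) = g b"
proof -
  interpret Z: module K Z by fact
  have "linear_extension Z g (unit_vector b) = (\<Oplus>\<^bsub>Z\<^esub>c\<in>B. if b = c then g c else \<zero>\<^bsub>Z\<^esub>)"
    unfolding linear_extension_def using assms
    by (intro Z.finsum_cong') (auto simp: unit_vector_def Pi_def)
  also have "\<dots> = g b"
    using assms by (intro Z.finsum_singleton finite_index) auto
  finally show ?thesis .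
qed

sublocale T: module_pair K M M ..

text \<open>
  The products of two coordinate functions are the bilinear forms dual to the tensors of unit
  vectors. They read off the coordinates of a tensor, and these coordinates determine the value of
  the induced map.
\<close>

lemma tensor_lift_exists:
  assumes Z: "module K Z" and \<beta>: "\<beta> \<in> bilinear_maps K M M Z"
  shows "\<exists>f\<in>linear_maps K (tensor_algebra K M M) Z.
    \<forall>v\<in>carrier M. \<forall>w\<in>carrier M. f (pure_tensor K M M v w) = \<beta> v w"
proof (intro bexI ballI)
  interpret Z: module K Z by fact
  let ?f = "\<lambda>t. \<Oplus>\<^bsub>Z\<^esub>b\<in>B. \<Oplus>\<^bsub>Z\<^esub>c\<in>B. t (\<lambda>v w. v b \<otimes> w c) \<odot>\<^bsub>Z\<^esub> \<beta> (unit_vector b) (unit_vector c)"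
  have form: "(\<lambda>v w. v b \<otimes> w c) \<in> bilinear_forms K M M" if "b \<in> B" "c \<in> B" for b c
    using that unfolding bilinear_forms_eq bilinear_maps_def mem_Collect_eq
    by (auto intro!: linear_mapsI simp: coordinate_closed ground_algebra_simps add_eq smult_eq
        l_distr r_distr m_ac)
  have eval: "(\<lambda>t. t \<phi>) \<in> linear_maps K (tensor_algebra K M M) (ground_algebra K)"
    if "\<phi> \<in> bilinear_forms K M M" for \<phi>
    using that by (intro linear_mapsI)
      (auto simp: T.tensor_eval_closed ground_algebra_simps tensor_algebra_simps)
  show "?f \<in> linear_maps K (tensor_algebra K M M) Z"
    by (intro linear_maps_finsum_fun T.module_tensor Z finite_index linear_maps_smult_const
        eval form bilinear_maps_closed[OF \<beta>]) auto
  fix v w assume v: "v \<in> carrier M" and w: "w \<in> carrier M"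
  note closed = bilinear_maps_closed[OF \<beta>]
  have "?f (pure_tensor K M M v w) = (\<Oplus>\<^bsub>Z\<^esub>b\<in>B. v b \<odot>\<^bsub>Z\<^esub> \<beta> (unit_vector b) w)"
  proof (intro Z.finsum_cong' refl)
    fix b assume b: "b \<in> B"
    have "(\<Oplus>\<^bsub>Z\<^esub>c\<in>B. pure_tensor K M M v w (\<lambda>v w. v b \<otimes> w c) \<odot>\<^bsub>Z\<^esub> \<beta> (unit_vector b) (unit_vector c)) =
        (\<Oplus>\<^bsub>Z\<^esub>c\<in>B. v b \<odot>\<^bsub>Z\<^esub> (w c \<odot>\<^bsub>Z\<^esub> \<beta> (unit_vector b) (unit_vector c)))"
      using v w b
      by (intro Z.finsum_cong')
        (auto simp: pure_tensor_def form coordinate_closed closed Z.smult_assoc1)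
    also have "\<dots> = v b \<odot>\<^bsub>Z\<^esub> (\<Oplus>\<^bsub>Z\<^esub>c\<in>B. w c \<odot>\<^bsub>Z\<^esub> \<beta> (unit_vector b) (unit_vector c))"
      using v w b
      by (intro Z.finsum_smult_ldistr[symmetric] finite_index) (auto simp: coordinate_closed closed)
    also have "(\<Oplus>\<^bsub>Z\<^esub>c\<in>B. w c \<odot>\<^bsub>Z\<^esub> \<beta> (unit_vector b) (unit_vector c)) = \<beta> (unit_vector b) w"
      using linear_maps_expansion[OF Z bilinear_maps_right[OF \<beta>] w] by simp
    finally show "(\<Oplus>\<^bsub>Z\<^esub>c\<in>B. pure_tensor K M M v w (\<lambda>v w. v b \<otimes> w c) \<odot>\<^bsub>Z\<^esub>
        \<beta> (unit_vector b) (unit_vector c)) = v b \<odot>\<^bsub>Z\<^esub> \<beta> (unit_vector b) w" .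
  qed (use v w in \<open>auto simp: coordinate_closed closed\<close>)
  also have "\<dots> = \<beta> v w"
    using linear_maps_expansion[OF Z bilinear_maps_left[OF \<beta> w] v] by simp
  finally show "?f (pure_tensor K M M v w) = \<beta> v w" .
qed

text \<open>
  The induced map is defined as the unique one with the prescribed values on pure tensors. It exists by
  the preceding lemma, and it is unique because pure tensors span.
\<close>

lemma
  assumes Z: "module K Z" and \<beta>: "\<beta> \<in> bilinear_maps K M M Z"
  shows tensor_lift_linear: "tensor_lift K M M Z \<beta> \<in> linear_maps K (tensor_algebra K M M) Z"
    and tensor_lift_pure: "\<And>v w. \<lbrakk>v \<in> carrier M; w \<in> carrier M\<rbrakk> \<Longrightarrow>
      tensor_lift K M M Z \<beta> (pure_tensor K M M v w) = \<beta> v w"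
proof -
  let ?T = "tensor_algebra K M M"
  interpret T': module K ?T by (rule T.module_tensor)
  obtain f where f: "f \<in> linear_maps K ?T Z"
    "\<And>v w. \<lbrakk>v \<in> carrier M; w \<in> carrier M\<rbrakk> \<Longrightarrow> f (pure_tensor K M M v w) = \<beta> v w"
    using tensor_lift_exists[OF assms] by blast
  let ?P = "\<lambda>f. f \<in> linear_maps K ?T Z \<and> f \<in> extensional (carrier ?T) \<and>
    (\<forall>v\<in>carrier M. \<forall>w\<in>carrier M. f (pure_tensor K M M v w) = \<beta> v w)"
  have "\<exists>!f. ?P f"
  proof (rule ex1I)
    show "?P (restrict f (carrier ?T))"
      using f by (auto simp: linear_maps_def)
    fix g assume g: "?P g"
    show "g = restrict f (carrier ?T)"
    proof (rule extensionalityI)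
      show "g \<in> extensional (carrier ?T)" "restrict f (carrier ?T) \<in> extensional (carrier ?T)"
        using g by simp_all
      show "g t = restrict f (carrier ?T) t" if "t \<in> carrier ?T" for t
        using T.linear_maps_tensor_eqI[OF Z _ f(1) _ that, of g] f(2) g that by simp
    qed
  qed
  then have "?P (tensor_lift K M M Z \<beta>)"
    unfolding tensor_lift_def by (rule theI')
  then show "tensor_lift K M M Z \<beta> \<in> linear_maps K ?T Z"
    "\<And>v w. \<lbrakk>v \<in> carrier M; w \<in> carrier M\<rbrakk> \<Longrightarrow>
      tensor_lift K M M Z \<beta> (pure_tensor K M M v w) = \<beta> v w"
    by blast+
qed

text \<open>
  Coassociativity involves a lift nested in another one: the inner lift depends on the second tensor
  factor as a parameter, and the outer lift makes sense because this dependence is linear.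
\<close>

lemma tensor_lift_parameter:
  assumes Z: "module K Z" and W: "module K W"
    and \<beta>: "\<And>u. u \<in> carrier W \<Longrightarrow> \<beta> u \<in> bilinear_maps K M M Z"
    and lin: "\<And>v w. \<lbrakk>v \<in> carrier M; w \<in> carrier M\<rbrakk> \<Longrightarrow> (\<lambda>u. \<beta> u v w) \<in> linear_maps K W Z"
    and t: "t \<in> carrier (tensor_algebra K M M)"
  shows "(\<lambda>u. tensor_lift K M M Z (\<beta> u) t) \<in> linear_maps K W Z"
  using t
proof (induction rule: T.tensor_induct)
  case zero
  show ?case
    by (rule linear_maps_cong[OF W linear_maps_const_zero[OF Z]])
      (rule linear_maps_zero[OF T.module_tensor Z tensor_lift_linear[OF Z \<beta>]])
next
  case (add t v w)
  show ?case
    by (rule linear_maps_cong[OF W linear_maps_plus[OF Z add.IH lin[OF add.hyps(2,3)]]])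
      (use add.hyps in \<open>simp add: linear_maps_add[OF tensor_lift_linear[OF Z \<beta>]]
        tensor_lift_pure[OF Z \<beta>]\<close>)
qed

end


section \<open>Two-cocycles\<close>

context field
begin

lemma two_cocycles_Units:
  "\<lbrakk>\<alpha> \<in> two_cocycles R G; \<xi> \<in> carrier G; \<tau> \<in> carrier G\<rbrakk> \<Longrightarrow> \<alpha> \<xi> \<tau> \<in> Units R"
  by (auto simp: two_cocycles_def)

lemma two_cocycles_closed:
  "\<lbrakk>\<alpha> \<in> two_cocycles R G; \<xi> \<in> carrier G; \<tau> \<in> carrier G\<rbrakk> \<Longrightarrow> \<alpha> \<xi> \<tau> \<in> carrier R"
  by (rule Units_closed[OF two_cocycles_Units])

lemma two_cocycles_eq:
  "\<lbrakk>\<alpha> \<in> two_cocycles R G; \<xi> \<in> carrier G; \<tau> \<in> carrier G; \<rho> \<in> carrier G\<rbrakk> \<Longrightarrow>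
    \<alpha> \<xi> \<tau> \<otimes> \<alpha> (\<xi> \<otimes>\<^bsub>G\<^esub> \<tau>) \<rho> = \<alpha> \<tau> \<rho> \<otimes> \<alpha> \<xi> (\<tau> \<otimes>\<^bsub>G\<^esub> \<rho>)"
  by (auto simp: two_cocycles_def)

context
  fixes G :: "('g, 'n) monoid_scheme" and \<alpha>
  assumes G: "group G" and \<alpha>: "\<alpha> \<in> two_cocycles R G"
begin

interpretation G: group G by (rule G)

text \<open>
  Three instances of the cocycle identity, at \<open>(1, 1, s)\<close>, \<open>(s, 1, 1)\<close> and \<open>(s, s\<inverse>, s)\<close>; in each of them a
  common factor cancels, as the values are units.
\<close>

lemma two_cocycles_one_left:
  assumes "\<xi> \<in> carrier G"
  shows "\<alpha> \<one>\<^bsub>G\<^esub> \<xi> = \<alpha> \<one>\<^bsub>G\<^esub> \<one>\<^bsub>G\<^esub>"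
proof -
  have "\<alpha> \<one>\<^bsub>G\<^esub> \<xi> \<otimes> \<alpha> \<one>\<^bsub>G\<^esub> \<one>\<^bsub>G\<^esub> = \<alpha> \<one>\<^bsub>G\<^esub> \<xi> \<otimes> \<alpha> \<one>\<^bsub>G\<^esub> \<xi>"
    using two_cocycles_eq[OF \<alpha> G.one_closed G.one_closed assms] assms
    by (simp add: m_comm two_cocycles_closed[OF \<alpha>])
  then show ?thesis
    using assms by (subst (asm) Units_l_cancel) (auto simp: two_cocycles_Units[OF \<alpha>] two_cocycles_closed[OF \<alpha>])
qed

lemma two_cocycles_one_right:
  assumes "\<xi> \<in> carrier G"
  shows "\<alpha> \<xi> \<one>\<^bsub>G\<^esub> = \<alpha> \<one>\<^bsub>G\<^esub> \<one>\<^bsub>G\<^esub>"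
proof -
  have "\<alpha> \<xi> \<one>\<^bsub>G\<^esub> \<otimes> \<alpha> \<xi> \<one>\<^bsub>G\<^esub> = \<alpha> \<xi> \<one>\<^bsub>G\<^esub> \<otimes> \<alpha> \<one>\<^bsub>G\<^esub> \<one>\<^bsub>G\<^esub>"
    using two_cocycles_eq[OF \<alpha> assms G.one_closed G.one_closed] assms
    by (simp add: m_comm two_cocycles_closed[OF \<alpha>])
  then show ?thesis
    using assms by (subst (asm) Units_l_cancel) (auto simp: two_cocycles_Units[OF \<alpha>] two_cocycles_closed[OF \<alpha>])
qed

lemma two_cocycles_inverse:
  assumes "\<xi> \<in> carrier G"
  shows "\<alpha> \<xi> (inv\<^bsub>G\<^esub> \<xi>) = \<alpha> (inv\<^bsub>G\<^esub> \<xi>) \<xi>"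
proof -
  have "\<alpha> \<one>\<^bsub>G\<^esub> \<one>\<^bsub>G\<^esub> \<otimes> \<alpha> \<xi> (inv\<^bsub>G\<^esub> \<xi>) = \<alpha> \<one>\<^bsub>G\<^esub> \<one>\<^bsub>G\<^esub> \<otimes> \<alpha> (inv\<^bsub>G\<^esub> \<xi>) \<xi>"
    using two_cocycles_eq[OF \<alpha> assms G.inv_closed[OF assms] assms] assms
    by (simp add: m_comm two_cocycles_closed[OF \<alpha>] two_cocycles_one_left[OF assms]
        two_cocycles_one_right[OF assms])
  then show ?thesis
    using assms by (subst (asm) Units_l_cancel) (auto simp: two_cocycles_Units[OF \<alpha>] two_cocycles_closed[OF \<alpha>])
qed

end

lemma finprod_Units:
  assumes "finite S" "\<And>s. s \<in> S \<Longrightarrow> f s \<in> Units R"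
  shows "finprod R f S \<in> Units R"
  using assms
proof (induction S rule: finite_induct)
  case (insert s S)
  then show ?case
    by (subst finprod_insert) (auto simp: Pi_def intro: Units_closed)
qed simp

text \<open>
  The order of the group kills the class of the cocycle. The cocycle
  identity \<open>\<alpha>(s, t) \<alpha>(st, r) = \<alpha>(t, r) \<alpha>(s, tr)\<close> is multiplied over all \<open>r\<close>: the first factor becomes
  a power, and \<open>tr\<close> runs through the group along with \<open>r\<close>.
\<close>

lemma two_cocycle_pow_card:
  fixes G :: "('g, 'n) monoid_scheme"
  assumes G: "group G" "finite (carrier G)" and \<alpha>: "\<alpha> \<in> two_cocycles R G"
    and \<xi>: "\<xi> \<in> carrier G" and \<tau>: "\<tau> \<in> carrier G"
  shows "\<alpha> \<xi> \<tau> [^] card (carrier G) \<otimes> (\<Otimes>\<rho>\<in>carrier G. \<alpha> (\<xi> \<otimes>\<^bsub>G\<^esub> \<tau>) \<rho>) =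
    (\<Otimes>\<rho>\<in>carrier G. \<alpha> \<xi> \<rho>) \<otimes> (\<Otimes>\<rho>\<in>carrier G. \<alpha> \<tau> \<rho>)"
proof -
  interpret G: group G by fact
  note cl = two_cocycles_closed[OF \<alpha>]
  have "\<alpha> \<xi> \<tau> [^] card (carrier G) \<otimes> (\<Otimes>\<rho>\<in>carrier G. \<alpha> (\<xi> \<otimes>\<^bsub>G\<^esub> \<tau>) \<rho>) =
      (\<Otimes>\<rho>\<in>carrier G. \<alpha> \<xi> \<tau> \<otimes> \<alpha> (\<xi> \<otimes>\<^bsub>G\<^esub> \<tau>) \<rho>)"
    using \<xi> \<tau> cl by (simp add: Pi_def finprod_const)
  also have "\<dots> = (\<Otimes>\<rho>\<in>carrier G. \<alpha> \<tau> \<rho> \<otimes> \<alpha> \<xi> (\<tau> \<otimes>\<^bsub>G\<^esub> \<rho>))"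
    using \<xi> \<tau> cl by (intro finprod_cong') (auto simp: two_cocycles_eq[OF \<alpha>])
  also have "\<dots> = (\<Otimes>\<rho>\<in>carrier G. \<alpha> \<tau> \<rho>) \<otimes> (\<Otimes>\<rho>\<in>carrier G. \<alpha> \<xi> (\<tau> \<otimes>\<^bsub>G\<^esub> \<rho>))"
    using \<xi> \<tau> cl by (intro finprod_multf) auto
  also have "(\<Otimes>\<rho>\<in>carrier G. \<alpha> \<xi> (\<tau> \<otimes>\<^bsub>G\<^esub> \<rho>)) = (\<Otimes>\<rho>\<in>carrier G. \<alpha> \<xi> \<rho>)"
    using finprod_reindex[of "\<alpha> \<xi>" "\<lambda>\<rho>. \<tau> \<otimes>\<^bsub>G\<^esub> \<rho>" "carrier G"] \<xi> cl
      G.surj_const_mult[OF \<tau>] G.inj_on_cmult[OF \<tau>] by simp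
  finally show ?thesis
    using \<xi> \<tau> cl by (simp add: m_comm)
qed

end


section \<open>The algebra underlying a bicrossed product\<close>

text \<open>
  This is the bicrossed product of the dual of the group algebra of \<open>I\<close> with the group algebra
  of \<open>G\<close>, with trivial actions and a cocycle on either side. For each \<open>i\<close>, the
  cocycle \<open>a i\<close> twists the multiplication of \<open>G\<close>; for each \<open>\<xi>\<close>, the cocycle \<open>c \<xi>\<close> twists the
  comultiplication dual to the multiplication of \<open>I\<close>. The condition \<open>compatible\<close> says exactly
  that the comultiplication is multiplicative on products of basis elements; \<open>a_one\<close> does the same for
  the counit, and \<open>c_one\<close> gives the counit laws.
\<close>

locale bicrossed_product = field K + I: group I + G: group G
  for K :: "('k, 'm) ring_scheme" (structure) and I :: "nat monoid" and G :: "nat monoid" +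
  fixes a c :: "nat \<Rightarrow> nat \<Rightarrow> nat \<Rightarrow> 'k"
  assumes finite_I: "finite (carrier I)" and finite_G: "finite (carrier G)"
    and a: "i \<in> carrier I \<Longrightarrow> a i \<in> two_cocycles K G"
    and c: "\<xi> \<in> carrier G \<Longrightarrow> c \<xi> \<in> two_cocycles K I"
    and a_one: "\<lbrakk>\<xi> \<in> carrier G; \<tau> \<in> carrier G\<rbrakk> \<Longrightarrow> a \<one>\<^bsub>I\<^esub> \<xi> \<tau> = \<one>"
    and c_one: "\<xi> \<in> carrier G \<Longrightarrow> c \<xi> \<one>\<^bsub>I\<^esub> \<one>\<^bsub>I\<^esub> = \<one>"
    and compatible: "\<lbrakk>i \<in> carrier I; j \<in> carrier I; \<xi> \<in> carrier G; \<tau> \<in> carrier G\<rbrakk> \<Longrightarrow>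
      a (i \<otimes>\<^bsub>I\<^esub> j) \<xi> \<tau> \<otimes> c (\<xi> \<otimes>\<^bsub>G\<^esub> \<tau>) i j = (c \<xi> i j \<otimes> c \<tau> i j) \<otimes> (a i \<xi> \<tau> \<otimes> a j \<xi> \<tau>)"
begin

text \<open>
  Pairs are encoded as numbers because the Hopf algebra has to consist of functions on the natural
  numbers.
\<close>

definition B :: "nat set"
  where "B = prod_encode ` (carrier I \<times> carrier G)"

text \<open>
  The product over \<open>i\<close> of the twisted group algebras of \<open>G\<close> with respect to the cocycles \<open>a i\<close>.
\<close>

definition H :: "('k, nat \<Rightarrow> 'k) module"
  where "H =
    \<lparr>carrier = B \<rightarrow>\<^sub>E carrier K,
     monoid.mult = (\<lambda>x y. \<lambda>p \<in> B. case prod_decode p of (i, \<rho>) \<Rightarrow>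
       \<Oplus>\<xi>\<in>carrier G. x (prod_encode (i, \<xi>)) \<otimes> y (prod_encode (i, inv\<^bsub>G\<^esub> \<xi> \<otimes>\<^bsub>G\<^esub> \<rho>)) \<otimes>
         a i \<xi> (inv\<^bsub>G\<^esub> \<xi> \<otimes>\<^bsub>G\<^esub> \<rho>)),
     one = (\<lambda>p \<in> B. case prod_decode p of (i, \<rho>) \<Rightarrow>
       if \<rho> = \<one>\<^bsub>G\<^esub> then inv (a i \<one>\<^bsub>G\<^esub> \<one>\<^bsub>G\<^esub>) else \<zero>),
     ring.zero = (\<lambda>_ \<in> B. \<zero>),
     add = (\<lambda>x y. \<lambda>p \<in> B. x p \<oplus> y p),
     smult = (\<lambda>r x. \<lambda>p \<in> B. r \<otimes> x p)\<rparr>"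

lemma index_in_B [simp]: "prod_encode (i, \<xi>) \<in> B \<longleftrightarrow> i \<in> carrier I \<and> \<xi> \<in> carrier G"
  by (auto simp: B_def)

lemma B_cases:
  assumes "p \<in> B"
  obtains i \<xi> where "p = prod_encode (i, \<xi>)" "i \<in> carrier I" "\<xi> \<in> carrier G"
  using assms by (auto simp: B_def)

sublocale H: coordinate_space K B H
  by unfold_locales (auto simp: H_def B_def finite_I finite_G)

abbreviation e :: "nat \<Rightarrow> nat \<Rightarrow> nat \<Rightarrow> 'k"
  where "e i \<xi> \<equiv> H.unit_vector (prod_encode (i, \<xi>))"

lemma mult_coordinate:
  "\<lbrakk>i \<in> carrier I; \<rho> \<in> carrier G\<rbrakk> \<Longrightarrow> (x \<otimes>\<^bsub>H\<^esub> y) (prod_encode (i, \<rho>)) =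
    (\<Oplus>\<xi>\<in>carrier G. x (prod_encode (i, \<xi>)) \<otimes> y (prod_encode (i, inv\<^bsub>G\<^esub> \<xi> \<otimes>\<^bsub>G\<^esub> \<rho>)) \<otimes>
         a i \<xi> (inv\<^bsub>G\<^esub> \<xi> \<otimes>\<^bsub>G\<^esub> \<rho>))"
  by (simp add: H_def)

lemma one_coordinate:
  "\<lbrakk>i \<in> carrier I; \<rho> \<in> carrier G\<rbrakk> \<Longrightarrow>
    \<one>\<^bsub>H\<^esub> (prod_encode (i, \<rho>)) = (if \<rho> = \<one>\<^bsub>G\<^esub> then inv (a i \<one>\<^bsub>G\<^esub> \<one>\<^bsub>G\<^esub>) else \<zero>)"
  by (simp add: H_def)

lemma a_closed [simp]: "\<lbrakk>i \<in> carrier I; \<xi> \<in> carrier G; \<tau> \<in> carrier G\<rbrakk> \<Longrightarrow> a i \<xi> \<tau> \<in> carrier K"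
  by (rule two_cocycles_closed[OF a])

lemma a_Units [simp]: "\<lbrakk>i \<in> carrier I; \<xi> \<in> carrier G; \<tau> \<in> carrier G\<rbrakk> \<Longrightarrow> a i \<xi> \<tau> \<in> Units K"
  by (rule two_cocycles_Units[OF a])

lemma c_closed [simp]: "\<lbrakk>\<xi> \<in> carrier G; i \<in> carrier I; j \<in> carrier I\<rbrakk> \<Longrightarrow> c \<xi> i j \<in> carrier K"
  by (rule two_cocycles_closed[OF c])

lemma c_Units [simp]: "\<lbrakk>\<xi> \<in> carrier G; i \<in> carrier I; j \<in> carrier I\<rbrakk> \<Longrightarrow> c \<xi> i j \<in> Units K"
  by (rule two_cocycles_Units[OF c])

lemma coord_closed [simp]:
  "\<lbrakk>x \<in> carrier H; i \<in> carrier I; \<xi> \<in> carrier G\<rbrakk> \<Longrightarrow> x (prod_encode (i, \<xi>)) \<in> carrier K"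
  by (rule H.coordinate_closed) auto

lemma H_ext:
  assumes "x \<in> carrier H" "y \<in> carrier H"
    and "\<And>i \<xi>. \<lbrakk>i \<in> carrier I; \<xi> \<in> carrier G\<rbrakk> \<Longrightarrow>
      x (prod_encode (i, \<xi>)) = y (prod_encode (i, \<xi>))"
  shows "x = y"
  using assms by (intro H.vector_ext) (auto elim: B_cases)

lemma e_coordinate:
  "\<lbrakk>j \<in> carrier I; \<tau> \<in> carrier G\<rbrakk> \<Longrightarrow>
    e i \<xi> (prod_encode (j, \<tau>)) = (if j = i \<and> \<tau> = \<xi> then \<one> else \<zero>)"
  by (simp add: H.unit_vector_def)

lemma mult_closed: "\<lbrakk>x \<in> carrier H; y \<in> carrier H\<rbrakk> \<Longrightarrow> x \<otimes>\<^bsub>H\<^esub> y \<in> carrier H"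
  unfolding H.carrier_eq
  by (auto simp: H_def elim!: B_cases intro!: finsum_closed)

lemma mult_bilinear: "(\<otimes>\<^bsub>H\<^esub>) \<in> bilinear_maps K H H H"
  unfolding bilinear_maps_def mem_Collect_eq
proof (intro conjI ballI linear_mapsI)
  fix x y z r
  assume x: "x \<in> carrier H" and y: "y \<in> carrier H"
  show "x \<otimes>\<^bsub>H\<^esub> y \<in> carrier H" "x \<otimes>\<^bsub>H\<^esub> y \<in> carrier H"
    using x y by (simp_all add: mult_closed)
  {
    assume z: "z \<in> carrier H"
    show "x \<otimes>\<^bsub>H\<^esub> (y \<oplus>\<^bsub>H\<^esub> z) = x \<otimes>\<^bsub>H\<^esub> y \<oplus>\<^bsub>H\<^esub> x \<otimes>\<^bsub>H\<^esub> z"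
    proof (rule H_ext)
      fix i \<rho> assume i: "i \<in> carrier I" and \<rho>: "\<rho> \<in> carrier G"
      show "(x \<otimes>\<^bsub>H\<^esub> (y \<oplus>\<^bsub>H\<^esub> z)) (prod_encode (i, \<rho>)) = (x \<otimes>\<^bsub>H\<^esub> y \<oplus>\<^bsub>H\<^esub> x \<otimes>\<^bsub>H\<^esub> z) (prod_encode (i, \<rho>))"
        using x y z i \<rho> by (simp add: H.add_eq mult_coordinate Pi_def l_distr r_distr flip: finsum_addf
          cong: finsum_cong)
    qed (use x y z in \<open>simp_all add: mult_closed\<close>)
    show "(x \<oplus>\<^bsub>H\<^esub> y) \<otimes>\<^bsub>H\<^esub> z = x \<otimes>\<^bsub>H\<^esub> z \<oplus>\<^bsub>H\<^esub> y \<otimes>\<^bsub>H\<^esub> z"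
    proof (rule H_ext)
      fix i \<rho> assume i: "i \<in> carrier I" and \<rho>: "\<rho> \<in> carrier G"
      show "((x \<oplus>\<^bsub>H\<^esub> y) \<otimes>\<^bsub>H\<^esub> z) (prod_encode (i, \<rho>)) = (x \<otimes>\<^bsub>H\<^esub> z \<oplus>\<^bsub>H\<^esub> y \<otimes>\<^bsub>H\<^esub> z) (prod_encode (i, \<rho>))"
        using x y z i \<rho> by (simp add: H.add_eq mult_coordinate Pi_def l_distr r_distr flip: finsum_addf
          cong: finsum_cong)
    qed (use x y z in \<open>simp_all add: mult_closed\<close>)
  }
  {
    assume r: "r \<in> carrier K"
    show "x \<otimes>\<^bsub>H\<^esub> (r \<odot>\<^bsub>H\<^esub> y) = r \<odot>\<^bsub>H\<^esub> (x \<otimes>\<^bsub>H\<^esub> y)"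
    proof (rule H_ext)
      fix i \<rho> assume i: "i \<in> carrier I" and \<rho>: "\<rho> \<in> carrier G"
      show "(x \<otimes>\<^bsub>H\<^esub> (r \<odot>\<^bsub>H\<^esub> y)) (prod_encode (i, \<rho>)) = (r \<odot>\<^bsub>H\<^esub> (x \<otimes>\<^bsub>H\<^esub> y)) (prod_encode (i, \<rho>))"
        using x y r i \<rho> by (simp add: H.smult_eq mult_coordinate Pi_def finsum_rdistr finite_G m_ac
          cong: finsum_cong)
    qed (use x y r in \<open>simp_all add: mult_closed\<close>)
    show "(r \<odot>\<^bsub>H\<^esub> x) \<otimes>\<^bsub>H\<^esub> y = r \<odot>\<^bsub>H\<^esub> (x \<otimes>\<^bsub>H\<^esub> y)"
    proof (rule H_ext)
      fix i \<rho> assume i: "i \<in> carrier I" and \<rho>: "\<rho> \<in> carrier G"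
      show "((r \<odot>\<^bsub>H\<^esub> x) \<otimes>\<^bsub>H\<^esub> y) (prod_encode (i, \<rho>)) = (r \<odot>\<^bsub>H\<^esub> (x \<otimes>\<^bsub>H\<^esub> y)) (prod_encode (i, \<rho>))"
        using x y r i \<rho> by (simp add: H.smult_eq mult_coordinate Pi_def finsum_rdistr finite_G m_ac
          cong: finsum_cong)
    qed (use x y r in \<open>simp_all add: mult_closed\<close>)
  }
qed

lemma e_mult:
  assumes "i \<in> carrier I" "j \<in> carrier I" "\<xi> \<in> carrier G" "\<tau> \<in> carrier G"
  shows "e i \<xi> \<otimes>\<^bsub>H\<^esub> e j \<tau> = (if i = j then a i \<xi> \<tau> \<odot>\<^bsub>H\<^esub> e i (\<xi> \<otimes>\<^bsub>G\<^esub> \<tau>) else \<zero>\<^bsub>H\<^esub>)"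
proof (rule H_ext)
  fix k \<rho> assume k: "k \<in> carrier I" and \<rho>: "\<rho> \<in> carrier G"
  have "inv\<^bsub>G\<^esub> \<xi> \<otimes>\<^bsub>G\<^esub> \<rho> = \<tau> \<longleftrightarrow> \<rho> = \<xi> \<otimes>\<^bsub>G\<^esub> \<tau>"
    using assms \<rho> by (metis G.inv_solve_left)
  let ?u = "if k = i \<and> k = j \<and> \<rho> = \<xi> \<otimes>\<^bsub>G\<^esub> \<tau> then a i \<xi> \<tau> else \<zero>"
  have "(e i \<xi> \<otimes>\<^bsub>H\<^esub> e j \<tau>) (prod_encode (k, \<rho>)) =
      (\<Oplus>\<mu>\<in>carrier G. if \<xi> = \<mu> then ?u else \<zero>)"
    unfolding mult_coordinate[OF k \<rho>] using assms k \<rho> \<open>_ \<longleftrightarrow> _\<close>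
    by (intro finsum_cong') (auto simp: e_coordinate)
  also have "\<dots> = ?u"
    using assms by (intro finsum_singleton finite_G) auto
  finally show "(e i \<xi> \<otimes>\<^bsub>H\<^esub> e j \<tau>) (prod_encode (k, \<rho>)) =
      (if i = j then a i \<xi> \<tau> \<odot>\<^bsub>H\<^esub> e i (\<xi> \<otimes>\<^bsub>G\<^esub> \<tau>) else \<zero>\<^bsub>H\<^esub>) (prod_encode (k, \<rho>))"
    using assms k \<rho> by (auto simp: H.smult_eq H.zero_eq e_coordinate)
qed (use assms in \<open>auto simp: mult_closed\<close>)

lemma H_basis_eqI:
  assumes "module K Z" "f \<in> linear_maps K H Z" "g \<in> linear_maps K H Z"
    and "\<And>i \<xi>. \<lbrakk>i \<in> carrier I; \<xi> \<in> carrier G\<rbrakk> \<Longrightarrow> f (e i \<xi>) = g (e i \<xi>)"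
    and "x \<in> carrier H"
  shows "f x = g x"
  using H.linear_maps_eqI[OF assms(1-3) _ assms(5)] assms(4) by (metis B_cases)

lemma e_mult_assoc:
  assumes "i \<in> carrier I" "j \<in> carrier I" "k \<in> carrier I"
    "\<xi> \<in> carrier G" "\<tau> \<in> carrier G" "\<rho> \<in> carrier G"
  shows "(e i \<xi> \<otimes>\<^bsub>H\<^esub> e j \<tau>) \<otimes>\<^bsub>H\<^esub> e k \<rho> = e i \<xi> \<otimes>\<^bsub>H\<^esub> (e j \<tau> \<otimes>\<^bsub>H\<^esub> e k \<rho>)"
proof -
  note left = bilinear_maps_left[OF mult_bilinear] and right = bilinear_maps_right[OF mult_bilinear]
  note mod = H.M.module_axioms
  have zero: "\<zero>\<^bsub>H\<^esub> \<otimes>\<^bsub>H\<^esub> x = \<zero>\<^bsub>H\<^esub>" "x \<otimes>\<^bsub>H\<^esub> \<zero>\<^bsub>H\<^esub> = \<zero>\<^bsub>H\<^esub>" if "x \<in> carrier H" for x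
    using that linear_maps_zero[OF mod mod left] linear_maps_zero[OF mod mod right] by auto
  have smult: "(r \<odot>\<^bsub>H\<^esub> x) \<otimes>\<^bsub>H\<^esub> y = r \<odot>\<^bsub>H\<^esub> (x \<otimes>\<^bsub>H\<^esub> y)" "x \<otimes>\<^bsub>H\<^esub> (r \<odot>\<^bsub>H\<^esub> y) = r \<odot>\<^bsub>H\<^esub> (x \<otimes>\<^bsub>H\<^esub> y)"
    if "r \<in> carrier K" "x \<in> carrier H" "y \<in> carrier H" for r x y
    using that linear_maps_smult[OF left] linear_maps_smult[OF right] by auto
  show ?thesis
  proof (cases "i = j \<and> j = k")
    case True
    then have "(e i \<xi> \<otimes>\<^bsub>H\<^esub> e j \<tau>) \<otimes>\<^bsub>H\<^esub> e k \<rho> =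
        (a i \<xi> \<tau> \<otimes> a i (\<xi> \<otimes>\<^bsub>G\<^esub> \<tau>) \<rho>) \<odot>\<^bsub>H\<^esub> e i (\<xi> \<otimes>\<^bsub>G\<^esub> \<tau> \<otimes>\<^bsub>G\<^esub> \<rho>)"
      using assms by (simp add: e_mult smult H.M.smult_assoc1)
    also have "\<dots> = (a i \<tau> \<rho> \<otimes> a i \<xi> (\<tau> \<otimes>\<^bsub>G\<^esub> \<rho>)) \<odot>\<^bsub>H\<^esub> e i (\<xi> \<otimes>\<^bsub>G\<^esub> (\<tau> \<otimes>\<^bsub>G\<^esub> \<rho>))"
      using assms two_cocycles_eq[OF a[of i] assms(4-6)] by (simp add: G.m_assoc)
    also have "\<dots> = e i \<xi> \<otimes>\<^bsub>H\<^esub> (e j \<tau> \<otimes>\<^bsub>H\<^esub> e k \<rho>)"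
      using True assms by (simp add: e_mult smult H.M.smult_assoc1)
    finally show ?thesis .
  next
    case False
    then show ?thesis
      using assms by (auto simp: e_mult smult zero)
  qed
qed

text \<open>
  Both sides are linear in each argument, and the three arguments are reduced to basis elements one
  after the other.
\<close>

lemma mult_assoc:
  assumes "x \<in> carrier H" "y \<in> carrier H" "z \<in> carrier H"
  shows "(x \<otimes>\<^bsub>H\<^esub> y) \<otimes>\<^bsub>H\<^esub> z = x \<otimes>\<^bsub>H\<^esub> (y \<otimes>\<^bsub>H\<^esub> z)"
proof -
  note left = bilinear_maps_left[OF mult_bilinear] and right = bilinear_maps_right[OF mult_bilinear]
  note ext = H_basis_eqI[OF H.M.module_axioms]
  have 1: "(e i \<xi> \<otimes>\<^bsub>H\<^esub> e j \<tau>) \<otimes>\<^bsub>H\<^esub> z = e i \<xi> \<otimes>\<^bsub>H\<^esub> (e j \<tau> \<otimes>\<^bsub>H\<^esub> z)"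
    if "i \<in> carrier I" "j \<in> carrier I" "\<xi> \<in> carrier G" "\<tau> \<in> carrier G" "z \<in> carrier H" for i j \<xi> \<tau> z
    by (rule ext[OF right linear_maps_comp[OF right right]])
      (use that in \<open>auto simp: mult_closed e_mult_assoc\<close>)
  have 2: "(e i \<xi> \<otimes>\<^bsub>H\<^esub> y) \<otimes>\<^bsub>H\<^esub> z = e i \<xi> \<otimes>\<^bsub>H\<^esub> (y \<otimes>\<^bsub>H\<^esub> z)"
    if "i \<in> carrier I" "\<xi> \<in> carrier G" "y \<in> carrier H" "z \<in> carrier H" for i \<xi> y z
    by (rule ext[OF linear_maps_comp[OF right left] linear_maps_comp[OF left right]])
      (use that in \<open>auto simp: mult_closed 1\<close>)
  show ?thesis
    by (rule ext[OF linear_maps_comp[OF left left] left])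
      (use assms in \<open>auto simp: mult_closed 2\<close>)
qed

lemma a_one_left: "\<lbrakk>i \<in> carrier I; \<xi> \<in> carrier G\<rbrakk> \<Longrightarrow> a i \<one>\<^bsub>G\<^esub> \<xi> = a i \<one>\<^bsub>G\<^esub> \<one>\<^bsub>G\<^esub>"
  by (rule two_cocycles_one_left[OF G.is_group a])

lemma a_one_right: "\<lbrakk>i \<in> carrier I; \<xi> \<in> carrier G\<rbrakk> \<Longrightarrow> a i \<xi> \<one>\<^bsub>G\<^esub> = a i \<one>\<^bsub>G\<^esub> \<one>\<^bsub>G\<^esub>"
  by (rule two_cocycles_one_right[OF G.is_group a])

lemma c_one_left: "\<lbrakk>\<xi> \<in> carrier G; i \<in> carrier I\<rbrakk> \<Longrightarrow> c \<xi> \<one>\<^bsub>I\<^esub> i = \<one>"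
  using two_cocycles_one_left[OF I.is_group c] by (simp add: c_one)

lemma c_one_right: "\<lbrakk>\<xi> \<in> carrier G; i \<in> carrier I\<rbrakk> \<Longrightarrow> c \<xi> i \<one>\<^bsub>I\<^esub> = \<one>"
  using two_cocycles_one_right[OF I.is_group c] by (simp add: c_one)

lemma one_closed: "\<one>\<^bsub>H\<^esub> \<in> carrier H"
  unfolding H.carrier_eq by (auto simp: H_def elim!: B_cases)

lemma mult_one_left:
  assumes x: "x \<in> carrier H"
  shows "\<one>\<^bsub>H\<^esub> \<otimes>\<^bsub>H\<^esub> x = x"
proof (rule H_ext[OF mult_closed[OF one_closed x] x])
  fix i \<rho> assume i: "i \<in> carrier I" and \<rho>: "\<rho> \<in> carrier G"
  have "(\<one>\<^bsub>H\<^esub> \<otimes>\<^bsub>H\<^esub> x) (prod_encode (i, \<rho>)) =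
      (\<Oplus>\<mu>\<in>carrier G. if \<one>\<^bsub>G\<^esub> = \<mu> then x (prod_encode (i, \<rho>)) else \<zero>)"
    unfolding mult_coordinate[OF i \<rho>]
  proof (rule finsum_cong')
    fix \<mu> assume \<mu>: "\<mu> \<in> carrier G"
    have "inv (a i \<one>\<^bsub>G\<^esub> \<one>\<^bsub>G\<^esub>) \<otimes> x (prod_encode (i, \<rho>)) \<otimes> a i \<one>\<^bsub>G\<^esub> \<one>\<^bsub>G\<^esub> =
        x (prod_encode (i, \<rho>)) \<otimes> (inv (a i \<one>\<^bsub>G\<^esub> \<one>\<^bsub>G\<^esub>) \<otimes> a i \<one>\<^bsub>G\<^esub> \<one>\<^bsub>G\<^esub>)"
      using x i \<rho> by (simp add: m_ac)
    then show "\<one>\<^bsub>H\<^esub> (prod_encode (i, \<mu>)) \<otimes> x (prod_encode (i, inv\<^bsub>G\<^esub> \<mu> \<otimes>\<^bsub>G\<^esub> \<rho>)) \<otimes>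
        a i \<mu> (inv\<^bsub>G\<^esub> \<mu> \<otimes>\<^bsub>G\<^esub> \<rho>) = (if \<one>\<^bsub>G\<^esub> = \<mu> then x (prod_encode (i, \<rho>)) else \<zero>)"
      using x i \<rho> \<mu> by (auto simp: one_coordinate a_one_left[of i \<rho>])
  qed (use x i \<rho> in auto)
  also have "\<dots> = x (prod_encode (i, \<rho>))"
    using x i \<rho> by (intro finsum_singleton finite_G) auto
  finally show "(\<one>\<^bsub>H\<^esub> \<otimes>\<^bsub>H\<^esub> x) (prod_encode (i, \<rho>)) = x (prod_encode (i, \<rho>))" .
qed

lemma mult_one_right:
  assumes x: "x \<in> carrier H"
  shows "x \<otimes>\<^bsub>H\<^esub> \<one>\<^bsub>H\<^esub> = x"
proof (rule H_ext[OF mult_closed[OF x one_closed] x])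
  fix i \<rho> assume i: "i \<in> carrier I" and \<rho>: "\<rho> \<in> carrier G"
  have "(x \<otimes>\<^bsub>H\<^esub> \<one>\<^bsub>H\<^esub>) (prod_encode (i, \<rho>)) =
      (\<Oplus>\<mu>\<in>carrier G. if \<rho> = \<mu> then x (prod_encode (i, \<rho>)) else \<zero>)"
    unfolding mult_coordinate[OF i \<rho>]
  proof (rule finsum_cong')
    fix \<mu> assume \<mu>: "\<mu> \<in> carrier G"
    have "inv\<^bsub>G\<^esub> \<mu> \<otimes>\<^bsub>G\<^esub> \<rho> = \<one>\<^bsub>G\<^esub> \<longleftrightarrow> \<rho> = \<mu>"
      using \<mu> \<rho> by (metis G.inv_solve_left G.one_closed G.r_one)
    then show "x (prod_encode (i, \<mu>)) \<otimes> \<one>\<^bsub>H\<^esub> (prod_encode (i, inv\<^bsub>G\<^esub> \<mu> \<otimes>\<^bsub>G\<^esub> \<rho>)) \<otimes>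
        a i \<mu> (inv\<^bsub>G\<^esub> \<mu> \<otimes>\<^bsub>G\<^esub> \<rho>) = (if \<rho> = \<mu> then x (prod_encode (i, \<rho>)) else \<zero>)"
      using x i \<rho> \<mu> by (auto simp: one_coordinate a_one_right[of i \<mu>] m_assoc)
  qed (use x i \<rho> in auto)
  also have "\<dots> = x (prod_encode (i, \<rho>))"
    using x i \<rho> by (intro finsum_singleton finite_G) auto
  finally show "(x \<otimes>\<^bsub>H\<^esub> \<one>\<^bsub>H\<^esub>) (prod_encode (i, \<rho>)) = x (prod_encode (i, \<rho>))" .
qed

lemma ring_H: "ring H"
proof (intro ringI H.M.abelian_group_axioms monoidI)
  show "\<one>\<^bsub>H\<^esub> \<in> carrier H"
    by (rule one_closed)
  fix x y z assume x: "x \<in> carrier H"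
  show "\<one>\<^bsub>H\<^esub> \<otimes>\<^bsub>H\<^esub> x = x" "x \<otimes>\<^bsub>H\<^esub> \<one>\<^bsub>H\<^esub> = x"
    using x by (simp_all add: mult_one_left mult_one_right)
  assume y: "y \<in> carrier H"
  show "x \<otimes>\<^bsub>H\<^esub> y \<in> carrier H"
    using x y by (rule mult_closed)
  assume z: "z \<in> carrier H"
  show "(x \<otimes>\<^bsub>H\<^esub> y) \<otimes>\<^bsub>H\<^esub> z = x \<otimes>\<^bsub>H\<^esub> (y \<otimes>\<^bsub>H\<^esub> z)"
    using x y z by (rule mult_assoc)
  show "(x \<oplus>\<^bsub>H\<^esub> y) \<otimes>\<^bsub>H\<^esub> z = x \<otimes>\<^bsub>H\<^esub> z \<oplus>\<^bsub>H\<^esub> y \<otimes>\<^bsub>H\<^esub> z"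
    using linear_maps_add[OF bilinear_maps_left[OF mult_bilinear z] x y] .
  show "z \<otimes>\<^bsub>H\<^esub> (x \<oplus>\<^bsub>H\<^esub> y) = z \<otimes>\<^bsub>H\<^esub> x \<oplus>\<^bsub>H\<^esub> z \<otimes>\<^bsub>H\<^esub> y"
    using linear_maps_add[OF bilinear_maps_right[OF mult_bilinear z] x y] .
qed

lemma assoc_algebra_H: "assoc_algebra K H"
proof (rule assoc_algebra.intro[OF H.M.module_axioms ring_H], rule assoc_algebra_axioms.intro)
  fix r x y assume r: "r \<in> carrier K" and x: "x \<in> carrier H" and y: "y \<in> carrier H"
  show "(r \<odot>\<^bsub>H\<^esub> x) \<otimes>\<^bsub>H\<^esub> y = r \<odot>\<^bsub>H\<^esub> (x \<otimes>\<^bsub>H\<^esub> y)"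
    using linear_maps_smult[OF bilinear_maps_left[OF mult_bilinear y] r x] .
  show "x \<otimes>\<^bsub>H\<^esub> (r \<odot>\<^bsub>H\<^esub> y) = r \<odot>\<^bsub>H\<^esub> (x \<otimes>\<^bsub>H\<^esub> y)"
    using linear_maps_smult[OF bilinear_maps_right[OF mult_bilinear x] r y] .
qed

lemma algebra_pair_H: "algebra_pair K H H"
  by (intro algebra_pair.intro assoc_algebra_H)

abbreviation "HH \<equiv> tensor_algebra K H H"
abbreviation pure (infixl "\<otimes>\<^sub>t" 71) where "pure x y \<equiv> pure_tensor K H H x y"

sublocale HH: module K HH
  by (rule H.T.module_tensor)

lemma one_eq: "\<one>\<^bsub>H\<^esub> = (\<Oplus>\<^bsub>H\<^esub>i\<in>carrier I. inv (a i \<one>\<^bsub>G\<^esub> \<one>\<^bsub>G\<^esub>) \<odot>\<^bsub>H\<^esub> e i \<one>\<^bsub>G\<^esub>)"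
proof (rule H_ext)
  have cl: "(\<lambda>i. inv (a i \<one>\<^bsub>G\<^esub> \<one>\<^bsub>G\<^esub>) \<odot>\<^bsub>H\<^esub> e i \<one>\<^bsub>G\<^esub>) \<in> carrier I \<rightarrow> carrier H"
    by auto
  then show "(\<Oplus>\<^bsub>H\<^esub>i\<in>carrier I. inv (a i \<one>\<^bsub>G\<^esub> \<one>\<^bsub>G\<^esub>) \<odot>\<^bsub>H\<^esub> e i \<one>\<^bsub>G\<^esub>) \<in> carrier H"
    by (rule H.M.finsum_closed)
  fix k \<rho> assume k: "k \<in> carrier I" and \<rho>: "\<rho> \<in> carrier G"
  let ?u = "\<one>\<^bsub>H\<^esub> (prod_encode (k, \<rho>))"
  have "(\<Oplus>\<^bsub>H\<^esub>i\<in>carrier I. inv (a i \<one>\<^bsub>G\<^esub> \<one>\<^bsub>G\<^esub>) \<odot>\<^bsub>H\<^esub> e i \<one>\<^bsub>G\<^esub>) (prod_encode (k, \<rho>)) =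
      (\<Oplus>i\<in>carrier I. (inv (a i \<one>\<^bsub>G\<^esub> \<one>\<^bsub>G\<^esub>) \<odot>\<^bsub>H\<^esub> e i \<one>\<^bsub>G\<^esub>) (prod_encode (k, \<rho>)))"
    using k \<rho> by (intro H.finsum_coordinate finite_I cl) simp
  also have "\<dots> = (\<Oplus>i\<in>carrier I. if k = i then ?u else \<zero>)"
    using k \<rho> by (intro finsum_cong') (auto simp: H.smult_eq e_coordinate one_coordinate)
  also have "\<dots> = ?u"
    using k \<rho> by (intro finsum_singleton finite_I) (auto simp: one_coordinate)
  finally show "?u = (\<Oplus>\<^bsub>H\<^esub>i\<in>carrier I. inv (a i \<one>\<^bsub>G\<^esub> \<one>\<^bsub>G\<^esub>) \<odot>\<^bsub>H\<^esub> e i \<one>\<^bsub>G\<^esub>) (prod_encode (k, \<rho>))"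
    by (rule sym)
qed (rule one_closed)


section \<open>The Hopf algebra structure of a bicrossed product\<close>

text \<open>
  The sum runs over all factorisations \<open>m = i k\<close> in \<open>I\<close>, parametrised by \<open>i\<close>.
\<close>

definition comult :: "(nat \<Rightarrow> 'k) \<Rightarrow> ('k, nat \<Rightarrow> 'k, nat \<Rightarrow> 'k) tensor"
  where "comult = H.linear_extension HH (\<lambda>p. case prod_decode p of (m, \<xi>) \<Rightarrow>
    \<Oplus>\<^bsub>HH\<^esub>i\<in>carrier I. c \<xi> i (inv\<^bsub>I\<^esub> i \<otimes>\<^bsub>I\<^esub> m) \<odot>\<^bsub>HH\<^esub> (e i \<xi> \<otimes>\<^sub>t e (inv\<^bsub>I\<^esub> i \<otimes>\<^bsub>I\<^esub> m) \<xi>))"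

definition counit :: "(nat \<Rightarrow> 'k) \<Rightarrow> 'k"
  where "counit = H.linear_extension (ground_algebra K)
    (\<lambda>p. if fst (prod_decode p) = \<one>\<^bsub>I\<^esub> then \<one> else \<zero>)"

text \<open>
  Up to a scalar, the antipode inverts both indices. The scalar is forced by the left antipode law:
  multiplied by the structure constants of the comultiplication and of the product, it has to give
  the coefficient of the unit element (\<open>antipode_cancel\<close>).
\<close>

definition antipode :: "(nat \<Rightarrow> 'k) \<Rightarrow> (nat \<Rightarrow> 'k)"
  where "antipode = H.linear_extension H (\<lambda>p. case prod_decode p of (i, \<xi>) \<Rightarrow>
    inv (c \<xi> i (inv\<^bsub>I\<^esub> i) \<otimes> a (inv\<^bsub>I\<^esub> i) (inv\<^bsub>G\<^esub> \<xi>) \<xi> \<otimes> a (inv\<^bsub>I\<^esub> i) \<one>\<^bsub>G\<^esub> \<one>\<^bsub>G\<^esub>) \<odot>\<^bsub>H\<^esub>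
      e (inv\<^bsub>I\<^esub> i) (inv\<^bsub>G\<^esub> \<xi>))"

lemma module_ground: "module K (ground_algebra K)"
  by (rule module_ground_algebra[OF is_cring])

lemma comult_linear: "comult \<in> linear_maps K H HH"
  and comult_e: "\<lbrakk>m \<in> carrier I; \<xi> \<in> carrier G\<rbrakk> \<Longrightarrow> comult (e m \<xi>) =
    (\<Oplus>\<^bsub>HH\<^esub>i\<in>carrier I. c \<xi> i (inv\<^bsub>I\<^esub> i \<otimes>\<^bsub>I\<^esub> m) \<odot>\<^bsub>HH\<^esub> (e i \<xi> \<otimes>\<^sub>t e (inv\<^bsub>I\<^esub> i \<otimes>\<^bsub>I\<^esub> m) \<xi>))"
proof -
  have *: "(\<lambda>p. case prod_decode p of (m, \<xi>) \<Rightarrow>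
      \<Oplus>\<^bsub>HH\<^esub>i\<in>carrier I. c \<xi> i (inv\<^bsub>I\<^esub> i \<otimes>\<^bsub>I\<^esub> m) \<odot>\<^bsub>HH\<^esub> (e i \<xi> \<otimes>\<^sub>t e (inv\<^bsub>I\<^esub> i \<otimes>\<^bsub>I\<^esub> m) \<xi>))
    \<in> B \<rightarrow> carrier HH"
    by (auto elim!: B_cases intro!: HH.finsum_closed)
  show "comult \<in> linear_maps K H HH"
    unfolding comult_def by (rule H.linear_extension_linear[OF HH.module_axioms *])
  show "comult (e m \<xi>) =
    (\<Oplus>\<^bsub>HH\<^esub>i\<in>carrier I. c \<xi> i (inv\<^bsub>I\<^esub> i \<otimes>\<^bsub>I\<^esub> m) \<odot>\<^bsub>HH\<^esub> (e i \<xi> \<otimes>\<^sub>t e (inv\<^bsub>I\<^esub> i \<otimes>\<^bsub>I\<^esub> m) \<xi>))"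
    if "m \<in> carrier I" "\<xi> \<in> carrier G"
    unfolding comult_def
    using that by (subst H.linear_extension_unit_vector[OF HH.module_axioms *]) simp_all
qed

lemma counit_linear: "counit \<in> linear_maps K H (ground_algebra K)"
  and counit_e: "\<lbrakk>m \<in> carrier I; \<xi> \<in> carrier G\<rbrakk> \<Longrightarrow> counit (e m \<xi>) = (if m = \<one>\<^bsub>I\<^esub> then \<one> else \<zero>)"
proof -
  have *: "(\<lambda>p. if fst (prod_decode p) = \<one>\<^bsub>I\<^esub> then \<one> else \<zero>) \<in> B \<rightarrow> carrier (ground_algebra K)"
    by (auto simp: ground_algebra_simps)
  show "counit \<in> linear_maps K H (ground_algebra K)"
    unfolding counit_def by (rule H.linear_extension_linear[OF module_ground *])
  show "counit (e m \<xi>) = (if m = \<one>\<^bsub>I\<^esub> then \<one> else \<zero>)" if "m \<in> carrier I" "\<xi> \<in> carrier G"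
    unfolding counit_def
    using that by (subst H.linear_extension_unit_vector[OF module_ground *]) simp_all
qed

lemma antipode_linear: "antipode \<in> linear_maps K H H"
  and antipode_e: "\<lbrakk>i \<in> carrier I; \<xi> \<in> carrier G\<rbrakk> \<Longrightarrow> antipode (e i \<xi>) =
    inv (c \<xi> i (inv\<^bsub>I\<^esub> i) \<otimes> a (inv\<^bsub>I\<^esub> i) (inv\<^bsub>G\<^esub> \<xi>) \<xi> \<otimes> a (inv\<^bsub>I\<^esub> i) \<one>\<^bsub>G\<^esub> \<one>\<^bsub>G\<^esub>) \<odot>\<^bsub>H\<^esub>
      e (inv\<^bsub>I\<^esub> i) (inv\<^bsub>G\<^esub> \<xi>)"
proof -
  have *: "(\<lambda>p. case prod_decode p of (i, \<xi>) \<Rightarrow>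
    inv (c \<xi> i (inv\<^bsub>I\<^esub> i) \<otimes> a (inv\<^bsub>I\<^esub> i) (inv\<^bsub>G\<^esub> \<xi>) \<xi> \<otimes> a (inv\<^bsub>I\<^esub> i) \<one>\<^bsub>G\<^esub> \<one>\<^bsub>G\<^esub>) \<odot>\<^bsub>H\<^esub>
      e (inv\<^bsub>I\<^esub> i) (inv\<^bsub>G\<^esub> \<xi>)) \<in> B \<rightarrow> carrier H"
    by (auto elim!: B_cases intro!: H.M.smult_closed Units_inv_closed Units_m_closed)
  show "antipode \<in> linear_maps K H H"
    unfolding antipode_def by (rule H.linear_extension_linear[OF H.M.module_axioms *])
  show "antipode (e i \<xi>) =
    inv (c \<xi> i (inv\<^bsub>I\<^esub> i) \<otimes> a (inv\<^bsub>I\<^esub> i) (inv\<^bsub>G\<^esub> \<xi>) \<xi> \<otimes> a (inv\<^bsub>I\<^esub> i) \<one>\<^bsub>G\<^esub> \<one>\<^bsub>G\<^esub>) \<odot>\<^bsub>H\<^esub>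
      e (inv\<^bsub>I\<^esub> i) (inv\<^bsub>G\<^esub> \<xi>)" if "i \<in> carrier I" "\<xi> \<in> carrier G"
    unfolding antipode_def
    using that by (subst H.linear_extension_unit_vector[OF H.M.module_axioms *]) simp_all
qed

lemma linear_maps_comult_e:
  assumes Z: "module K Z" and f: "f \<in> linear_maps K HH Z" and "m \<in> carrier I" "\<xi> \<in> carrier G"
  shows "f (comult (e m \<xi>)) = (\<Oplus>\<^bsub>Z\<^esub>i\<in>carrier I. c \<xi> i (inv\<^bsub>I\<^esub> i \<otimes>\<^bsub>I\<^esub> m) \<odot>\<^bsub>Z\<^esub>
    f (e i \<xi> \<otimes>\<^sub>t e (inv\<^bsub>I\<^esub> i \<otimes>\<^bsub>I\<^esub> m) \<xi>))"
proof -
  interpret Z: module K Z by (rule Z)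
  have "f (comult (e m \<xi>)) = (\<Oplus>\<^bsub>Z\<^esub>i\<in>carrier I.
      f (c \<xi> i (inv\<^bsub>I\<^esub> i \<otimes>\<^bsub>I\<^esub> m) \<odot>\<^bsub>HH\<^esub> (e i \<xi> \<otimes>\<^sub>t e (inv\<^bsub>I\<^esub> i \<otimes>\<^bsub>I\<^esub> m) \<xi>)))"
    unfolding comult_e[OF assms(3,4)] using assms(3,4)
    by (intro linear_maps_finsum[OF HH.module_axioms Z f] finite_I) auto
  also have "\<dots> = (\<Oplus>\<^bsub>Z\<^esub>i\<in>carrier I. c \<xi> i (inv\<^bsub>I\<^esub> i \<otimes>\<^bsub>I\<^esub> m) \<odot>\<^bsub>Z\<^esub>
      f (e i \<xi> \<otimes>\<^sub>t e (inv\<^bsub>I\<^esub> i \<otimes>\<^bsub>I\<^esub> m) \<xi>))"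
    using assms(3,4) linear_maps_closed[OF f]
    by (intro Z.finsum_cong') (auto simp: linear_maps_smult[OF f])
  finally show ?thesis .
qed

text \<open>
  The laws of coassociativity, counit and antipode are about lifts applied to a comultiplication; this
  gives their values on the basis.
\<close>

lemma tensor_lift_comult_e:
  assumes Z: "module K Z" and \<beta>: "\<beta> \<in> bilinear_maps K H H Z" and "m \<in> carrier I" "\<xi> \<in> carrier G"
  shows "tensor_lift K H H Z \<beta> (comult (e m \<xi>)) = (\<Oplus>\<^bsub>Z\<^esub>i\<in>carrier I. c \<xi> i (inv\<^bsub>I\<^esub> i \<otimes>\<^bsub>I\<^esub> m) \<odot>\<^bsub>Z\<^esub>
    \<beta> (e i \<xi>) (e (inv\<^bsub>I\<^esub> i \<otimes>\<^bsub>I\<^esub> m) \<xi>))"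
  using linear_maps_comult_e[OF Z H.tensor_lift_linear[OF Z \<beta>] assms(3,4)]
  by (simp add: H.tensor_lift_pure[OF Z \<beta>])

text \<open>
  In the product of the two sums, the left tensor factors annihilate each other unless \<open>i = j\<close>,
  and then the right factors do so unless \<open>m = m'\<close>. What remains agrees term by term with the
  comultiplication of the product, by \<open>compatible\<close>.
\<close>

lemma comult_mult_e:
  assumes m: "m \<in> carrier I" "m' \<in> carrier I" and \<xi>: "\<xi> \<in> carrier G" "\<tau> \<in> carrier G"
  shows "comult (e m \<xi> \<otimes>\<^bsub>H\<^esub> e m' \<tau>) = comult (e m \<xi>) \<otimes>\<^bsub>HH\<^esub> comult (e m' \<tau>)"
proof -
  interpret A: algebra_pair K H H by (rule algebra_pair_H)
  note bil = A.tensor_mult_bilinear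
  note tens = H.T.pure_tensor_bilinear
  have smult: "(r \<odot>\<^bsub>HH\<^esub> s) \<otimes>\<^bsub>HH\<^esub> (q \<odot>\<^bsub>HH\<^esub> t) = (r \<otimes> q) \<odot>\<^bsub>HH\<^esub> (s \<otimes>\<^bsub>HH\<^esub> t)"
    if "r \<in> carrier K" "q \<in> carrier K" "s \<in> carrier HH" "t \<in> carrier HH" for r q s t
    using that by (simp add: A.tensor_mult_smult_left A.tensor_mult_smult_right A.tensor_mult_closed m_comm
        flip: HH.smult_assoc1)
  have pure_smult: "(r \<odot>\<^bsub>H\<^esub> x) \<otimes>\<^sub>t (q \<odot>\<^bsub>H\<^esub> y) = (r \<otimes> q) \<odot>\<^bsub>HH\<^esub> (x \<otimes>\<^sub>t y)"
    if "r \<in> carrier K" "q \<in> carrier K" "x \<in> carrier H" "y \<in> carrier H" for r q x y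
    using that linear_maps_smult[OF bilinear_maps_left[OF tens]]
      linear_maps_smult[OF bilinear_maps_right[OF tens]]
    by (simp add: m_comm flip: HH.smult_assoc1)
  have pure_zero: "\<zero>\<^bsub>H\<^esub> \<otimes>\<^sub>t x = \<zero>\<^bsub>HH\<^esub>" "x \<otimes>\<^sub>t \<zero>\<^bsub>H\<^esub> = \<zero>\<^bsub>HH\<^esub>" if "x \<in> carrier H" for x
    using that linear_maps_zero[OF H.M.module_axioms HH.module_axioms bilinear_maps_left[OF tens]]
      linear_maps_zero[OF H.M.module_axioms HH.module_axioms bilinear_maps_right[OF tens]] by auto
  let ?X = "\<lambda>i. (a m \<xi> \<tau> \<otimes> c (\<xi> \<otimes>\<^bsub>G\<^esub> \<tau>) i (inv\<^bsub>I\<^esub> i \<otimes>\<^bsub>I\<^esub> m)) \<odot>\<^bsub>HH\<^esub>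
    (e i (\<xi> \<otimes>\<^bsub>G\<^esub> \<tau>) \<otimes>\<^sub>t e (inv\<^bsub>I\<^esub> i \<otimes>\<^bsub>I\<^esub> m) (\<xi> \<otimes>\<^bsub>G\<^esub> \<tau>))"
  let ?Y = "\<lambda>i. if m = m' then ?X i else \<zero>\<^bsub>HH\<^esub>"
  let ?l = "\<lambda>i. c \<xi> i (inv\<^bsub>I\<^esub> i \<otimes>\<^bsub>I\<^esub> m) \<odot>\<^bsub>HH\<^esub> (e i \<xi> \<otimes>\<^sub>t e (inv\<^bsub>I\<^esub> i \<otimes>\<^bsub>I\<^esub> m) \<xi>)"
  let ?r = "\<lambda>j. c \<tau> j (inv\<^bsub>I\<^esub> j \<otimes>\<^bsub>I\<^esub> m') \<odot>\<^bsub>HH\<^esub> (e j \<tau> \<otimes>\<^sub>t e (inv\<^bsub>I\<^esub> j \<otimes>\<^bsub>I\<^esub> m') \<tau>)"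
  have product: "?l i \<otimes>\<^bsub>HH\<^esub> ?r j = (if i = j then ?Y j else \<zero>\<^bsub>HH\<^esub>)"
    if i: "i \<in> carrier I" and j: "j \<in> carrier I" for i j
  proof -
    let ?k = "inv\<^bsub>I\<^esub> i \<otimes>\<^bsub>I\<^esub> m" and ?k' = "inv\<^bsub>I\<^esub> j \<otimes>\<^bsub>I\<^esub> m'"
    have k: "?k \<in> carrier I" "?k' \<in> carrier I" using i j m by auto
    have "?l i \<otimes>\<^bsub>HH\<^esub> ?r j = (c \<xi> i ?k \<otimes> c \<tau> j ?k') \<odot>\<^bsub>HH\<^esub>
        ((e i \<xi> \<otimes>\<^bsub>H\<^esub> e j \<tau>) \<otimes>\<^sub>t (e ?k \<xi> \<otimes>\<^bsub>H\<^esub> e ?k' \<tau>))"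
      using i j k \<xi> by (simp add: smult tensor_mult_pure[OF assoc_algebra_H assoc_algebra_H])
    also have "\<dots> = (if i = j then ?Y j else \<zero>\<^bsub>HH\<^esub>)"
    proof (cases "i = j \<and> m = m'")
      case True
      have "a m \<xi> \<tau> \<otimes> c (\<xi> \<otimes>\<^bsub>G\<^esub> \<tau>) i ?k = (c \<xi> i ?k \<otimes> c \<tau> i ?k) \<otimes> (a i \<xi> \<tau> \<otimes> a ?k \<xi> \<tau>)"
        using compatible[OF i k(1) \<xi>] i m by (simp add: I.m_assoc[symmetric])
      then show ?thesis
        using True i k \<xi> by (simp add: e_mult pure_smult HH.smult_assoc1)
    next
      case False
      moreover have "?k \<noteq> ?k'" if "i = j" "m \<noteq> m'"
        using that i m by simp
      ultimately show ?thesis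
        using i j k \<xi> by (auto simp: e_mult pure_zero mult_closed)
    qed
    finally show ?thesis .
  qed
  have X: "?X i \<in> carrier HH" if "i \<in> carrier I" for i
    using that m \<xi> by auto
  have "comult (e m \<xi>) \<otimes>\<^bsub>HH\<^esub> comult (e m' \<tau>) = (\<Oplus>\<^bsub>HH\<^esub>i\<in>carrier I. \<Oplus>\<^bsub>HH\<^esub>j\<in>carrier I. ?l i \<otimes>\<^bsub>HH\<^esub> ?r j)"
    unfolding comult_e[OF m(1) \<xi>(1)] comult_e[OF m(2) \<xi>(2)] using m \<xi>
    by (intro linear_maps_finsum_bilinear[OF HH.module_axioms HH.module_axioms HH.module_axioms bil]
        finite_I) auto
  also have "\<dots> = (\<Oplus>\<^bsub>HH\<^esub>i\<in>carrier I. ?Y i)"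
  proof (intro HH.finsum_cong' refl)
    fix i assume i: "i \<in> carrier I"
    have "(\<Oplus>\<^bsub>HH\<^esub>j\<in>carrier I. ?l i \<otimes>\<^bsub>HH\<^esub> ?r j) = (\<Oplus>\<^bsub>HH\<^esub>j\<in>carrier I. if i = j then ?Y j else \<zero>\<^bsub>HH\<^esub>)"
      using i X by (intro HH.finsum_cong') (auto simp: product)
    also have "\<dots> = ?Y i"
      using i X by (intro HH.finsum_singleton finite_I) auto
    finally show "(\<Oplus>\<^bsub>HH\<^esub>j\<in>carrier I. ?l i \<otimes>\<^bsub>HH\<^esub> ?r j) = ?Y i" .
  qed (use X in auto)
  also have "\<dots> = comult (e m \<xi> \<otimes>\<^bsub>H\<^esub> e m' \<tau>)"
  proof (cases "m = m'")
    case True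
    have "comult (e m \<xi> \<otimes>\<^bsub>H\<^esub> e m' \<tau>) = a m \<xi> \<tau> \<odot>\<^bsub>HH\<^esub> comult (e m (\<xi> \<otimes>\<^bsub>G\<^esub> \<tau>))"
      using True m \<xi> linear_maps_smult[OF comult_linear] by (simp add: e_mult)
    also have "\<dots> = (\<Oplus>\<^bsub>HH\<^esub>i\<in>carrier I. a m \<xi> \<tau> \<odot>\<^bsub>HH\<^esub> (c (\<xi> \<otimes>\<^bsub>G\<^esub> \<tau>) i (inv\<^bsub>I\<^esub> i \<otimes>\<^bsub>I\<^esub> m) \<odot>\<^bsub>HH\<^esub>
        (e i (\<xi> \<otimes>\<^bsub>G\<^esub> \<tau>) \<otimes>\<^sub>t e (inv\<^bsub>I\<^esub> i \<otimes>\<^bsub>I\<^esub> m) (\<xi> \<otimes>\<^bsub>G\<^esub> \<tau>))))"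
      unfolding comult_e[OF m(1) G.m_closed[OF \<xi>]] using m \<xi>
      by (intro HH.finsum_smult_ldistr finite_I) auto
    also have "\<dots> = (\<Oplus>\<^bsub>HH\<^esub>i\<in>carrier I. ?Y i)"
      using True m \<xi> by (intro HH.finsum_cong') (auto simp: HH.smult_assoc1)
    finally show ?thesis ..
  next
    case False
    then show ?thesis
      using m \<xi> linear_maps_zero[OF H.M.module_axioms HH.module_axioms comult_linear]
      by (simp add: e_mult)
  qed
  finally show ?thesis ..
qed

text \<open>
  This is \<open>compatible\<close> at the identity of \<open>G\<close>, where one of the two factors \<open>c\<close> on its right-hand
  side cancels the one on the left.
\<close>

lemma a_one_one_mult:
  assumes "i \<in> carrier I" "j \<in> carrier I"
  shows "inv (a (i \<otimes>\<^bsub>I\<^esub> j) \<one>\<^bsub>G\<^esub> \<one>\<^bsub>G\<^esub>) \<otimes> c \<one>\<^bsub>G\<^esub> i j = inv (a i \<one>\<^bsub>G\<^esub> \<one>\<^bsub>G\<^esub>) \<otimes> inv (a j \<one>\<^bsub>G\<^esub> \<one>\<^bsub>G\<^esub>)"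
proof -
  let ?x = "a (i \<otimes>\<^bsub>I\<^esub> j) \<one>\<^bsub>G\<^esub> \<one>\<^bsub>G\<^esub>" and ?y = "a i \<one>\<^bsub>G\<^esub> \<one>\<^bsub>G\<^esub>" and ?z = "a j \<one>\<^bsub>G\<^esub> \<one>\<^bsub>G\<^esub>" and ?c = "c \<one>\<^bsub>G\<^esub> i j"
  have u: "?x \<in> Units K" "?y \<in> Units K" "?z \<in> Units K" "?c \<in> Units K"
    using assms by simp_all
  note cl = Units_closed[OF u(1)] Units_closed[OF u(2)] Units_closed[OF u(3)] Units_closed[OF u(4)]
  have "?c \<otimes> ?x = ?c \<otimes> (?c \<otimes> (?y \<otimes> ?z))"
    using compatible[OF assms G.one_closed G.one_closed] cl by (simp add: m_ac)
  then have "?x = ?c \<otimes> (?y \<otimes> ?z)"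
    using u cl by (subst (asm) Units_l_cancel) auto
  have "(?y \<otimes> ?z) \<otimes> (inv ?y \<otimes> inv ?z) = (?y \<otimes> inv ?y) \<otimes> (?z \<otimes> inv ?z)"
    using u cl by (simp add: m_ac)
  then have *: "(?y \<otimes> ?z) \<otimes> (inv ?y \<otimes> inv ?z) = \<one>"
    using u by simp
  have "inv ?x \<otimes> ?c = inv ?x \<otimes> (?c \<otimes> ((?y \<otimes> ?z) \<otimes> (inv ?y \<otimes> inv ?z)))"
    unfolding * using u cl by simp
  also have "\<dots> = (inv ?x \<otimes> (?c \<otimes> (?y \<otimes> ?z))) \<otimes> (inv ?y \<otimes> inv ?z)"
    using u cl by (simp add: m_assoc)
  also have "\<dots> = inv ?y \<otimes> inv ?z"
    using u cl by (simp flip: \<open>?x = ?c \<otimes> (?y \<otimes> ?z)\<close>)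
  finally show ?thesis .
qed

text \<open>
  Both sides are sums of multiples of \<open>e\<^sub>i \<otimes> e\<^sub>j\<close> over all pairs \<open>(i, j)\<close>, once the sum over \<open>m\<close> on the
  left is rewritten with \<open>m = i j\<close>.
\<close>

lemma comult_one: "comult \<one>\<^bsub>H\<^esub> = \<one>\<^bsub>HH\<^esub>"
proof -
  let ?u = "\<lambda>i. inv (a i \<one>\<^bsub>G\<^esub> \<one>\<^bsub>G\<^esub>)"
  note tens = H.T.pure_tensor_bilinear
  have u: "?u i \<in> carrier K" if "i \<in> carrier I" for i
    using that by simp
  have pure_smult: "(r \<odot>\<^bsub>H\<^esub> x) \<otimes>\<^sub>t (q \<odot>\<^bsub>H\<^esub> y) = (r \<otimes> q) \<odot>\<^bsub>HH\<^esub> (x \<otimes>\<^sub>t y)"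
    if "r \<in> carrier K" "q \<in> carrier K" "x \<in> carrier H" "y \<in> carrier H" for r q x y
    using that linear_maps_smult[OF bilinear_maps_left[OF tens]]
      linear_maps_smult[OF bilinear_maps_right[OF tens]]
    by (simp add: m_comm flip: HH.smult_assoc1)
  let ?W = "\<lambda>m i. (?u m \<otimes> c \<one>\<^bsub>G\<^esub> i (inv\<^bsub>I\<^esub> i \<otimes>\<^bsub>I\<^esub> m)) \<odot>\<^bsub>HH\<^esub> (e i \<one>\<^bsub>G\<^esub> \<otimes>\<^sub>t e (inv\<^bsub>I\<^esub> i \<otimes>\<^bsub>I\<^esub> m) \<one>\<^bsub>G\<^esub>)"
  have "comult \<one>\<^bsub>H\<^esub> = (\<Oplus>\<^bsub>HH\<^esub>m\<in>carrier I. comult (?u m \<odot>\<^bsub>H\<^esub> e m \<one>\<^bsub>G\<^esub>))"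
    unfolding one_eq
    by (rule linear_maps_finsum[OF H.M.module_axioms HH.module_axioms comult_linear finite_I])
      (auto simp: u)
  also have "\<dots> = (\<Oplus>\<^bsub>HH\<^esub>m\<in>carrier I. \<Oplus>\<^bsub>HH\<^esub>i\<in>carrier I. ?W m i)"
  proof (intro HH.finsum_cong' refl)
    fix m assume m: "m \<in> carrier I"
    have "comult (?u m \<odot>\<^bsub>H\<^esub> e m \<one>\<^bsub>G\<^esub>) = ?u m \<odot>\<^bsub>HH\<^esub> comult (e m \<one>\<^bsub>G\<^esub>)"
      using m u by (simp add: linear_maps_smult[OF comult_linear])
    also have "\<dots> = (\<Oplus>\<^bsub>HH\<^esub>i\<in>carrier I. ?u m \<odot>\<^bsub>HH\<^esub> (c \<one>\<^bsub>G\<^esub> i (inv\<^bsub>I\<^esub> i \<otimes>\<^bsub>I\<^esub> m) \<odot>\<^bsub>HH\<^esub>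
        (e i \<one>\<^bsub>G\<^esub> \<otimes>\<^sub>t e (inv\<^bsub>I\<^esub> i \<otimes>\<^bsub>I\<^esub> m) \<one>\<^bsub>G\<^esub>)))"
      unfolding comult_e[OF m G.one_closed] using m u
      by (intro HH.finsum_smult_ldistr finite_I) auto
    also have "\<dots> = (\<Oplus>\<^bsub>HH\<^esub>i\<in>carrier I. ?W m i)"
      using m u by (intro HH.finsum_cong') (auto simp: HH.smult_assoc1)
    finally show "comult (?u m \<odot>\<^bsub>H\<^esub> e m \<one>\<^bsub>G\<^esub>) = (\<Oplus>\<^bsub>HH\<^esub>i\<in>carrier I. ?W m i)" .
  qed (auto intro!: HH.finsum_closed HH.smult_closed m_closed u)
  also have "\<dots> = (\<Oplus>\<^bsub>HH\<^esub>i\<in>carrier I. \<Oplus>\<^bsub>HH\<^esub>m\<in>carrier I. ?W m i)"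
    by (intro HH.finsum_swap finite_I) (auto simp: u)
  also have "\<dots> = (\<Oplus>\<^bsub>HH\<^esub>i\<in>carrier I. \<Oplus>\<^bsub>HH\<^esub>j\<in>carrier I. (?u i \<odot>\<^bsub>H\<^esub> e i \<one>\<^bsub>G\<^esub>) \<otimes>\<^sub>t (?u j \<odot>\<^bsub>H\<^esub> e j \<one>\<^bsub>G\<^esub>))"
  proof (rule HH.finsum_cong'[OF refl])
    fix i assume i: "i \<in> carrier I"
    have "(\<Oplus>\<^bsub>HH\<^esub>m\<in>carrier I. ?W m i) = (\<Oplus>\<^bsub>HH\<^esub>j\<in>carrier I. ?W (i \<otimes>\<^bsub>I\<^esub> j) i)"
      by (rule I.finsum_translate[OF HH.abelian_monoid_axioms i]) (auto simp: u i)
    also have "\<dots> = (\<Oplus>\<^bsub>HH\<^esub>j\<in>carrier I. (?u i \<odot>\<^bsub>H\<^esub> e i \<one>\<^bsub>G\<^esub>) \<otimes>\<^sub>t (?u j \<odot>\<^bsub>H\<^esub> e j \<one>\<^bsub>G\<^esub>))"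
    proof (intro HH.finsum_cong' refl)
      fix j assume j: "j \<in> carrier I"
      have "inv\<^bsub>I\<^esub> i \<otimes>\<^bsub>I\<^esub> (i \<otimes>\<^bsub>I\<^esub> j) = j"
        using i j by (simp add: I.m_assoc[symmetric])
      then show "?W (i \<otimes>\<^bsub>I\<^esub> j) i = (?u i \<odot>\<^bsub>H\<^esub> e i \<one>\<^bsub>G\<^esub>) \<otimes>\<^sub>t (?u j \<odot>\<^bsub>H\<^esub> e j \<one>\<^bsub>G\<^esub>)"
        using i j u by (simp add: a_one_one_mult pure_smult)
    qed (use i u in auto)
    finally show "(\<Oplus>\<^bsub>HH\<^esub>m\<in>carrier I. ?W m i) =
      (\<Oplus>\<^bsub>HH\<^esub>j\<in>carrier I. (?u i \<odot>\<^bsub>H\<^esub> e i \<one>\<^bsub>G\<^esub>) \<otimes>\<^sub>t (?u j \<odot>\<^bsub>H\<^esub> e j \<one>\<^bsub>G\<^esub>))" .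
  qed (auto intro!: HH.finsum_closed H.T.pure_tensor_closed H.M.smult_closed u)
  also have "\<dots> = \<one>\<^bsub>H\<^esub> \<otimes>\<^sub>t \<one>\<^bsub>H\<^esub>"
    unfolding one_eq
    by (rule linear_maps_finsum_bilinear[OF H.M.module_axioms H.M.module_axioms HH.module_axioms tens
          finite_I finite_I, symmetric]) (auto simp: u)
  finally show ?thesis
    by (simp add: tensor_algebra_simps)
qed

lemma comult_hom: "comult \<in> algebra_homs K H HH"
proof -
  interpret A: algebra_pair K H H by (rule algebra_pair_H)
  show ?thesis
    by (rule H.algebra_homs_unit_vectorI[OF HH.module_axioms comult_linear mult_bilinear
          A.tensor_mult_bilinear _ comult_one]) (auto elim!: B_cases simp: comult_mult_e)
qed

lemma counit_hom: "counit \<in> algebra_homs K H (ground_algebra K)"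
proof (rule H.algebra_homs_unit_vectorI[OF module_ground counit_linear mult_bilinear])
  show "(\<otimes>\<^bsub>ground_algebra K\<^esub>) \<in> bilinear_maps K (ground_algebra K) (ground_algebra K) (ground_algebra K)"
    unfolding bilinear_maps_def mem_Collect_eq
    by (intro conjI ballI linear_mapsI) (auto simp: ground_algebra_simps l_distr r_distr m_ac)
  have smult: "counit (r \<odot>\<^bsub>H\<^esub> x) = r \<otimes> counit x" if "r \<in> carrier K" "x \<in> carrier H" for r x
    using linear_maps_smult[OF counit_linear that] by (simp add: ground_algebra_simps)
  have zero: "counit \<zero>\<^bsub>H\<^esub> = \<zero>"
    using linear_maps_zero[OF H.M.module_axioms module_ground counit_linear]
    by (simp add: ground_algebra_simps)
  show "counit (H.unit_vector p \<otimes>\<^bsub>H\<^esub> H.unit_vector q) =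
      counit (H.unit_vector p) \<otimes>\<^bsub>ground_algebra K\<^esub> counit (H.unit_vector q)"
    if "p \<in> B" "q \<in> B" for p q
    using that by (auto elim!: B_cases simp: e_mult counit_e smult zero a_one ground_algebra_simps)
  have "counit \<one>\<^bsub>H\<^esub> = (\<Oplus>i\<in>carrier I. counit (inv (a i \<one>\<^bsub>G\<^esub> \<one>\<^bsub>G\<^esub>) \<odot>\<^bsub>H\<^esub> e i \<one>\<^bsub>G\<^esub>))"
    unfolding one_eq
    using linear_maps_finsum[OF H.M.module_axioms module_ground counit_linear finite_I,
        of "\<lambda>i. inv (a i \<one>\<^bsub>G\<^esub> \<one>\<^bsub>G\<^esub>) \<odot>\<^bsub>H\<^esub> e i \<one>\<^bsub>G\<^esub>"]
    by (simp add: finsum_ground_algebra Pi_def)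
  also have "\<dots> = (\<Oplus>i\<in>carrier I. if \<one>\<^bsub>I\<^esub> = i then \<one> else \<zero>)"
    by (intro finsum_cong') (auto simp: smult counit_e a_one)
  also have "\<dots> = \<one>"
    by (intro finsum_singleton finite_I) auto
  finally show "counit \<one>\<^bsub>H\<^esub> = \<one>\<^bsub>ground_algebra K\<^esub>"
    by (simp add: ground_algebra_simps)
qed

text \<open>
  On a basis element, both sides are double sums of tensors \<open>e\<^sub>j \<otimes> (e\<^sub>k \<otimes> e\<^sub>n)\<close> with \<open>j k n = m\<close>. The
  coefficients agree by the cocycle identity for \<open>c \<xi>\<close>, once the summation on the left
  is exchanged and its variable \<open>i\<close> is replaced by \<open>j k\<close>.
\<close>

lemma coassoc:
  assumes "h \<in> carrier H"
  shows "tensor_lift K H H (tensor_algebra K H HH)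
      (\<lambda>a b. tensor_lift K H H (tensor_algebra K H HH)
        (\<lambda>x y. pure_tensor K H HH x (y \<otimes>\<^sub>t b)) (comult a)) (comult h)
    = tensor_lift K H H (tensor_algebra K H HH) (\<lambda>a b. pure_tensor K H HH a (comult b)) (comult h)"
proof -
  interpret P: module_pair K H HH ..
  let ?Z = "tensor_algebra K H HH"
  interpret Z: module K ?Z by (rule P.module_tensor)
  let ?t = "pure_tensor K H HH"
  note tens = H.T.pure_tensor_bilinear and tens3 = P.pure_tensor_bilinear
  let ?\<beta> = "\<lambda>b x y. ?t x (y \<otimes>\<^sub>t b)"
  let ?L = "\<lambda>b. tensor_lift K H H ?Z (?\<beta> b)"
  have \<beta>: "?\<beta> b \<in> bilinear_maps K H H ?Z" if "b \<in> carrier H" for b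
    by (rule bilinear_maps_comp[OF tens3 linear_maps_id bilinear_maps_left[OF tens that] linear_maps_id])
  have "(\<lambda>b. ?\<beta> b x y) \<in> linear_maps K H ?Z" if "x \<in> carrier H" "y \<in> carrier H" for x y
    by (rule linear_maps_comp[OF bilinear_maps_right[OF tens that(2)] bilinear_maps_right[OF tens3 that(1)]])
  then have L_param: "(\<lambda>b. ?L b t) \<in> linear_maps K H ?Z" if "t \<in> carrier HH" for t
    using that by (intro H.tensor_lift_parameter Z.module_axioms H.M.module_axioms \<beta>)
  have L: "?L b \<in> linear_maps K HH ?Z" if "b \<in> carrier H" for b
    by (rule H.tensor_lift_linear[OF Z.module_axioms \<beta>[OF that]])
  let ?l = "\<lambda>a b. ?L b (comult a)" and ?r = "\<lambda>a b. ?t a (comult b)"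
  have l: "?l \<in> bilinear_maps K H H ?Z"
    unfolding bilinear_maps_def mem_Collect_eq
    using L_param[OF linear_maps_closed[OF comult_linear]] linear_maps_comp[OF comult_linear L] by simp
  have r: "?r \<in> bilinear_maps K H H ?Z"
    by (rule bilinear_maps_comp[OF tens3 linear_maps_id comult_linear linear_maps_id])
  have "tensor_lift K H H ?Z ?l (comult h) = tensor_lift K H H ?Z ?r (comult h)"
  proof (rule H_basis_eqI[OF Z.module_axioms
        linear_maps_comp[OF comult_linear H.tensor_lift_linear[OF Z.module_axioms l]]
        linear_maps_comp[OF comult_linear H.tensor_lift_linear[OF Z.module_axioms r]] _ assms])
    fix m \<xi> assume m: "m \<in> carrier I" and \<xi>: "\<xi> \<in> carrier G"
    let ?Q = "\<lambda>x y z. ?t (e x \<xi>) (e y \<xi> \<otimes>\<^sub>t e z \<xi>)"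
    let ?W = "\<lambda>i j. (c \<xi> i (inv\<^bsub>I\<^esub> i \<otimes>\<^bsub>I\<^esub> m) \<otimes> c \<xi> j (inv\<^bsub>I\<^esub> j \<otimes>\<^bsub>I\<^esub> i)) \<odot>\<^bsub>?Z\<^esub>
      ?Q j (inv\<^bsub>I\<^esub> j \<otimes>\<^bsub>I\<^esub> i) (inv\<^bsub>I\<^esub> i \<otimes>\<^bsub>I\<^esub> m)"
    let ?V = "\<lambda>j k. (c \<xi> j (inv\<^bsub>I\<^esub> j \<otimes>\<^bsub>I\<^esub> m) \<otimes> c \<xi> k (inv\<^bsub>I\<^esub> k \<otimes>\<^bsub>I\<^esub> (inv\<^bsub>I\<^esub> j \<otimes>\<^bsub>I\<^esub> m))) \<odot>\<^bsub>?Z\<^esub>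
      ?Q j k (inv\<^bsub>I\<^esub> k \<otimes>\<^bsub>I\<^esub> (inv\<^bsub>I\<^esub> j \<otimes>\<^bsub>I\<^esub> m))"
    have W: "?W i j \<in> carrier ?Z" if "i \<in> carrier I" "j \<in> carrier I" for i j
      using that m \<xi> by auto
    have V: "?V i j \<in> carrier ?Z" if "i \<in> carrier I" "j \<in> carrier I" for i j
      using that m \<xi> by auto
    have "tensor_lift K H H ?Z ?l (comult (e m \<xi>)) = (\<Oplus>\<^bsub>?Z\<^esub>i\<in>carrier I. \<Oplus>\<^bsub>?Z\<^esub>j\<in>carrier I. ?W i j)"
      unfolding tensor_lift_comult_e[OF Z.module_axioms l m \<xi>]
    proof (rule Z.finsum_cong'[OF refl])
      fix i assume i: "i \<in> carrier I"
      let ?k = "inv\<^bsub>I\<^esub> i \<otimes>\<^bsub>I\<^esub> m"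
      have k: "?k \<in> carrier I" using i m by simp
      have "c \<xi> i ?k \<odot>\<^bsub>?Z\<^esub> ?L (e ?k \<xi>) (comult (e i \<xi>)) =
          c \<xi> i ?k \<odot>\<^bsub>?Z\<^esub> (\<Oplus>\<^bsub>?Z\<^esub>j\<in>carrier I. c \<xi> j (inv\<^bsub>I\<^esub> j \<otimes>\<^bsub>I\<^esub> i) \<odot>\<^bsub>?Z\<^esub> ?Q j (inv\<^bsub>I\<^esub> j \<otimes>\<^bsub>I\<^esub> i) ?k)"
        using tensor_lift_comult_e[OF Z.module_axioms \<beta> i \<xi>, of "e ?k \<xi>"] by simp
      also have "\<dots> = (\<Oplus>\<^bsub>?Z\<^esub>j\<in>carrier I. c \<xi> i ?k \<odot>\<^bsub>?Z\<^esub> (c \<xi> j (inv\<^bsub>I\<^esub> j \<otimes>\<^bsub>I\<^esub> i) \<odot>\<^bsub>?Z\<^esub> ?Q j (inv\<^bsub>I\<^esub> j \<otimes>\<^bsub>I\<^esub> i) ?k))"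
        using i k \<xi> by (intro Z.finsum_smult_ldistr finite_I) auto
      also have "\<dots> = (\<Oplus>\<^bsub>?Z\<^esub>j\<in>carrier I. ?W i j)"
        using i k \<xi> by (intro Z.finsum_cong') (auto simp: Z.smult_assoc1)
      finally show "c \<xi> i ?k \<odot>\<^bsub>?Z\<^esub> ?L (e ?k \<xi>) (comult (e i \<xi>)) = (\<Oplus>\<^bsub>?Z\<^esub>j\<in>carrier I. ?W i j)" .
    qed (use W in \<open>auto intro!: Z.finsum_closed\<close>)
    also have "\<dots> = (\<Oplus>\<^bsub>?Z\<^esub>j\<in>carrier I. \<Oplus>\<^bsub>?Z\<^esub>i\<in>carrier I. ?W i j)"
      by (rule Z.finsum_swap[OF finite_I finite_I W])
    also have "\<dots> = (\<Oplus>\<^bsub>?Z\<^esub>j\<in>carrier I. \<Oplus>\<^bsub>?Z\<^esub>k\<in>carrier I. ?V j k)"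
    proof (rule Z.finsum_cong'[OF refl])
      fix j assume j: "j \<in> carrier I"
      have "(\<Oplus>\<^bsub>?Z\<^esub>i\<in>carrier I. ?W i j) = (\<Oplus>\<^bsub>?Z\<^esub>k\<in>carrier I. ?W (j \<otimes>\<^bsub>I\<^esub> k) j)"
        by (rule I.finsum_translate[OF Z.abelian_monoid_axioms j]) (use W j in blast)
      also have "\<dots> = (\<Oplus>\<^bsub>?Z\<^esub>k\<in>carrier I. ?V j k)"
      proof (rule Z.finsum_cong'[OF refl])
        fix k assume k: "k \<in> carrier I"
        let ?n = "inv\<^bsub>I\<^esub> k \<otimes>\<^bsub>I\<^esub> (inv\<^bsub>I\<^esub> j \<otimes>\<^bsub>I\<^esub> m)"
        have n: "?n \<in> carrier I" using j k m by simp
        have 1: "inv\<^bsub>I\<^esub> (j \<otimes>\<^bsub>I\<^esub> k) \<otimes>\<^bsub>I\<^esub> m = ?n" "inv\<^bsub>I\<^esub> j \<otimes>\<^bsub>I\<^esub> (j \<otimes>\<^bsub>I\<^esub> k) = k" "k \<otimes>\<^bsub>I\<^esub> ?n = inv\<^bsub>I\<^esub> j \<otimes>\<^bsub>I\<^esub> m"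
          using j k m by (simp_all add: I.inv_mult_group flip: I.m_assoc)
        have "c \<xi> j k \<otimes> c \<xi> (j \<otimes>\<^bsub>I\<^esub> k) ?n = c \<xi> k ?n \<otimes> c \<xi> j (inv\<^bsub>I\<^esub> j \<otimes>\<^bsub>I\<^esub> m)"
          using two_cocycles_eq[OF c[OF \<xi>] j k n] unfolding 1 .
        then have "c \<xi> (j \<otimes>\<^bsub>I\<^esub> k) ?n \<otimes> c \<xi> j k = c \<xi> j (inv\<^bsub>I\<^esub> j \<otimes>\<^bsub>I\<^esub> m) \<otimes> c \<xi> k ?n"
          using j k n m \<xi> by (simp add: m_comm)
        then show "?W (j \<otimes>\<^bsub>I\<^esub> k) j = ?V j k"
          unfolding 1 by simp
      qed (use V j in blast)
      finally show "(\<Oplus>\<^bsub>?Z\<^esub>i\<in>carrier I. ?W i j) = (\<Oplus>\<^bsub>?Z\<^esub>k\<in>carrier I. ?V j k)" .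
    qed (use V in \<open>auto intro!: Z.finsum_closed\<close>)
    also have "\<dots> = tensor_lift K H H ?Z ?r (comult (e m \<xi>))"
      unfolding tensor_lift_comult_e[OF Z.module_axioms r m \<xi>]
    proof (rule Z.finsum_cong'[OF refl])
      fix j assume j: "j \<in> carrier I"
      let ?k = "inv\<^bsub>I\<^esub> j \<otimes>\<^bsub>I\<^esub> m"
      have k: "?k \<in> carrier I" using j m by simp
      have "c \<xi> j ?k \<odot>\<^bsub>?Z\<^esub> ?t (e j \<xi>) (comult (e ?k \<xi>)) =
          c \<xi> j ?k \<odot>\<^bsub>?Z\<^esub> (\<Oplus>\<^bsub>?Z\<^esub>i\<in>carrier I. c \<xi> i (inv\<^bsub>I\<^esub> i \<otimes>\<^bsub>I\<^esub> ?k) \<odot>\<^bsub>?Z\<^esub> ?Q j i (inv\<^bsub>I\<^esub> i \<otimes>\<^bsub>I\<^esub> ?k))"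
        using linear_maps_comult_e[OF Z.module_axioms bilinear_maps_right[OF tens3] k \<xi>, of "e j \<xi>"]
        by simp
      also have "\<dots> = (\<Oplus>\<^bsub>?Z\<^esub>i\<in>carrier I. c \<xi> j ?k \<odot>\<^bsub>?Z\<^esub> (c \<xi> i (inv\<^bsub>I\<^esub> i \<otimes>\<^bsub>I\<^esub> ?k) \<odot>\<^bsub>?Z\<^esub> ?Q j i (inv\<^bsub>I\<^esub> i \<otimes>\<^bsub>I\<^esub> ?k)))"
        using j k \<xi> by (intro Z.finsum_smult_ldistr finite_I) auto
      also have "\<dots> = (\<Oplus>\<^bsub>?Z\<^esub>i\<in>carrier I. ?V j i)"
        using j k \<xi> by (intro Z.finsum_cong') (auto simp: Z.smult_assoc1)
      finally show "(\<Oplus>\<^bsub>?Z\<^esub>i\<in>carrier I. ?V j i) = c \<xi> j ?k \<odot>\<^bsub>?Z\<^esub> ?t (e j \<xi>) (comult (e ?k \<xi>))" ..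
    qed (use m \<xi> linear_maps_closed[OF comult_linear] in auto)
    finally show "tensor_lift K H H ?Z ?l (comult (e m \<xi>)) = tensor_lift K H H ?Z ?r (comult (e m \<xi>))" .
  qed
  then show ?thesis .
qed

lemma counit_left:
  assumes "h \<in> carrier H"
  shows "tensor_lift K H H H (\<lambda>x y. counit x \<odot>\<^bsub>H\<^esub> y) (comult h) = h"
proof -
  have bil: "(\<lambda>x y. counit x \<odot>\<^bsub>H\<^esub> y) \<in> bilinear_maps K H H H"
    unfolding bilinear_maps_def mem_Collect_eq
    using linear_maps_closed[OF counit_linear] linear_maps_add[OF counit_linear]
      linear_maps_smult[OF counit_linear]
    by (intro conjI ballI linear_mapsI)
      (auto simp: ground_algebra_simps H.M.smult_l_distr H.M.smult_r_distr m_comm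
        simp flip: H.M.smult_assoc1)
  note lin = H.tensor_lift_linear[OF H.M.module_axioms bil]
  show ?thesis
  proof (rule H_basis_eqI[OF H.M.module_axioms linear_maps_comp[OF comult_linear lin]
        linear_maps_id _ assms])
    fix m \<xi> assume m: "m \<in> carrier I" and \<xi>: "\<xi> \<in> carrier G"
    have "tensor_lift K H H H (\<lambda>x y. counit x \<odot>\<^bsub>H\<^esub> y) (comult (e m \<xi>)) =
        (\<Oplus>\<^bsub>H\<^esub>i\<in>carrier I. if \<one>\<^bsub>I\<^esub> = i then e m \<xi> else \<zero>\<^bsub>H\<^esub>)"
      unfolding tensor_lift_comult_e[OF H.M.module_axioms bil m \<xi>] using m \<xi>
      by (intro H.M.finsum_cong') (auto simp: counit_e c_one_left)
    also have "\<dots> = e m \<xi>"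
      by (intro H.M.finsum_singleton finite_I) auto
    finally show "tensor_lift K H H H (\<lambda>x y. counit x \<odot>\<^bsub>H\<^esub> y) (comult (e m \<xi>)) = e m \<xi>" .
  qed
qed

lemma counit_right:
  assumes "h \<in> carrier H"
  shows "tensor_lift K H H H (\<lambda>x y. counit y \<odot>\<^bsub>H\<^esub> x) (comult h) = h"
proof -
  have bil: "(\<lambda>x y. counit y \<odot>\<^bsub>H\<^esub> x) \<in> bilinear_maps K H H H"
    unfolding bilinear_maps_def mem_Collect_eq
    using linear_maps_closed[OF counit_linear] linear_maps_add[OF counit_linear]
      linear_maps_smult[OF counit_linear]
    by (intro conjI ballI linear_mapsI)
      (auto simp: ground_algebra_simps H.M.smult_l_distr H.M.smult_r_distr m_comm
        simp flip: H.M.smult_assoc1)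
  note lin = H.tensor_lift_linear[OF H.M.module_axioms bil]
  show ?thesis
  proof (rule H_basis_eqI[OF H.M.module_axioms linear_maps_comp[OF comult_linear lin]
        linear_maps_id _ assms])
    fix m \<xi> assume m: "m \<in> carrier I" and \<xi>: "\<xi> \<in> carrier G"
    have "inv\<^bsub>I\<^esub> i \<otimes>\<^bsub>I\<^esub> m = \<one>\<^bsub>I\<^esub> \<longleftrightarrow> m = i" if "i \<in> carrier I" for i
      using that m by (metis I.inv_solve_left I.one_closed I.r_one)
    then have "tensor_lift K H H H (\<lambda>x y. counit y \<odot>\<^bsub>H\<^esub> x) (comult (e m \<xi>)) =
        (\<Oplus>\<^bsub>H\<^esub>i\<in>carrier I. if m = i then e m \<xi> else \<zero>\<^bsub>H\<^esub>)"
      unfolding tensor_lift_comult_e[OF H.M.module_axioms bil m \<xi>] using m \<xi>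
      by (intro H.M.finsum_cong') (auto simp: counit_e c_one_right)
    also have "\<dots> = e m \<xi>"
      using m by (intro H.M.finsum_singleton finite_I) auto
    finally show "tensor_lift K H H H (\<lambda>x y. counit y \<odot>\<^bsub>H\<^esub> x) (comult (e m \<xi>)) = e m \<xi>" .
  qed
qed

lemma antipode_cancel:
  assumes i: "i \<in> carrier I" and \<xi>: "\<xi> \<in> carrier G"
  shows "c \<xi> i (inv\<^bsub>I\<^esub> i) \<otimes> inv (c \<xi> i (inv\<^bsub>I\<^esub> i) \<otimes> a (inv\<^bsub>I\<^esub> i) (inv\<^bsub>G\<^esub> \<xi>) \<xi> \<otimes> a (inv\<^bsub>I\<^esub> i) \<one>\<^bsub>G\<^esub> \<one>\<^bsub>G\<^esub>)
    \<otimes> a (inv\<^bsub>I\<^esub> i) (inv\<^bsub>G\<^esub> \<xi>) \<xi> = inv (a (inv\<^bsub>I\<^esub> i) \<one>\<^bsub>G\<^esub> \<one>\<^bsub>G\<^esub>)"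
proof -
  let ?x = "c \<xi> i (inv\<^bsub>I\<^esub> i)" and ?y = "a (inv\<^bsub>I\<^esub> i) (inv\<^bsub>G\<^esub> \<xi>) \<xi>" and ?z = "a (inv\<^bsub>I\<^esub> i) \<one>\<^bsub>G\<^esub> \<one>\<^bsub>G\<^esub>"
  have u: "?x \<in> Units K" "?y \<in> Units K" "?z \<in> Units K" "?x \<otimes> ?y \<otimes> ?z \<in> Units K"
    using assms by simp_all
  note cl = Units_closed[OF u(1)] Units_closed[OF u(2)] Units_closed[OF u(3)] Units_inv_closed[OF u(3)]
    Units_inv_closed[OF u(4)] Units_closed[OF u(4)]
  have "?x \<otimes> inv (?x \<otimes> ?y \<otimes> ?z) \<otimes> ?y = ?x \<otimes> (inv (?x \<otimes> ?y \<otimes> ?z) \<otimes> ?y) \<otimes> (?z \<otimes> inv ?z)"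
    using u cl by (simp add: m_assoc)
  also have "\<dots> = (inv (?x \<otimes> ?y \<otimes> ?z) \<otimes> (?x \<otimes> ?y \<otimes> ?z)) \<otimes> inv ?z"
    using cl by (simp add: m_ac)
  also have "\<dots> = inv ?z"
    using u(4) cl by simp
  finally show ?thesis .
qed

lemma one_eq_inverse:
  "\<one>\<^bsub>H\<^esub> = (\<Oplus>\<^bsub>H\<^esub>i\<in>carrier I. inv (a (inv\<^bsub>I\<^esub> i) \<one>\<^bsub>G\<^esub> \<one>\<^bsub>G\<^esub>) \<odot>\<^bsub>H\<^esub> e (inv\<^bsub>I\<^esub> i) \<one>\<^bsub>G\<^esub>)"
  unfolding one_eq by (rule I.finsum_inverse[OF H.M.abelian_monoid_axioms]) auto

lemma inverse_mult_eq_iff: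
  assumes "i \<in> carrier I" "m \<in> carrier I"
  shows "inv\<^bsub>I\<^esub> i = inv\<^bsub>I\<^esub> i \<otimes>\<^bsub>I\<^esub> m \<longleftrightarrow> m = \<one>\<^bsub>I\<^esub>"
  using assms by (metis I.inv_closed I.l_cancel_one')

text \<open>
  The antipode moves the component \<open>i\<close> to \<open>i\<inverse>\<close>, where it meets \<open>i\<inverse> m\<close>, so the product vanishes
  unless \<open>m\<close> is the identity. In that case the terms add up to the expansion of the unit
  element.
\<close>

lemma antipode_left:
  assumes "h \<in> carrier H"
  shows "tensor_lift K H H H (\<lambda>x y. antipode x \<otimes>\<^bsub>H\<^esub> y) (comult h) = counit h \<odot>\<^bsub>H\<^esub> \<one>\<^bsub>H\<^esub>"
proof -
  have bil: "(\<lambda>x y. antipode x \<otimes>\<^bsub>H\<^esub> y) \<in> bilinear_maps K H H H"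
    by (rule bilinear_maps_comp[OF mult_bilinear antipode_linear linear_maps_id linear_maps_id])
  note lin = H.tensor_lift_linear[OF H.M.module_axioms bil]
  show ?thesis
  proof (rule H_basis_eqI[OF H.M.module_axioms linear_maps_comp[OF comult_linear lin]
        linear_maps_smult_const[OF H.M.module_axioms counit_linear one_closed] _ assms])
    fix m \<xi> assume m: "m \<in> carrier I" and \<xi>: "\<xi> \<in> carrier G"
    have smult: "(r \<odot>\<^bsub>H\<^esub> x) \<otimes>\<^bsub>H\<^esub> y = r \<odot>\<^bsub>H\<^esub> (x \<otimes>\<^bsub>H\<^esub> y)"
      if "r \<in> carrier K" "x \<in> carrier H" "y \<in> carrier H" for r x y
      using linear_maps_smult[OF bilinear_maps_left[OF mult_bilinear that(3)] that(1,2)] .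
    have Units: "c \<xi> i (inv\<^bsub>I\<^esub> i) \<otimes> a (inv\<^bsub>I\<^esub> i) (inv\<^bsub>G\<^esub> \<xi>) \<xi> \<otimes> a (inv\<^bsub>I\<^esub> i) \<one>\<^bsub>G\<^esub> \<one>\<^bsub>G\<^esub> \<in> Units K"
      if "i \<in> carrier I" for i using that \<xi> by simp
    have "tensor_lift K H H H (\<lambda>x y. antipode x \<otimes>\<^bsub>H\<^esub> y) (comult (e m \<xi>)) =
        (\<Oplus>\<^bsub>H\<^esub>i\<in>carrier I. if m = \<one>\<^bsub>I\<^esub> then inv (a (inv\<^bsub>I\<^esub> i) \<one>\<^bsub>G\<^esub> \<one>\<^bsub>G\<^esub>) \<odot>\<^bsub>H\<^esub> e (inv\<^bsub>I\<^esub> i) \<one>\<^bsub>G\<^esub> else \<zero>\<^bsub>H\<^esub>)"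
      unfolding tensor_lift_comult_e[OF H.M.module_axioms bil m \<xi>]
    proof (rule H.M.finsum_cong'[OF refl])
      fix i assume i: "i \<in> carrier I"
      note Units_inv_closed[OF Units[OF i]]
      then show "c \<xi> i (inv\<^bsub>I\<^esub> i \<otimes>\<^bsub>I\<^esub> m) \<odot>\<^bsub>H\<^esub> (antipode (e i \<xi>) \<otimes>\<^bsub>H\<^esub> e (inv\<^bsub>I\<^esub> i \<otimes>\<^bsub>I\<^esub> m) \<xi>) =
          (if m = \<one>\<^bsub>I\<^esub> then inv (a (inv\<^bsub>I\<^esub> i) \<one>\<^bsub>G\<^esub> \<one>\<^bsub>G\<^esub>) \<odot>\<^bsub>H\<^esub> e (inv\<^bsub>I\<^esub> i) \<one>\<^bsub>G\<^esub> else \<zero>\<^bsub>H\<^esub>)"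
        using i m \<xi> antipode_cancel[OF i \<xi>]
        by (auto simp: antipode_e smult e_mult inverse_mult_eq_iff simp flip: H.M.smult_assoc1)
    qed auto
    also have "\<dots> = counit (e m \<xi>) \<odot>\<^bsub>H\<^esub> \<one>\<^bsub>H\<^esub>"
      using m \<xi> one_closed by (simp add: counit_e one_eq_inverse[symmetric])
    finally show "tensor_lift K H H H (\<lambda>x y. antipode x \<otimes>\<^bsub>H\<^esub> y) (comult (e m \<xi>)) =
      counit (e m \<xi>) \<odot>\<^bsub>H\<^esub> \<one>\<^bsub>H\<^esub>" .
  qed
qed

text \<open>
  The scalar in the antipode fits the left law. It fits the right law as well because cocycles take the
  same value at \<open>(s, s\<inverse>)\<close> and \<open>(s\<inverse>, s)\<close> (\<open>two_cocycles_inverse\<close>).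
\<close>

lemma antipode_right:
  assumes "h \<in> carrier H"
  shows "tensor_lift K H H H (\<lambda>x y. x \<otimes>\<^bsub>H\<^esub> antipode y) (comult h) = counit h \<odot>\<^bsub>H\<^esub> \<one>\<^bsub>H\<^esub>"
proof -
  have bil: "(\<lambda>x y. x \<otimes>\<^bsub>H\<^esub> antipode y) \<in> bilinear_maps K H H H"
    by (rule bilinear_maps_comp[OF mult_bilinear linear_maps_id antipode_linear linear_maps_id])
  note lin = H.tensor_lift_linear[OF H.M.module_axioms bil]
  show ?thesis
  proof (rule H_basis_eqI[OF H.M.module_axioms linear_maps_comp[OF comult_linear lin]
        linear_maps_smult_const[OF H.M.module_axioms counit_linear one_closed] _ assms])
    fix m \<xi> assume m: "m \<in> carrier I" and \<xi>: "\<xi> \<in> carrier G"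
    have smult: "x \<otimes>\<^bsub>H\<^esub> (r \<odot>\<^bsub>H\<^esub> y) = r \<odot>\<^bsub>H\<^esub> (x \<otimes>\<^bsub>H\<^esub> y)"
      if "r \<in> carrier K" "x \<in> carrier H" "y \<in> carrier H" for r x y
      using linear_maps_smult[OF bilinear_maps_right[OF mult_bilinear that(2)] that(1,3)] .
    have Units: "c \<xi> i (inv\<^bsub>I\<^esub> i) \<otimes> a (inv\<^bsub>I\<^esub> i) (inv\<^bsub>G\<^esub> \<xi>) \<xi> \<otimes> a (inv\<^bsub>I\<^esub> i) \<one>\<^bsub>G\<^esub> \<one>\<^bsub>G\<^esub> \<in> Units K"
      if "i \<in> carrier I" for i using that \<xi> by simp
    have "tensor_lift K H H H (\<lambda>x y. x \<otimes>\<^bsub>H\<^esub> antipode y) (comult (e m \<xi>)) =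
        (\<Oplus>\<^bsub>H\<^esub>i\<in>carrier I. if m = \<one>\<^bsub>I\<^esub> then inv (a i \<one>\<^bsub>G\<^esub> \<one>\<^bsub>G\<^esub>) \<odot>\<^bsub>H\<^esub> e i \<one>\<^bsub>G\<^esub> else \<zero>\<^bsub>H\<^esub>)"
      unfolding tensor_lift_comult_e[OF H.M.module_axioms bil m \<xi>]
    proof (rule H.M.finsum_cong'[OF refl])
      fix i assume i: "i \<in> carrier I"
      let ?k = "inv\<^bsub>I\<^esub> i \<otimes>\<^bsub>I\<^esub> m"
      have k: "?k \<in> carrier I" using i m by simp
      have inv_k: "inv\<^bsub>I\<^esub> ?k = i \<longleftrightarrow> m = \<one>\<^bsub>I\<^esub>" "i = inv\<^bsub>I\<^esub> ?k \<longleftrightarrow> m = \<one>\<^bsub>I\<^esub>"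
        using i m inverse_mult_eq_iff by (metis I.inv_inv k)+
      have "c \<xi> i (inv\<^bsub>I\<^esub> i) = c \<xi> (inv\<^bsub>I\<^esub> i) i" "a i \<xi> (inv\<^bsub>G\<^esub> \<xi>) = a i (inv\<^bsub>G\<^esub> \<xi>) \<xi>"
        using two_cocycles_inverse[OF I.is_group c[OF \<xi>] i]
          two_cocycles_inverse[OF G.is_group a[OF i] \<xi>] .
      then show "c \<xi> i ?k \<odot>\<^bsub>H\<^esub> (e i \<xi> \<otimes>\<^bsub>H\<^esub> antipode (e ?k \<xi>)) =
          (if m = \<one>\<^bsub>I\<^esub> then inv (a i \<one>\<^bsub>G\<^esub> \<one>\<^bsub>G\<^esub>) \<odot>\<^bsub>H\<^esub> e i \<one>\<^bsub>G\<^esub> else \<zero>\<^bsub>H\<^esub>)"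
        using i m k \<xi> antipode_cancel[OF I.inv_closed[OF i] \<xi>] Units_inv_closed[OF Units[OF k]]
        by (auto simp: antipode_e smult e_mult inv_k simp flip: H.M.smult_assoc1)
    qed auto
    also have "\<dots> = counit (e m \<xi>) \<odot>\<^bsub>H\<^esub> \<one>\<^bsub>H\<^esub>"
      using m \<xi> one_closed by (simp add: counit_e one_eq[symmetric])
    finally show "tensor_lift K H H H (\<lambda>x y. x \<otimes>\<^bsub>H\<^esub> antipode y) (comult (e m \<xi>)) =
      counit (e m \<xi>) \<odot>\<^bsub>H\<^esub> \<one>\<^bsub>H\<^esub>" .
  qed
qed

theorem hopf_algebra_H: "hopf_algebra K H comult counit antipode"
  by (intro hopf_algebra.intro assoc_algebra_H hopf_algebra_axioms.intro)
    (simp_all add: comult_hom counit_hom antipode_linear coassoc counit_left counit_right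
      antipode_left antipode_right)

lemma finite_dimensional_H: "finite_dimensional K H"
  by (rule H.finite_dimensional_coordinate_space) simp

text \<open>
  The map is the projection to the component of index \<open>q\<close>.
\<close>

lemma twisted_group_algebra_image:
  assumes q: "q \<in> carrier I"
    and \<alpha>: "\<And>\<xi> \<tau>. \<lbrakk>\<xi> \<in> carrier G; \<tau> \<in> carrier G\<rbrakk> \<Longrightarrow> \<alpha> \<xi> \<tau> = a q \<xi> \<tau>"
  shows "homomorphic_image K (twisted_group_algebra K G \<alpha>) H"
  unfolding homomorphic_image_def
proof (rule bexI)
  let ?A = "twisted_group_algebra K G \<alpha>"
  let ?f = "\<lambda>x. \<lambda>\<rho>\<in>carrier G. x (prod_encode (q, \<rho>))"
  show "?f \<in> algebra_homs K H ?A"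
    unfolding algebra_homs_def
  proof (rule IntI)
    show "?f \<in> ring_hom H ?A"
      using q by (intro ring_hom_memI)
        (auto simp: twisted_group_algebra_def mult_coordinate one_coordinate H.add_eq \<alpha>
          intro!: restrict_ext finsum_cong')
    show "?f \<in> linear_maps K H ?A"
      using q by (intro linear_mapsI)
        (auto simp: twisted_group_algebra_def H.add_eq H.smult_eq intro!: restrict_ext)
  qed
  show "?f ` carrier H = carrier ?A"
  proof (intro equalityI subsetI)
    fix y assume "y \<in> carrier ?A"
    then have y: "y \<in> carrier G \<rightarrow>\<^sub>E carrier K"
      by (simp add: twisted_group_algebra_def)
    let ?x = "\<lambda>p\<in>B. y (snd (prod_decode p))"
    have x: "?x \<in> carrier H"
      using y by (auto simp: H.carrier_eq elim!: B_cases)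
    have "y = ?f ?x"
      using y q by (intro PiE_ext[of y "carrier G" "\<lambda>_. carrier K"]) auto
    then show "y \<in> ?f ` carrier H"
      using x by (rule image_eqI)
  qed (use q in \<open>auto simp: twisted_group_algebra_def\<close>)
qed

end


section \<open>Twisted group algebras as images of Hopf algebras\<close>

definition cyclic_group :: "nat \<Rightarrow> nat monoid"
  where "cyclic_group n = \<lparr>carrier = {..<n}, monoid.mult = (\<lambda>i j. (i + j) mod n), one = 0\<rparr>"

lemma group_cyclic_group:
  assumes "n > 0"
  shows "group (cyclic_group n)"
proof (rule groupI)
  fix i assume i: "i \<in> carrier (cyclic_group n)"
  then have "(n - i) mod n \<in> carrier (cyclic_group n)"
    "(n - i) mod n \<otimes>\<^bsub>cyclic_group n\<^esub> i = \<one>\<^bsub>cyclic_group n\<^esub>"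
    using assms by (auto simp: cyclic_group_def mod_simps)
  then show "\<exists>j\<in>carrier (cyclic_group n). j \<otimes>\<^bsub>cyclic_group n\<^esub> i = \<one>\<^bsub>cyclic_group n\<^esub>"
    by blast
qed (use assms in \<open>auto simp: cyclic_group_def mod_simps add.assoc\<close>)

text \<open>
  The number of carries in a sum of three residues does not depend on the bracketing. This makes the
  powers of a fixed unit that count carries a two-cocycle on the cyclic group.
\<close>

lemma carry_add: "(i + j) div n + ((i + j) mod n + k) div n = (i + j + k) div n" for n :: nat
proof (cases "n = 0")
  case False
  have "i + j + k = ((i + j) mod n + k) + (i + j) div n * n"
    by simp
  then show ?thesis
    using False by (metis add.commute div_mult_self1)
qed simp

text \<open>
  When \<open>i + j\<close> reaches \<open>n\<close>, the exponent of \<open>\<alpha>\<close> drops by \<open>n\<close>. The coboundary \<open>\<alpha>\<^sup>n\<close> that is lost is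
  made up for by the factors \<open>1 / \<mu>\<close> in the comultiplication.
\<close>

lemma bicrossed_product_cyclic:
  fixes K :: "('k, 'm) ring_scheme" (structure) and G :: "nat monoid"
  assumes K: "field K" and G: "group G" "finite (carrier G)" and \<alpha>: "\<alpha> \<in> two_cocycles K G"
    and n: "n > 0" and \<mu>: "\<And>\<xi>. \<xi> \<in> carrier G \<Longrightarrow> \<mu> \<xi> \<in> Units K"
    and coboundary: "\<And>\<xi> \<tau>. \<lbrakk>\<xi> \<in> carrier G; \<tau> \<in> carrier G\<rbrakk> \<Longrightarrow>
      \<alpha> \<xi> \<tau> [^] n \<otimes> \<mu> (\<xi> \<otimes>\<^bsub>G\<^esub> \<tau>) = \<mu> \<xi> \<otimes> \<mu> \<tau>"
  shows "bicrossed_product K (cyclic_group n) G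
    (\<lambda>i \<xi> \<tau>. \<alpha> \<xi> \<tau> [^] i) (\<lambda>\<xi> i j. inv (\<mu> \<xi>) [^] ((i + j) div n))"
proof -
  interpret field K by (rule K)
  interpret G: group G by (rule G)
  note cl = two_cocycles_closed[OF \<alpha>] and Units = two_cocycles_Units[OF \<alpha>]
  show ?thesis
  proof (intro bicrossed_product.intro bicrossed_product_axioms.intro K G group_cyclic_group n)
    show "finite (carrier (cyclic_group n))"
      by (simp add: cyclic_group_def)
    show "(\<lambda>\<xi> \<tau>. \<alpha> \<xi> \<tau> [^] i) \<in> two_cocycles K G" for i :: nat
      unfolding two_cocycles_def using Units cl
      by (auto simp: Units_pow_closed two_cocycles_eq[OF \<alpha>] simp flip: nat_pow_distrib)
    show "(\<lambda>i j. inv (\<mu> \<xi>) [^] ((i + j) div n)) \<in> two_cocycles K (cyclic_group n)"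
      if "\<xi> \<in> carrier G" for \<xi>
    proof -
      have "(i + j) div n + ((i + j) mod n + k) div n = (j + k) div n + (i + (j + k) mod n) div n"
        for i j k
        using carry_add[of i j n k] carry_add[of j k n i] by (simp add: ac_simps)
      then show ?thesis
        using \<mu>[OF that] unfolding two_cocycles_def
        by (auto simp: cyclic_group_def Units_pow_closed nat_pow_mult)
    qed
    show "\<alpha> \<xi> \<tau> [^] \<one>\<^bsub>cyclic_group n\<^esub> = \<one>" for \<xi> \<tau>
      by (simp add: cyclic_group_def)
    show "inv (\<mu> \<xi>) [^] ((\<one>\<^bsub>cyclic_group n\<^esub> + \<one>\<^bsub>cyclic_group n\<^esub>) div n) = \<one>" for \<xi>
      by (simp add: cyclic_group_def)
    fix i j \<xi> \<tau>
    assume \<xi>: "\<xi> \<in> carrier G" and \<tau>: "\<tau> \<in> carrier G"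
    let ?x = "\<alpha> \<xi> \<tau>" and ?y = "\<mu> \<xi>" and ?z = "\<mu> \<tau>" and ?w = "\<mu> (\<xi> \<otimes>\<^bsub>G\<^esub> \<tau>)"
    let ?q = "(i + j) div n" and ?r = "(i + j) mod n"
    have u: "?x \<in> Units K" "?y \<in> Units K" "?z \<in> Units K" "?w \<in> Units K"
      using \<xi> \<tau> Units \<mu> by auto
    note c = Units_closed[OF u(1)] Units_closed[OF u(2)] Units_closed[OF u(3)] Units_closed[OF u(4)]
      Units_inv_closed[OF u(2)] Units_inv_closed[OF u(3)] Units_inv_closed[OF u(4)]
    have "inv ?w = (inv ?y \<otimes> ?y) \<otimes> (inv ?z \<otimes> ?z) \<otimes> inv ?w"
      using u c by simp
    also have "\<dots> = (inv ?y \<otimes> inv ?z) \<otimes> (?y \<otimes> ?z) \<otimes> inv ?w"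
      using c by (simp add: m_ac)
    also have "\<dots> = (inv ?y \<otimes> inv ?z) \<otimes> ((?x [^] n \<otimes> ?w) \<otimes> inv ?w)"
      using c coboundary[OF \<xi> \<tau>] by (simp add: m_assoc)
    also have "\<dots> = (inv ?y \<otimes> inv ?z) \<otimes> ?x [^] n"
      using u c by (simp add: m_assoc)
    finally have "inv ?w [^] ?q = (inv ?y [^] ?q \<otimes> inv ?z [^] ?q) \<otimes> ?x [^] (n * ?q)"
      using c by (simp add: nat_pow_distrib nat_pow_pow)
    then have "?x [^] ?r \<otimes> inv ?w [^] ?q =
        (inv ?y [^] ?q \<otimes> inv ?z [^] ?q) \<otimes> (?x [^] ?r \<otimes> ?x [^] (n * ?q))"
      using c by (simp add: m_ac)
    also have "?x [^] ?r \<otimes> ?x [^] (n * ?q) = ?x [^] i \<otimes> ?x [^] j"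
      using c by (simp add: nat_pow_mult)
    finally show "?x [^] (i \<otimes>\<^bsub>cyclic_group n\<^esub> j) \<otimes> inv ?w [^] ?q =
        (inv ?y [^] ?q \<otimes> inv ?z [^] ?q) \<otimes> (?x [^] i \<otimes> ?x [^] j)"
      by (simp add: cyclic_group_def)
  qed
qed

lemma homomorphic_image_trans:
  assumes "homomorphic_image K B A" "homomorphic_image K C B"
  shows "homomorphic_image K C A"
proof -
  obtain f where f: "f \<in> algebra_homs K A B" "f ` carrier A = carrier B"
    using assms(1) unfolding homomorphic_image_def by blast
  obtain g where g: "g \<in> algebra_homs K B C" "g ` carrier B = carrier C"
    using assms(2) unfolding homomorphic_image_def by blast
  have "g \<circ> f \<in> ring_hom A C"
    using f(1) g(1) by (auto simp: algebra_homs_def intro: ring_hom_trans)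
  moreover have "g \<circ> f \<in> linear_maps K A C"
    using linear_maps_comp[of f K A B g C] f(1) g(1) by (simp add: algebra_homs_def comp_def)
  moreover have "(g \<circ> f) ` carrier A = carrier C"
    using f(2) g(2) by (simp flip: image_image add: image_comp[symmetric])
  ultimately show ?thesis
    unfolding homomorphic_image_def algebra_homs_def by blast
qed

theorem projective_schur_algebra_imp_hopf_schur_algebra:
  fixes K :: "('k, 'm) ring_scheme" (structure)
  assumes "field K" and "projective_schur_algebra K A"
  shows "hopf_schur_algebra K A"
proof -
  interpret field K by fact
  from assms(2) obtain G :: "nat monoid" and \<alpha> where A: "central_simple K A"
    and G: "group G" "finite (carrier G)" and \<alpha>: "\<alpha> \<in> two_cocycles K G"
    and image: "homomorphic_image K A (twisted_group_algebra K G \<alpha>)"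
    unfolding projective_schur_algebra_def by blast
  interpret G: group G by (rule G)
  let ?l = "\<lambda>\<xi>. \<Otimes>\<rho>\<in>carrier G. \<alpha> \<xi> \<rho>"
  let ?\<mu> = "\<lambda>\<xi>. ?l \<xi> \<otimes> ?l \<xi>"
  \<comment> \<open>Twice the order of \<open>G\<close>, so that the index \<open>1\<close> is available even if \<open>G\<close> is trivial.\<close>
  let ?n = "2 * card (carrier G)"
  have l: "?l \<xi> \<in> Units K" if "\<xi> \<in> carrier G" for \<xi>
    using that by (intro finprod_Units G(2) two_cocycles_Units[OF \<alpha>])
  have "card (carrier G) > 0"
    using G(2) by (auto simp: card_gt_0_iff)
  then have n: "?n > 1" by simp
  have "\<alpha> \<xi> \<tau> [^] ?n \<otimes> ?\<mu> (\<xi> \<otimes>\<^bsub>G\<^esub> \<tau>) = ?\<mu> \<xi> \<otimes> ?\<mu> \<tau>"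
    if \<xi>: "\<xi> \<in> carrier G" and \<tau>: "\<tau> \<in> carrier G" for \<xi> \<tau>
  proof -
    let ?x = "\<alpha> \<xi> \<tau> [^] card (carrier G)"
    have closed: "?x \<in> carrier K" "?l \<xi> \<in> carrier K" "?l \<tau> \<in> carrier K" "?l (\<xi> \<otimes>\<^bsub>G\<^esub> \<tau>) \<in> carrier K"
      using \<xi> \<tau> two_cocycles_closed[OF \<alpha>] l by (auto intro: Units_closed)
    have "\<alpha> \<xi> \<tau> [^] ?n = ?x \<otimes> ?x"
      using \<xi> \<tau> two_cocycles_closed[OF \<alpha>] by (simp add: nat_pow_mult mult_2)
    then have "\<alpha> \<xi> \<tau> [^] ?n \<otimes> ?\<mu> (\<xi> \<otimes>\<^bsub>G\<^esub> \<tau>) =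
        (?x \<otimes> ?l (\<xi> \<otimes>\<^bsub>G\<^esub> \<tau>)) \<otimes> (?x \<otimes> ?l (\<xi> \<otimes>\<^bsub>G\<^esub> \<tau>))"
      using closed by (simp add: m_ac)
    also have "\<dots> = ?\<mu> \<xi> \<otimes> ?\<mu> \<tau>"
      unfolding two_cocycle_pow_card[OF G \<alpha> \<xi> \<tau>] using closed by (simp add: m_ac)
    finally show ?thesis .
  qed
  then interpret D: bicrossed_product K "cyclic_group ?n" G "\<lambda>i \<xi> \<tau>. \<alpha> \<xi> \<tau> [^] i"
    "\<lambda>\<xi> i j. inv (?\<mu> \<xi>) [^] ((i + j) div ?n)"
    using n l by (intro bicrossed_product_cyclic assms(1) G \<alpha>) auto
  have "1 \<in> carrier (cyclic_group ?n)"
    using n by (simp add: cyclic_group_def)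
  then have "homomorphic_image K (twisted_group_algebra K G \<alpha>) D.H"
    by (rule D.twisted_group_algebra_image) (simp add: two_cocycles_closed[OF \<alpha>])
  then have "homomorphic_image K A D.H"
    using image by (rule homomorphic_image_trans)
  then show ?thesis
    unfolding hopf_schur_algebra_def
    using A D.hopf_algebra_H D.finite_dimensional_H by blast
qed

theorem corollary1p5:
  fixes K :: "('k, 'm) ring_scheme"
  assumes "field K"
  shows "projective_schur_group K \<subseteq> hopf_schur_group K"
proof
  fix C assume "C \<in> projective_schur_group K"
  then have "C \<in> {C \<in> carrier (brauer_group K). \<exists>A \<in> C. hopf_schur_algebra K A}"
    using projective_schur_algebra_imp_hopf_schur_algebra[OF assms]
    unfolding projective_schur_group_def by blast
  then show "C \<in> hopf_schur_group K"
    unfolding hopf_schur_group_def by (rule generate.incl)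
qed

end
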